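(* Let $d\ge1$ and let $S$ be the operator $Sf(x)=|x|\,L^{-1/2}f(x)$, defined for $f\in\mathcal{D}$, where $L=-\Delta+|x|^2$ on $\mathbb{R}^d$. For every $1\le p<\infty$ we have $\|S\|_{p\to p}\le 3$, i.e. $S$ extends uniquely to a bounded operator on $L^p(\mathbb{R}^d)$ with norm at most $3$.
   Context: All functions are real-valued; $|\cdot|$ is the Euclidean norm; $\|\cdot\|_{p\to p}$ is the operator norm on $L^p(\mathbb{R}^d)$ (Lebesgue measure); $\langle\cdot,\cdot\rangle$ is the $L^2(\mathbb{R}^d)$ inner product; $\mathbb{N}=\{0,1,2,\dots\}$. Hermite functions: for $k\in\mathbb{N}$ and $x\in\mathbb{R}$, $h_k(x)=(2^k k!\sqrt{\pi})^{-1/2}e^{-x^2/2}H_k(x)$ with $H_k(x)=(-1)^ke^{x^2}\frac{d^k}{dx^k}e^{-x^2}$; for $n\in\mathbb{N}^d$ and $x\in\mathbb{R}^d$, $h_n(x)=h_{n_1}(x_1)\cdots h_{n_d}(x_d)$. Let $\mathcal{D}$ be the linear span of $\{h_n:n\in\mathbb{N}^d\}$; it is dense in $L^p(\mathbb{R}^d)$ for $1\le p<\infty$. The harmonic oscillator $L=-\Delta+|x|^2$ satisfies $Lh_n=\lambda_nh_n$ with $\lambda_n=2|n|+d$, $|n|=n_1+\dots+n_d$, and $L^{-1/2}f=\sum_{n}\lambda_n^{-1/2}\langle f,h_n\rangle h_n$ (a finite sum for $f\in\mathcal{D}$). A densely defined bounded operator is identified with its unique bounded extension. *)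

theory Defs
  imports "HOL-Analysis.Analysis"
begin

definition hermite_poly :: "nat \<Rightarrow> real \<Rightarrow> real" where
  "hermite_poly k x = (-1) ^ k * exp (x\<^sup>2) * (deriv ^^ k) (\<lambda>t. exp (- t\<^sup>2)) x"

definition hermite_fun1 :: "nat \<Rightarrow> real \<Rightarrow> real" where
  "hermite_fun1 k x =
     (2 ^ k * fact k * sqrt pi) powr (- 1 / 2) * exp (- x\<^sup>2 / 2) * hermite_poly k x"

definition hermite_fun :: "nat ^ 'd \<Rightarrow> real ^ 'd \<Rightarrow> real" where
  "hermite_fun n x = (\<Prod>i\<in>UNIV. hermite_fun1 (n $ i) (x $ i))"

definition hermite_span :: "(real ^ 'd \<Rightarrow> real) set" where
  "hermite_span = {f. \<exists>A c. finite A \<and> f = (\<lambda>x. \<Sum>n\<in>A. c n * hermite_fun n x)}"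

text \<open>The eigenvalue of \<open>L = -\<Delta> + |x|\<^sup>2\<close> belonging to \<open>hermite_fun n\<close>.\<close>

definition hermite_eigenvalue :: "nat ^ 'd \<Rightarrow> real" where
  "hermite_eigenvalue n = 2 * real (\<Sum>i\<in>UNIV. n $ i) + real CARD('d)"

definition L2_inner :: "(real ^ 'd \<Rightarrow> real) \<Rightarrow> (real ^ 'd \<Rightarrow> real) \<Rightarrow> real" where
  "L2_inner f g = (LINT x|lebesgue. f x * g x)"

text \<open>
  The operator \<open>L\<close> to the power \<open>-1/2\<close>, by its expansion in Hermite functions. The sum runs
  over the indices with nonzero coefficient. It is meaningful for \<open>f \<in> hermite_span\<close>, where by
  orthonormality only finitely many coefficients are nonzero; elsewhere the value is irrelevant.
\<close>

definition L_inv_sqrt :: "(real ^ 'd \<Rightarrow> real) \<Rightarrow> real ^ 'd \<Rightarrow> real" where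
  "L_inv_sqrt f x =
     (\<Sum>n | L2_inner f (hermite_fun n) \<noteq> 0.
        hermite_eigenvalue n powr (- 1 / 2) * L2_inner f (hermite_fun n) * hermite_fun n x)"

definition S_op :: "(real ^ 'd \<Rightarrow> real) \<Rightarrow> real ^ 'd \<Rightarrow> real" where
  "S_op f x = norm x * L_inv_sqrt f x"

text \<open>
  Elements of \<open>L\<^sup>p\<close> are represented by functions, and equality in \<open>L\<^sup>p\<close> is equality almost
  everywhere. An operator on \<open>L\<^sup>p\<close> is a map on representatives that respects this equality and is
  linear up to it.
\<close>

definition Lp_space :: "real \<Rightarrow> (real ^ 'd \<Rightarrow> real) set" where
  "Lp_space p =
     {f \<in> borel_measurable lebesgue. integrable lebesgue (\<lambda>x. \<bar>f x\<bar> powr p)}"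

definition Lp_norm :: "real \<Rightarrow> (real ^ 'd \<Rightarrow> real) \<Rightarrow> real" where
  "Lp_norm p f = (LINT x|lebesgue. \<bar>f x\<bar> powr p) powr (1 / p)"

definition Lp_eq :: "(real ^ 'd \<Rightarrow> real) \<Rightarrow> (real ^ 'd \<Rightarrow> real) \<Rightarrow> bool" where
  "Lp_eq f g \<longleftrightarrow> (AE x in lebesgue. f x = g x)"

definition Lp_bounded_operator ::
    "real \<Rightarrow> ((real ^ 'd \<Rightarrow> real) \<Rightarrow> real ^ 'd \<Rightarrow> real) \<Rightarrow> bool" where
  "Lp_bounded_operator p T \<longleftrightarrow>
     (\<forall>f\<in>Lp_space p. T f \<in> Lp_space p) \<and>
     (\<forall>f\<in>Lp_space p. \<forall>g\<in>Lp_space p. Lp_eq f g \<longrightarrow> Lp_eq (T f) (T g)) \<and>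
     (\<forall>f\<in>Lp_space p. \<forall>g\<in>Lp_space p. Lp_eq (T (\<lambda>x. f x + g x)) (\<lambda>x. T f x + T g x)) \<and>
     (\<forall>c. \<forall>f\<in>Lp_space p. Lp_eq (T (\<lambda>x. c * f x)) (\<lambda>x. c * T f x)) \<and>
     (\<exists>C. \<forall>f\<in>Lp_space p. Lp_norm p (T f) \<le> C * Lp_norm p f)"

text \<open>
  The analogue of \<^const>\<open>onorm\<close>. As there, the supremum is meaningful for bounded operators, and
  the quotient is 0 when \<open>Lp_norm p f = 0\<close>.
\<close>

definition Lp_onorm :: "real \<Rightarrow> ((real ^ 'd \<Rightarrow> real) \<Rightarrow> real ^ 'd \<Rightarrow> real) \<Rightarrow> real" where
  "Lp_onorm p T = (SUP f\<in>Lp_space p. Lp_norm p (T f) / Lp_norm p f)"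

definition Lp_bounded_extension ::
    "real \<Rightarrow> (real ^ 'd \<Rightarrow> real) set \<Rightarrow> ((real ^ 'd \<Rightarrow> real) \<Rightarrow> real ^ 'd \<Rightarrow> real) \<Rightarrow>
     ((real ^ 'd \<Rightarrow> real) \<Rightarrow> real ^ 'd \<Rightarrow> real) \<Rightarrow> bool" where
  "Lp_bounded_extension p D S T \<longleftrightarrow>
     Lp_bounded_operator p T \<and> (\<forall>f\<in>D. Lp_eq (T f) (S f))"

end

theory Submission
  imports Defs "HOL-Probability.Distributions"
begin

text \<open>
  Subordination, \<open>\<lambda>\<^sup>-\<^sup>1\<^sup>/\<^sup>2 = \<pi>\<^sup>-\<^sup>1\<^sup>/\<^sup>2 \<integral> t\<^sup>-\<^sup>1\<^sup>/\<^sup>2 exp (- t \<lambda>) dt\<close>, writes \<open>S\<close> as integration against the positive kernel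
  \<open>|x| \<pi>\<^sup>-\<^sup>1\<^sup>/\<^sup>2 \<integral> t\<^sup>-\<^sup>1\<^sup>/\<^sup>2 M\<^sub>t(x, y) dt\<close>, where \<open>M\<^sub>t\<close> is Mehler's kernel. Up to the factor
  \<open>cosh (2t)\<^sup>-\<^sup>d\<^sup>/\<^sup>2 exp (- tanh (2t) |x|\<^sup>2 / 2)\<close>, \<open>M\<^sub>t(x, \<cdot>)\<close> is a Gaussian density with mean \<open>x / cosh (2t)\<close>
  and variance \<open>tanh (2t)\<close> in each coordinate, so both marginals of the kernel reduce to
  one-dimensional integrals, bounded by 1.7 and by 1.7 + 1.26 in every dimension. Schur's test then
  gives the norm bound 3 on all \<open>L\<^sup>p\<close>, and the integral operator itself is the extension.

  Uniqueness is the density of the Hermite span. The bounded functions that multiply the closure of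
  the span into itself form an algebra that is closed under bounded pointwise limits. It contains
  the functions \<open>sin (c x\<^sub>i)\<close>, hence \<open>g (x\<^sub>i) = lim g (k sin (x\<^sub>i / k))\<close> for bounded continuous \<open>g\<close>, hence
  the indicators of all Borel sets; and every \<open>f\<close> is a multiple of the Gaussian \<open>h\<^sub>0\<close>.
\<close>

section \<open>Hermite polynomials and the one-dimensional Mehler kernel\<close>

text \<open>The kernel of S is not symmetric. Integrating it in y leaves |x| outside, while
  integrating it in x averages |x| over a Gaussian around y / cosh (2t), of mean size at most |y|
  plus a fluctuation sqrt (d tanh (2t)). The first part obeys the same bound as the row integral.
  The fluctuation grows with d, and it is tamed by the factor cosh (2t)^(-d/2), which confines t to
  the scale d^(-1/2). The constants round sqrt (4/3) + 4 / (e sqrt (3 pi)) up to 1.7 and sqrt (pi /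
  2) up to 1.26, so the bound 3 leaves little room. Mehler's formula is not derived from a
  generating function: the kernel is given explicitly, and its action on Hermite functions is
  checked by completing the square and integrating polynomials against Gaussians by parts. In the
  density proof the obstacle is that the coordinates multiply the span into itself but are
  unbounded. The sine is bounded, and its Taylor series against a Gaussian is dominated; k sin (u /
  k) tends to u and recovers the coordinate in the limit.\<close>

fun hpoly :: "nat \<Rightarrow> real poly" where
  "hpoly 0 = 1"
| "hpoly (Suc k) = [:0, 2:] * hpoly k - pderiv (hpoly k)"

lemma higher_deriv_gauss:
  "(deriv ^^ k) (\<lambda>t::real. exp (- t\<^sup>2)) = (\<lambda>x. (-1) ^ k * poly (hpoly k) x * exp (- x\<^sup>2))"
proof (induction k)
  case (Suc k)
  have "deriv (\<lambda>x. (-1) ^ k * poly (hpoly k) x * exp (- x\<^sup>2)) x =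
      (-1) ^ Suc k * poly (hpoly (Suc k)) x * exp (- x\<^sup>2)" for x :: real
    by (rule DERIV_imp_deriv)
      (auto intro!: derivative_eq_intros simp: algebra_simps)
  then show ?case using Suc by (auto simp del: hpoly.simps)
qed simp

lemma hermite_poly_eq: "hermite_poly k x = poly (hpoly k) x"
proof -
  have "exp (x\<^sup>2) * exp (- x\<^sup>2) = (1::real)" by (simp flip: exp_add)
  moreover have "(-1::real) ^ k * (-1) ^ k = 1" by (simp flip: power_mult_distrib)
  ultimately show ?thesis
    unfolding hermite_poly_def higher_deriv_gauss
    by (metis (no_types, opaque_lifting) mult.assoc mult.commute mult.left_neutral)
qed

text \<open>Differentiating the recursion for H(k+2) gives 2 H(k+1) + 2x H'(k+1) - H''(k+1). The
  induction hypothesis turns the last two terms into 2(k+1) times 2x H(k) - H'(k), which is H(k+1)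
  again.\<close>

lemma pderiv_hpoly_Suc: "pderiv (hpoly (Suc k)) = smult (2 * real (Suc k)) (hpoly k)"
proof (induction k)
  case (Suc k)
  have "pderiv (hpoly (Suc (Suc k))) =
      smult 2 (hpoly (Suc k)) + [:0, 2:] * pderiv (hpoly (Suc k)) - pderiv (pderiv (hpoly (Suc k)))"
    unfolding hpoly.simps(2)[of "Suc k"] pderiv_diff pderiv_mult
    by (simp add: pderiv_pCons del: hpoly.simps)
  also have "\<dots> = smult 2 (hpoly (Suc k)) + smult (2 * real (Suc k)) (hpoly (Suc k))"
    by (simp only: Suc pderiv_smult) (simp add: smult_diff_right algebra_simps)
  also have "\<dots> = smult (2 * real (Suc (Suc k))) (hpoly (Suc k))"
    by (simp flip: smult_add_left add: algebra_simps del: hpoly.simps)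
  finally show ?case .
qed (simp add: pderiv_pCons)

section \<open>Gaussian means of polynomials\<close>

text \<open>Expectation under the standard normal law as a linear functional on polynomials, so that
  Gaussian integrals become algebra in the polynomial ring.\<close>

definition gauss_mean :: "real poly \<Rightarrow> real" where
  "gauss_mean P = (LINT z|lborel. std_normal_density z * poly P z)"

lemma integrable_gauss_poly: "integrable lborel (\<lambda>z. std_normal_density z * poly P z)"
  unfolding poly_altdef sum_distrib_left
  by (intro Bochner_Integration.integrable_sum)
    (use integrable_std_normal_moment in \<open>simp add: mult.left_commute\<close>)

lemma gauss_mean_add: "gauss_mean (P + Q) = gauss_mean P + gauss_mean Q"
  unfolding gauss_mean_def poly_add distrib_left
  by (rule Bochner_Integration.integral_add[OF integrable_gauss_poly integrable_gauss_poly])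

lemma gauss_mean_smult: "gauss_mean (smult c P) = c * gauss_mean P"
  unfolding gauss_mean_def by (simp add: mult.left_commute)

lemma gauss_mean_diff: "gauss_mean (P - Q) = gauss_mean P - gauss_mean Q"
  using gauss_mean_add[of "P - Q" Q] by simp

lemma gauss_mean_sum: "gauss_mean (sum P A) = (\<Sum>i\<in>A. gauss_mean (P i))"
proof (induction A rule: infinite_finite_induct)
qed (auto simp: gauss_mean_add, auto simp: gauss_mean_def)

lemma gauss_mean_1: "gauss_mean 1 = 1"
  using integral_normal_density[of 1 0] by (simp add: gauss_mean_def)

text \<open>Odd moments vanish, and the even ones, (2j)! / (2^j j!), grow by the factor 2j + 1. At k
  = 0 the truncated \<open>k - 1\<close> is harmless, being multiplied by
  \<open>real k\<close>.\<close>

lemma gauss_mean_monom_rec: "gauss_mean (monom 1 (Suc k)) = real k * gauss_mean (monom 1 (k - 1))"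
proof (cases "even k")
  case True
  then obtain j where j: "k = 2 * j" by (auto elim: evenE)
  have "gauss_mean (monom 1 (Suc k)) = 0"
    using integral_std_normal_moment_odd[of j] by (simp add: gauss_mean_def poly_monom j)
  moreover have "real k * gauss_mean (monom 1 (k - 1)) = 0"
  proof (cases j)
    case (Suc i)
    then have "k - 1 = 2 * i + 1" using j by simp
    then show ?thesis
      using integral_std_normal_moment_odd[of i] by (simp add: gauss_mean_def poly_monom)
  qed (simp add: j)
  ultimately show ?thesis by simp
next
  case False
  then obtain j where j: "k = 2 * j + 1" by (auto elim: oddE)
  have "gauss_mean (monom 1 (Suc k)) = fact (2 * Suc j) / (2 ^ Suc j * fact (Suc j))"
    using integral_std_normal_moment_even[of "Suc j"] by (simp add: gauss_mean_def poly_monom j)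
  moreover have "gauss_mean (monom 1 (k - 1)) = fact (2 * j) / (2 ^ j * fact j)"
    using integral_std_normal_moment_even[of j] by (simp add: gauss_mean_def poly_monom j)
  moreover have "fact (2 * Suc j) / (2 ^ Suc j * fact (Suc j)) =
      real (2 * j + 1) * (fact (2 * j) / (2 ^ j * fact j))"
  proof -
    have "fact (2 * Suc j) = 2 * real (Suc j) * (real (2 * j + 1) * fact (2 * j))"
      by (simp add: algebra_simps)
    moreover have "2 ^ Suc j * fact (Suc j) = 2 * real (Suc j) * (2 ^ j * fact j)"
      by simp
    ultimately show ?thesis by (simp only: mult_divide_mult_cancel_left_if times_divide_eq_right) simp
  qed
  ultimately show ?thesis by (simp add: j)
qed

text \<open>Gaussian integration by parts, reduced to the recursion of the moments.\<close>

lemma gauss_mean_by_parts: "gauss_mean ([:0, 1:] * P) = gauss_mean (pderiv P)"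
proof -
  have *: "gauss_mean ([:0, 1:] * monom c k) = gauss_mean (pderiv (monom c k))" for c k
  proof -
    have "[:0, 1:] * monom c k = smult c (monom 1 (Suc k))"
      by (simp add: smult_monom monom_Suc)
    moreover have "pderiv (monom c k) = smult c (smult (real k) (monom 1 (k - 1)))"
      by (simp add: pderiv_monom smult_monom)
    ultimately show ?thesis by (simp only: gauss_mean_smult gauss_mean_monom_rec)
  qed
  have "pderiv (\<Sum>i\<in>A. f i) = (\<Sum>i\<in>A. pderiv (f i))" for f :: "nat \<Rightarrow> real poly" and A
    by (induction A rule: infinite_finite_induct) (auto simp: pderiv_add)
  then have "gauss_mean ([:0, 1:] * (\<Sum>i\<le>degree P. monom (coeff P i) i)) =
      gauss_mean (pderiv (\<Sum>i\<le>degree P. monom (coeff P i) i))"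
    by (simp only: sum_distrib_left gauss_mean_sum *)
  then show ?thesis by (simp only: poly_as_sum_of_monoms)
qed

text \<open>Expectation under the normal law with mean \<mu> and variance \<sigma>^2. Defining it by
  substitution keeps its calculus purely algebraic; the density only returns in
  \<open>integral_normal_poly\<close>.\<close>

definition affine_mean :: "real \<Rightarrow> real \<Rightarrow> real poly \<Rightarrow> real" where
  "affine_mean \<mu> \<sigma> P = gauss_mean (P \<circ>\<^sub>p [:\<mu>, \<sigma>:])"

text \<open>One factor \<sigma> comes from writing the variable as \<mu> + \<sigma> z, the other
  from the chain rule after integrating by parts in z.\<close>

lemma affine_mean_by_parts:
  "affine_mean \<mu> \<sigma> ([:0, 1:] * P) = \<mu> * affine_mean \<mu> \<sigma> P + \<sigma>\<^sup>2 * affine_mean \<mu> \<sigma> (pderiv P)"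
proof -
  have "([:0, 1:] * P) \<circ>\<^sub>p [:\<mu>, \<sigma>:] =
      smult \<mu> (P \<circ>\<^sub>p [:\<mu>, \<sigma>:]) + smult \<sigma> ([:0, 1:] * (P \<circ>\<^sub>p [:\<mu>, \<sigma>:]))"
    by (simp add: pcompose_mult pcompose_pCons)
  moreover have "pderiv (P \<circ>\<^sub>p [:\<mu>, \<sigma>:]) = smult \<sigma> (pderiv P \<circ>\<^sub>p [:\<mu>, \<sigma>:])"
    by (simp add: pderiv_pcompose pderiv_pCons)
  ultimately show ?thesis
    by (simp only: affine_mean_def gauss_mean_add gauss_mean_smult gauss_mean_by_parts)
      (simp add: power2_eq_square)
qed

lemma affine_mean_diff: "affine_mean \<mu> \<sigma> (P - Q) = affine_mean \<mu> \<sigma> P - affine_mean \<mu> \<sigma> Q"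
  by (simp add: affine_mean_def pcompose_diff gauss_mean_diff)

lemma affine_mean_smult: "affine_mean \<mu> \<sigma> (smult c P) = c * affine_mean \<mu> \<sigma> P"
  by (simp add: affine_mean_def pcompose_smult gauss_mean_smult)

lemma affine_mean_1: "affine_mean \<mu> \<sigma> 1 = 1"
  using gauss_mean_1 by (simp add: affine_mean_def one_pCons)

text \<open>The coefficient of the derivative term vanishes at variance 1/2, the orthogonality
  weight, and equals r^2 for the Mehler kernel.\<close>

lemma affine_mean_hpoly_Suc:
  "affine_mean \<mu> \<sigma> (hpoly (Suc k)) = 2 * \<mu> * affine_mean \<mu> \<sigma> (hpoly k)
     - (1 - 2 * \<sigma>\<^sup>2) * affine_mean \<mu> \<sigma> (pderiv (hpoly k))"
proof -
  have "hpoly (Suc k) = smult 2 ([:0, 1:] * hpoly k) - pderiv (hpoly k)" by simp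
  then show ?thesis
    by (simp only: affine_mean_diff affine_mean_smult affine_mean_by_parts)
      (simp add: algebra_simps)
qed

text \<open>The Ornstein-Uhlenbeck semigroup acts diagonally on the Hermite polynomials.\<close>

lemma affine_mean_hpoly:
  assumes "1 - 2 * \<sigma>\<^sup>2 = r\<^sup>2"
  shows "affine_mean (r * x) \<sigma> (hpoly k) = r ^ k * poly (hpoly k) x"
proof (induction k rule: less_induct)
  case (less k)
  show ?case
  proof (cases k)
    case (Suc j)
    have IH: "affine_mean (r * x) \<sigma> (hpoly j) = r ^ j * poly (hpoly j) x"
      using less Suc by simp
    \<comment> \<open>The derivative lowers the degree, so the induction hypothesis supplies r^i
      with j = i + 1, and the extra r^2 lifts it to the power wanted.\<close>
    have "r\<^sup>2 * affine_mean (r * x) \<sigma> (pderiv (hpoly j)) = r ^ Suc j * poly (pderiv (hpoly j)) x"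
    proof (cases j)
      case (Suc i)
      have "affine_mean (r * x) \<sigma> (hpoly i) = r ^ i * poly (hpoly i) x"
        using less Suc \<open>k = Suc j\<close> by simp
      then show ?thesis
        by (simp only: Suc pderiv_hpoly_Suc affine_mean_smult poly_smult)
          (simp add: power2_eq_square)
    next
      case 0
      then show ?thesis by (simp add: affine_mean_def gauss_mean_def)
    qed
    then show ?thesis
      unfolding Suc affine_mean_hpoly_Suc assms IH by (simp add: algebra_simps)
  qed (simp add: affine_mean_1)
qed

lemma normal_density_affine_std:
  "\<sigma> > 0 \<Longrightarrow> \<sigma> * normal_density \<mu> \<sigma> (\<mu> + \<sigma> * z) = std_normal_density z"
  by (simp add: normal_density_def real_sqrt_mult power_mult_distrib)

lemma integral_normal_poly:
  assumes "\<sigma> > 0"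
  shows "integrable lborel (\<lambda>v. normal_density \<mu> \<sigma> v * poly P v)"
    and "(LINT v|lborel. normal_density \<mu> \<sigma> v * poly P v) = affine_mean \<mu> \<sigma> P"
proof -
  have eq: "\<sigma> * (normal_density \<mu> \<sigma> (\<mu> + \<sigma> * z) * poly P (\<mu> + \<sigma> * z)) =
      std_normal_density z * poly (P \<circ>\<^sub>p [:\<mu>, \<sigma>:]) z" for z
    using normal_density_affine_std[OF assms, of \<mu> z]
    by (simp add: poly_pcompose mult.assoc mult.commute[of z])
  have "integrable lborel (\<lambda>z. \<sigma> * (normal_density \<mu> \<sigma> (\<mu> + \<sigma> * z) * poly P (\<mu> + \<sigma> * z)))"
    unfolding eq by (rule integrable_gauss_poly)
  then show "integrable lborel (\<lambda>v. normal_density \<mu> \<sigma> v * poly P v)"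
    using assms lborel_integrable_real_affine_iff[of \<sigma> "\<lambda>v. normal_density \<mu> \<sigma> v * poly P v" \<mu>] by simp
  show "(LINT v|lborel. normal_density \<mu> \<sigma> v * poly P v) = affine_mean \<mu> \<sigma> P"
    using assms by (subst lborel_integral_real_affine[where c = \<sigma> and t = \<mu>])
      (simp_all add: affine_mean_def gauss_mean_def eq flip: integral_mult_right_zero)
qed

text \<open>At mean 0 and variance 1/2 the map from Q to 2x Q - Q', which builds
  \<open>hpoly\<close>, is adjoint to differentiation. Moving it across lowers both degrees by one
  and produces the factor 2n.\<close>

lemma affine_mean_hpoly_mult:
  assumes "2 * \<sigma>\<^sup>2 = 1"
  shows "affine_mean 0 \<sigma> (hpoly m * hpoly n) = (if m = n then 2 ^ n * fact n else 0)"
proof (induction m arbitrary: n)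
  case 0
  show ?case
    using affine_mean_hpoly[of \<sigma> 0 0 n] assms by (cases n) (simp_all add: affine_mean_1)
next
  case (Suc m)
  have "hpoly (Suc m) * hpoly n =
      smult 2 ([:0, 1:] * (hpoly m * hpoly n)) - pderiv (hpoly m) * hpoly n"
    by (simp add: algebra_simps)
  then have "affine_mean 0 \<sigma> (hpoly (Suc m) * hpoly n) =
      affine_mean 0 \<sigma> (pderiv (hpoly m * hpoly n)) - affine_mean 0 \<sigma> (pderiv (hpoly m) * hpoly n)"
    using assms by (simp only: affine_mean_diff affine_mean_smult affine_mean_by_parts)
      (simp flip: mult.assoc)
  also have "\<dots> = affine_mean 0 \<sigma> (hpoly m * pderiv (hpoly n))"
    by (simp flip: affine_mean_diff add: pderiv_mult algebra_simps)
  also have "\<dots> = (if Suc m = n then 2 ^ n * fact n else 0)"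
  proof (cases n)
    case (Suc j)
    show ?thesis using Suc.IH[of j]
      by (simp only: Suc pderiv_hpoly_Suc mult_smult_right affine_mean_smult) (simp add: algebra_simps)
  qed (simp add: affine_mean_def gauss_mean_def)
  finally show ?case .
qed

section \<open>Normalised Hermite functions in one variable\<close>

definition hnorm :: "nat \<Rightarrow> real" where
  "hnorm k = (2 ^ k * fact k * sqrt pi) powr (- 1 / 2)"

lemma hermite_fun1_eq: "hermite_fun1 k x = hnorm k * exp (- x\<^sup>2 / 2) * poly (hpoly k) x"
  by (simp add: hermite_fun1_def hermite_poly_eq hnorm_def)

lemma hnorm_pos: "hnorm k > 0"
  by (simp add: hnorm_def)

lemma hnorm_square: "(hnorm k)\<^sup>2 * (2 ^ k * fact k * sqrt pi) = 1"
proof -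
  define c where "c = 2 ^ k * fact k * sqrt pi"
  have "c > 0" by (simp add: c_def)
  then have "(hnorm k)\<^sup>2 = inverse c"
    unfolding hnorm_def c_def[symmetric]
    by (simp add: powr_minus powr_half_sqrt power_inverse)
  then show ?thesis using \<open>c > 0\<close> unfolding c_def[symmetric] by simp
qed

lemma integral_hermite_fun1_mult:
  shows "integrable lborel (\<lambda>x. hermite_fun1 m x * hermite_fun1 n x)"
    and "(LINT x|lborel. hermite_fun1 m x * hermite_fun1 n x) = (if m = n then 1 else 0)"
proof -
  \<comment> \<open>The weight exp (-x^2) is sqrt pi times the centred normal density of variance
    1/2.\<close>
  define \<sigma> :: real where "\<sigma> = sqrt (1 / 2)"
  have \<sigma>: "\<sigma> > 0" "2 * \<sigma>\<^sup>2 = 1" by (simp_all add: \<sigma>_def)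
  have eq: "hermite_fun1 m x * hermite_fun1 n x =
      (hnorm m * hnorm n * sqrt pi) * (normal_density 0 \<sigma> x * poly (hpoly m * hpoly n) x)" for x
  proof -
    have *: "exp (- x\<^sup>2 / 2) * exp (- x\<^sup>2 / 2) = exp (- x\<^sup>2)" by (simp flip: exp_add)
    have **: "sqrt pi * normal_density 0 \<sigma> x = exp (- x\<^sup>2)"
      by (simp add: normal_density_def \<sigma>_def)
    show ?thesis
    proof -
      have "hermite_fun1 m x * hermite_fun1 n x = hnorm m * hnorm n *
          (exp (- x\<^sup>2 / 2) * exp (- x\<^sup>2 / 2)) * poly (hpoly m * hpoly n) x"
        by (simp add: hermite_fun1_eq mult_ac del: exp_add)
      also have "exp (- x\<^sup>2 / 2) * exp (- x\<^sup>2 / 2) = sqrt pi * normal_density 0 \<sigma> x"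
        using * ** by simp
      finally show ?thesis by (simp only: mult.assoc)
    qed
  qed
  show "integrable lborel (\<lambda>x. hermite_fun1 m x * hermite_fun1 n x)"
    unfolding eq by (intro integrable_mult_right integral_normal_poly \<sigma>)
  show "(LINT x|lborel. hermite_fun1 m x * hermite_fun1 n x) = (if m = n then 1 else 0)"
    using hnorm_square[of n]
    unfolding eq integral_mult_right_zero integral_normal_poly[OF \<sigma>(1)] affine_mean_hpoly_mult[OF \<sigma>(2)]
    by (auto simp: algebra_simps power2_eq_square)
qed

text \<open>The recursion reads 2x H(k) = H(k+1) + H'(k), and H'(k) is a multiple of H(k-1); at k =
  0 that multiple is 0. Hence multiplication by a coordinate preserves the Hermite span, which
  starts the density argument.\<close>

lemma hermite_fun1_times:
  "\<exists>a b. \<forall>x. x * hermite_fun1 k x = a * hermite_fun1 (Suc k) x + b * hermite_fun1 (k - 1) x"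
proof -
  have "\<exists>b. \<forall>x. poly (pderiv (hpoly k)) x = b * poly (hpoly (k - 1)) x"
  proof (cases k)
    case (Suc j)
    show ?thesis unfolding Suc pderiv_hpoly_Suc by auto
  qed auto
  then obtain b where b: "\<And>x. poly (pderiv (hpoly k)) x = b * poly (hpoly (k - 1)) x" by blast
  have "x * hermite_fun1 k x =
     (hnorm k / (2 * hnorm (Suc k))) * hermite_fun1 (Suc k) x +
     (b * hnorm k / (2 * hnorm (k - 1))) * hermite_fun1 (k - 1) x" for x
    using hnorm_pos[of k] hnorm_pos[of "Suc k"] hnorm_pos[of "k - 1"]
    by (simp add: hermite_fun1_eq b field_simps)
  then show ?thesis by blast
qed

text \<open>Mehler's kernel, the integral kernel of \<open>exp (- t L)\<close> in dimension one.\<close>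

definition mehler1 :: "real \<Rightarrow> real \<Rightarrow> real \<Rightarrow> real" where
  "mehler1 t u v = exp (- ((u\<^sup>2 + v\<^sup>2) * cosh (2 * t) - 2 * u * v) / (2 * sinh (2 * t)))
     / sqrt (2 * pi * sinh (2 * t))"

lemma mehler1_commute: "mehler1 t u v = mehler1 t v u"
  by (simp add: mehler1_def algebra_simps)

text \<open>Completing the square in v, with cosh^2 = 1 + sinh^2. This form gives masses and
  moments; \<open>mehler1_times_gauss\<close> is the form that acts on Hermite functions.\<close>

lemma mehler1_eq_normal:
  assumes "t > 0"
  shows "mehler1 t u v = cosh (2 * t) powr (- 1 / 2) * exp (- tanh (2 * t) * u\<^sup>2 / 2) *
    normal_density (u / cosh (2 * t)) (sqrt (tanh (2 * t))) v"
proof -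
  define s c where "s = sinh (2 * t)" and "c = cosh (2 * t)"
  have pos: "s > 0" "c > 0" using assms by (auto simp: s_def c_def)
  have sc: "c\<^sup>2 = s\<^sup>2 + 1" by (simp add: s_def c_def cosh_square_eq)
  have th: "tanh (2 * t) = s / c" by (simp add: tanh_def s_def c_def)
  have "- ((u\<^sup>2 + v\<^sup>2) * c - 2 * u * v) / (2 * s) = - (s / c) * u\<^sup>2 / 2 + - (v - u / c)\<^sup>2 / (2 * (s / c))"
  proof -
    have "- (s / c) * u\<^sup>2 / 2 + - (v - u / c)\<^sup>2 / (2 * (s / c)) =
       - (s\<^sup>2 * u\<^sup>2 + (v * c - u)\<^sup>2) / (2 * s * c)"
      using pos by (simp add: field_simps power2_eq_square)
    also have "s\<^sup>2 * u\<^sup>2 + (v * c - u)\<^sup>2 = c * ((u\<^sup>2 + v\<^sup>2) * c - 2 * u * v)"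
    proof -
      have s2: "s\<^sup>2 = c\<^sup>2 - 1" using sc by simp
      show ?thesis unfolding s2 by (simp add: algebra_simps power2_eq_square)
    qed
    finally have "- (s / c) * u\<^sup>2 / 2 + - (v - u / c)\<^sup>2 / (2 * (s / c)) =
      - (c * ((u\<^sup>2 + v\<^sup>2) * c - 2 * u * v)) / (c * (2 * s))" by (simp add: mult_ac)
    then show ?thesis using pos by (simp only: mult_minus_right[symmetric] mult_divide_mult_cancel_left_if) simp
  qed
  moreover have "sqrt (2 * pi * s) = sqrt c * sqrt (2 * pi * (s / c))"
    using pos by (simp flip: real_sqrt_mult)
  ultimately have S: "sqrt (2 * pi * s) = sqrt c * sqrt (2 * pi * (s / c))"
    and E: "exp (- ((u\<^sup>2 + v\<^sup>2) * c - 2 * u * v) / (2 * s)) =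
      exp (- (s / c) * u\<^sup>2 / 2) * exp (- (v - u / c)\<^sup>2 / (2 * (s / c)))"
    by (simp_all only: flip: exp_add)
  have P: "c powr (- 1 / 2) = 1 / sqrt c"
    using powr_minus[of c "1 / 2"] pos by (simp add: powr_half_sqrt inverse_eq_divide)
  have sq: "(sqrt (s / c))\<^sup>2 = s / c" using pos by simp
  show ?thesis
    unfolding mehler1_def normal_density_def th s_def[symmetric] c_def[symmetric] sq P S E by simp
qed

text \<open>A second completion of the square, which absorbs the Gaussian factor of the Hermite
  functions. With r = exp (-2t), the mean r u and the variance (1 - r^2) / 2 fit the hypothesis 1 -
  2 \<sigma>^2 = r^2 of \<open>affine_mean_hpoly\<close>.\<close>

lemma mehler1_times_gauss:
  assumes "t > 0"
  shows "mehler1 t u v * exp (- v\<^sup>2 / 2) = exp (- t) * exp (- u\<^sup>2 / 2) *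
    normal_density (exp (- 2 * t) * u) (sqrt ((1 - exp (- 4 * t)) / 2)) v"
proof -
  define s c r where "s = sinh (2 * t)" and "c = cosh (2 * t)" and "r = exp (- 2 * t)"
  have r: "0 < r" "r < 1" using assms by (auto simp: r_def)
  have r2: "exp (- 4 * t) = r\<^sup>2" by (simp add: r_def power2_eq_square flip: exp_add)
  have r_inv: "exp (2 * t) = 1 / r" "exp (- (2 * t)) = r" by (simp_all add: r_def exp_minus divide_inverse)
  have s: "s = (1 - r\<^sup>2) / (2 * r)" and c: "c = (1 + r\<^sup>2) / (2 * r)"
    using r unfolding s_def c_def sinh_def cosh_def r_inv
    by (simp_all add: field_simps power2_eq_square)
  have d: "1 - r\<^sup>2 > 0" using r by (simp add: power_less_one_iff abs_square_less_1)
  have "- ((u\<^sup>2 + v\<^sup>2) * c - 2 * u * v) / (2 * s) + - v\<^sup>2 / 2 =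
     - u\<^sup>2 / 2 + - (v - r * u)\<^sup>2 / (2 * ((1 - r\<^sup>2) / 2))"
  proof -
    have "- ((u\<^sup>2 + v\<^sup>2) * c - 2 * u * v) / (2 * s) =
       - ((u\<^sup>2 + v\<^sup>2) * (1 + r\<^sup>2) - 4 * r * u * v) / (2 * (1 - r\<^sup>2))"
      using r d by (simp add: s c divide_simps)
    also have "\<dots> = - u\<^sup>2 / 2 + - (v - r * u)\<^sup>2 / (2 * ((1 - r\<^sup>2) / 2)) - - v\<^sup>2 / 2"
      using d by (simp add: divide_simps) (simp add: algebra_simps power2_eq_square)
    finally show ?thesis by simp
  qed
  \<comment> \<open>Since sinh (2t) = (1 - r^2) / (2r), the two normalisations differ by sqrt r =
    exp (-t), the decay of the ground state.\<close>
  moreover have "sqrt (2 * pi * ((1 - r\<^sup>2) / 2)) = exp (- t) * sqrt (2 * pi * s)"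
  proof -
    have "exp (- t) = sqrt r" by (rule real_sqrt_unique[symmetric]) (simp_all add: r_def power2_eq_square flip: exp_add)
    then show ?thesis using r by (simp add: s flip: real_sqrt_mult)
  qed
  ultimately have S: "sqrt (2 * pi * ((1 - r\<^sup>2) / 2)) = exp (- t) * sqrt (2 * pi * s)"
    and E: "exp (- ((u\<^sup>2 + v\<^sup>2) * c - 2 * u * v) / (2 * s)) * exp (- v\<^sup>2 / 2) =
      exp (- u\<^sup>2 / 2) * exp (- (v - r * u)\<^sup>2 / (2 * ((1 - r\<^sup>2) / 2)))"
    by (simp_all only: flip: exp_add)
  have sq: "(sqrt ((1 - r\<^sup>2) / 2))\<^sup>2 = (1 - r\<^sup>2) / 2" using d by simp
  have "mehler1 t u v * exp (- v\<^sup>2 / 2) =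
      exp (- u\<^sup>2 / 2) * exp (- (v - r * u)\<^sup>2 / (2 * ((1 - r\<^sup>2) / 2))) / sqrt (2 * pi * s)"
    unfolding mehler1_def s_def[symmetric] c_def[symmetric] E[symmetric] by simp
  also have "\<dots> = exp (- t) * exp (- u\<^sup>2 / 2) * normal_density (r * u) (sqrt ((1 - r\<^sup>2) / 2)) v"
    unfolding normal_density_def sq S by simp
  finally show ?thesis unfolding r2 r_def .
qed

lemma mehler1_nonneg: "t > 0 \<Longrightarrow> mehler1 t u v \<ge> 0"
  by (simp add: mehler1_def)

lemma mehler1_hermite_fun1:
  assumes "t > 0"
  shows "integrable lborel (\<lambda>v. mehler1 t u v * hermite_fun1 k v)"
    and "(LINT v|lborel. mehler1 t u v * hermite_fun1 k v) = exp (- t * (2 * real k + 1)) * hermite_fun1 k u"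
proof -
  define \<sigma> r where "\<sigma> = sqrt ((1 - exp (- 4 * t)) / 2)" and "r = exp (- 2 * t)"
  have \<sigma>: "\<sigma> > 0" using assms by (simp add: \<sigma>_def)
  have "exp (- 4 * t) = r\<^sup>2" by (simp add: r_def power2_eq_square flip: exp_add)
  moreover have "2 * \<sigma>\<^sup>2 = 1 - exp (- 4 * t)"
    using assms by (simp add: \<sigma>_def)
  ultimately have r: "1 - 2 * \<sigma>\<^sup>2 = r\<^sup>2" by simp
  have eq: "mehler1 t u v * hermite_fun1 k v =
      (hnorm k * exp (- t) * exp (- u\<^sup>2 / 2)) * (normal_density (r * u) \<sigma> v * poly (hpoly k) v)" for v
    using mehler1_times_gauss[OF assms, of u v]
    by (simp add: hermite_fun1_eq r_def \<sigma>_def mult_ac)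
  show "integrable lborel (\<lambda>v. mehler1 t u v * hermite_fun1 k v)"
    unfolding eq by (intro integrable_mult_right integral_normal_poly \<sigma>)
  \<comment> \<open>The eigenvalue 2k + 1: exp (-t) stems from the normalisation, r^k from the
    Hermite polynomial.\<close>
  have "exp (- t) * r ^ k = exp (- t * (2 * real k + 1))"
    by (simp add: r_def algebra_simps flip: exp_of_nat_mult exp_add)
  then show "(LINT v|lborel. mehler1 t u v * hermite_fun1 k v) = exp (- t * (2 * real k + 1)) * hermite_fun1 k u"
    unfolding eq integral_mult_right_zero integral_normal_poly[OF \<sigma>] affine_mean_hpoly[OF r]
    unfolding hermite_fun1_eq by (simp add: mult_ac flip: \<open>exp (- t) * r ^ k = exp (- t * (2 * real k + 1))\<close>)
qed

section \<open>Integrals over the time of the semigroup\<close>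

text \<open>Cut off at 0 so that time integrals run over the whole line and the values of
  \<open>mehler\<close> at t \<le> 0, which are no heat kernel, drop out.\<close>

definition gamma_weight :: "real \<Rightarrow> real" where
  "gamma_weight t = (if t > 0 then 1 / sqrt (pi * t) else 0)"

lemma gamma_weight_nonneg: "gamma_weight t \<ge> 0"
  by (simp add: gamma_weight_def)

lemma borel_measurable_gamma_weight [measurable]: "gamma_weight \<in> borel_measurable borel"
  unfolding gamma_weight_def by measurable

text \<open>Rescaling time by l reduces the integral to Gamma (1/2) = sqrt pi.\<close>

lemma nn_integral_gamma_weight_exp:
  assumes l: "l > 0"
  shows "(\<integral>\<^sup>+t. ennreal (gamma_weight t * exp (- t * l)) \<partial>lborel) = ennreal (l powr (- 1 / 2))"
proof -
  have "ennreal (sqrt pi) = (\<integral>\<^sup>+t. ennreal (indicator {0..} t * t powr (1 / 2 - 1) / exp t) \<partial>lborel)"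
    using Gamma_conv_nn_integral_real[of "1 / 2"] by (simp add: Gamma_one_half_real)
  also have "\<dots> = ennreal l * (\<integral>\<^sup>+t. ennreal (indicator {0..} (l * t) * (l * t) powr (1 / 2 - 1) / exp (l * t)) \<partial>lborel)"
    using l by (subst nn_integral_real_affine[where c = l and t = 0]) auto
  also have "\<dots> = (\<integral>\<^sup>+t. ennreal (sqrt (pi * l)) * ennreal (gamma_weight t * exp (- t * l)) \<partial>lborel)"
    using l
  proof (subst nn_integral_cmult[symmetric], simp, intro nn_integral_cong)
    fix t :: real
    show "ennreal l * ennreal (indicator {0..} (l * t) * (l * t) powr (1 / 2 - 1) / exp (l * t)) =
        ennreal (sqrt (pi * l)) * ennreal (gamma_weight t * exp (- t * l))"
    proof (cases "t > 0")
      case True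
      have "(l * t) powr (1 / 2 - 1) = 1 / sqrt (l * t)"
        using powr_minus[of "l * t" "1 / 2"] l True by (simp add: powr_half_sqrt inverse_eq_divide)
      moreover have "l / sqrt (l * t) = sqrt (pi * l) * (1 / sqrt (pi * t))"
        using l True by (simp add: real_sqrt_mult field_simps)
      moreover have "l * (l * t) powr (1 / 2 - 1) = sqrt (pi * l) * (1 / sqrt (pi * t))"
        using calculation by simp
      ultimately have "l * ((l * t) powr (1 / 2 - 1) / exp (l * t)) =
          sqrt (pi * l) * (gamma_weight t * exp (- t * l))"
        using True by (simp only: gamma_weight_def exp_minus divide_inverse mult.assoc[symmetric])
          (simp add: exp_minus mult.commute)
      then show ?thesis
        using l True gamma_weight_nonneg[of t] by (simp flip: ennreal_mult)
    next
      case False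
      then show ?thesis using l by (cases "t = 0") (auto simp: gamma_weight_def indicator_def zero_le_mult_iff)
    qed
  qed
  also have "\<dots> = ennreal (sqrt (pi * l)) * (\<integral>\<^sup>+t. ennreal (gamma_weight t * exp (- t * l)) \<partial>lborel)"
    by (rule nn_integral_cmult) simp
  finally have *: "ennreal (sqrt pi) = ennreal (sqrt (pi * l)) * (\<integral>\<^sup>+t. ennreal (gamma_weight t * exp (- t * l)) \<partial>lborel)" .
  have "(\<integral>\<^sup>+t. ennreal (gamma_weight t * exp (- t * l)) \<partial>lborel) =
      ennreal (1 / sqrt (pi * l)) * (ennreal (sqrt (pi * l)) * (\<integral>\<^sup>+t. ennreal (gamma_weight t * exp (- t * l)) \<partial>lborel))"
    using l by (simp flip: mult.assoc ennreal_mult)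
  also have "\<dots> = ennreal (1 / sqrt (pi * l)) * ennreal (sqrt pi)" by (simp only: *)
  also have "\<dots> = ennreal (1 / sqrt l)" using l by (simp add: real_sqrt_mult flip: ennreal_mult)
  also have "1 / sqrt l = l powr (- 1 / 2)"
    using powr_minus[of l "1 / 2"] l by (simp add: powr_half_sqrt inverse_eq_divide)
  finally show ?thesis .
qed

section \<open>Hyperbolic estimates and the two time integrals\<close>

lemma sinh_le_mult_cosh: "x \<ge> 0 \<Longrightarrow> sinh x \<le> x * cosh (x :: real)"
proof -
  assume x: "x \<ge> 0"
  have "0 * cosh 0 - sinh 0 \<le> x * cosh x - sinh x"
  proof (rule DERIV_nonneg_imp_nondecreasing[OF x])
    fix y :: real assume "0 \<le> y"
    then show "\<exists>z. ((\<lambda>x. x * cosh x - sinh x) has_real_derivative z) (at y) \<and> 0 \<le> z"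
      by (intro exI[of _ "y * sinh y"]) (auto intro!: derivative_eq_intros)
  qed
  then show ?thesis by simp
qed

lemma tanh_le_self: "x \<ge> 0 \<Longrightarrow> tanh x \<le> (x :: real)"
  using sinh_le_mult_cosh[of x] by (simp add: tanh_def divide_le_eq)

text \<open>The rational function is the second convergent of the continued fraction of tanh.
  Cleared of denominators, the difference has derivative x (x cosh x - sinh x).\<close>

lemma tanh_ge_rational: "x \<ge> 0 \<Longrightarrow> 3 * x / (3 + x\<^sup>2) \<le> tanh (x :: real)"
proof -
  assume x: "x \<ge> 0"
  have "sinh 0 * (3 + 0\<^sup>2) - 3 * 0 * cosh 0 \<le> sinh x * (3 + x\<^sup>2) - 3 * x * cosh x"
  proof (rule DERIV_nonneg_imp_nondecreasing[OF x])
    fix y :: real assume y: "0 \<le> y"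
    have "((\<lambda>x. sinh x * (3 + x\<^sup>2) - 3 * x * cosh x) has_real_derivative y * (y * cosh y - sinh y)) (at y)"
      by (auto intro!: derivative_eq_intros simp: algebra_simps power2_eq_square)
    then show "\<exists>z. ((\<lambda>x. sinh x * (3 + x\<^sup>2) - 3 * x * cosh x) has_real_derivative z) (at y) \<and> 0 \<le> z"
      using y sinh_le_mult_cosh[OF y] by (intro exI[of _ "y * (y * cosh y - sinh y)"]) auto
  qed
  moreover have "3 + x\<^sup>2 > 0" by (simp add: add_pos_nonneg)
  ultimately show ?thesis by (simp add: tanh_def field_simps)
qed

lemma cosh_powr_le: "cosh (2 * t) powr (- 1 / 2) \<le> sqrt 2 * exp (- t :: real)"
proof -
  have "exp (2 * t) / 2 \<le> cosh (2 * t)" by (simp add: cosh_def)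
  then have "cosh (2 * t) powr (- 1 / 2) \<le> (exp (2 * t) / 2) powr (- 1 / 2)"
    by (intro powr_mono2') auto
  also have "\<dots> = sqrt 2 * exp (- t)"
    using powr_minus[of 2 "1 / 2 :: real"]
    by (simp add: powr_divide powr_half_sqrt exp_powr_real inverse_eq_divide)
  finally show ?thesis .
qed

lemma nn_integral_exp_tail:
  fixes c K :: real
  assumes "K \<ge> 0"
  shows "(\<integral>\<^sup>+t. ennreal (K * exp (- t)) * indicator {c..} t \<partial>lborel) = ennreal (K * exp (- c))"
proof -
  have "(\<integral>\<^sup>+t. ennreal (K * exp (- t)) * indicator {c..} t \<partial>lborel) = ennreal (0 - (- (K * exp (- c))))"
  proof (rule nn_integral_FTC_atLeast[where F = "\<lambda>t. - (K * exp (- t))"])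
    have "((\<lambda>t::real. exp (- t)) \<longlongrightarrow> 0) at_top"
      by (rule filterlim_compose[OF exp_at_bot filterlim_uminus_at_bot_at_top])
    then show "((\<lambda>t. - (K * exp (- t))) \<longlongrightarrow> 0) at_top"
      using tendsto_mult_right_zero[of "\<lambda>t. exp (- t)" at_top "- K"] by simp
  qed (use assms in \<open>auto intro!: derivative_eq_intros\<close>)
  then show ?thesis by simp
qed

text \<open>
  For \<open>t \<le> 1/2\<close> use \<open>tanh (2 t) \<ge> 3 t / 2\<close>, which leaves a Gamma integral; for \<open>t \<ge> 1/2\<close> the
  factor in \<open>a\<close> is bounded by its maximum and the rest decays exponentially.
\<close>

lemma nn_integral_weight_le:
  assumes a: "a \<ge> 0" and q: "q \<le> - 1 / 2"
  shows "(\<integral>\<^sup>+t. ennreal (a * gamma_weight t * (cosh (2 * t) powr q * exp (- tanh (2 * t) * a\<^sup>2 / 2))) \<partial>lborel)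
    \<le> ennreal 1.7"
proof (cases "a = 0")
  case False
  with a have a: "a > 0" by simp
  \<comment> \<open>For t \<ge> 1/2: sqrt (2 / pi) is the maximum of the weight, sqrt 2 comes from
    \<open>cosh_powr_le\<close>, and the last root is the maximum of a exp (-3 a^2 / 8), attained at
    a^2 = 4/3.\<close>
  define K where "K = sqrt (2 / pi) * sqrt 2 * sqrt (4 / (3 * exp 1))"
  have K: "K \<ge> 0" by (simp add: K_def)
  have ae: "a * exp (- (3 * a\<^sup>2 / 8)) \<le> sqrt (4 / (3 * exp 1))"
  proof (rule real_le_rsqrt)
    have "3 * a\<^sup>2 / 4 \<le> exp (3 * a\<^sup>2 / 4 - 1)"
      using exp_ge_add_one_self[of "3 * a\<^sup>2 / 4 - 1"] by simp
    then have "a\<^sup>2 * exp (- (3 * a\<^sup>2 / 4)) \<le> 4 / (3 * exp 1)"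
      unfolding exp_diff exp_minus by (simp add: field_simps)
    moreover have "exp (- (3 * a\<^sup>2 / 8)) ^ 2 = exp (- (3 * a\<^sup>2 / 4))"
      by (simp add: power2_eq_square flip: exp_add)
    ultimately show "(a * exp (- (3 * a\<^sup>2 / 8)))\<^sup>2 \<le> 4 / (3 * exp 1)"
      by (simp add: power_mult_distrib)
  qed
  have "a * gamma_weight t * (cosh (2 * t) powr q * exp (- tanh (2 * t) * a\<^sup>2 / 2))
      \<le> a * (gamma_weight t * exp (- t * (3 / 4 * a\<^sup>2))) + K * exp (- t) * indicator {1 / 2..} t" for t
  proof -
    consider "t \<le> 0" | "t > 0" "t < 1 / 2" | "t \<ge> 1 / 2" by linarith
    then show ?thesis
    proof cases
      case 2
      have "3 / 4 * (2 * t) \<le> 3 * (2 * t) / (3 + (2 * t)\<^sup>2)"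
      proof -
        have "(2 * t)\<^sup>2 \<le> 1" using 2 by (intro power_le_one) auto
        then have "3 * (2 * t) / (3 + (2 * t)\<^sup>2) \<ge> 3 * (2 * t) / 4"
          using 2 by (intro divide_left_mono) (auto intro: add_pos_nonneg mult_pos_pos)
        then show ?thesis by simp
      qed
      also have "\<dots> \<le> tanh (2 * t)" using 2 by (intro tanh_ge_rational) simp
      finally have "3 / 2 * t * (a\<^sup>2 / 2) \<le> tanh (2 * t) * (a\<^sup>2 / 2)"
        by (intro mult_right_mono) auto
      then have "exp (- tanh (2 * t) * a\<^sup>2 / 2) \<le> exp (- t * (3 / 4 * a\<^sup>2))"
        by simp
      moreover have "cosh (2 * t) powr q \<le> 1"
        using powr_mono[of q 0 "cosh (2 * t)"] q cosh_real_ge_1[of "2 * t"] by simp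
      ultimately have "cosh (2 * t) powr q * exp (- tanh (2 * t) * a\<^sup>2 / 2) \<le> 1 * exp (- t * (3 / 4 * a\<^sup>2))"
        by (intro mult_mono) auto
      then have "a * gamma_weight t * (cosh (2 * t) powr q * exp (- tanh (2 * t) * a\<^sup>2 / 2)) \<le>
          a * gamma_weight t * (1 * exp (- t * (3 / 4 * a\<^sup>2)))"
        using a gamma_weight_nonneg by (intro mult_left_mono) auto
      then show ?thesis using 2 by (simp add: mult_ac)
    next
      case 3
      have "gamma_weight t = sqrt (1 / (pi * t))" using 3 by (simp add: gamma_weight_def real_sqrt_divide)
      also have "\<dots> \<le> sqrt (2 / pi)" using 3 by (simp add: field_simps)
      finally have g: "gamma_weight t \<le> sqrt (2 / pi)" .
      have "3 / 4 = 3 * 1 / (3 + 1\<^sup>2 :: real)" by simp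
      also have "\<dots> \<le> tanh 1" by (rule tanh_ge_rational) simp
      also have "\<dots> \<le> tanh (2 * t)" using 3 by simp
      finally have "3 / 4 * (a\<^sup>2 / 2) \<le> tanh (2 * t) * (a\<^sup>2 / 2)" by (intro mult_right_mono) auto
      then have "a * exp (- tanh (2 * t) * a\<^sup>2 / 2) \<le> a * exp (- (3 * a\<^sup>2 / 8))"
        using a by (intro mult_left_mono) auto
      with ae have "a * exp (- tanh (2 * t) * a\<^sup>2 / 2) \<le> sqrt (4 / (3 * exp 1))" by linarith
      \<comment> \<open>Every q is compared with -1/2, the exponent of dimension one, so the bound
        is uniform in the dimension.\<close>
      moreover have "cosh (2 * t) powr q \<le> sqrt 2 * exp (- t)"
        using powr_mono[of q "- 1 / 2" "cosh (2 * t)"] q cosh_real_ge_1[of "2 * t"] cosh_powr_le[of t]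
        by linarith
      ultimately have "gamma_weight t * (cosh (2 * t) powr q * (a * exp (- tanh (2 * t) * a\<^sup>2 / 2))) \<le>
          sqrt (2 / pi) * (sqrt 2 * exp (- t) * sqrt (4 / (3 * exp 1)))"
        using g a gamma_weight_nonneg[of t] by (intro mult_mono mult_nonneg_nonneg) auto
      moreover have "0 \<le> a * (gamma_weight t * exp (- t * (3 / 4 * a\<^sup>2)))"
        using a gamma_weight_nonneg[of t] by simp
      ultimately show ?thesis using 3 by (simp add: K_def mult_ac)
    qed (simp add: gamma_weight_def indicator_def)
  qed
  then have "(\<integral>\<^sup>+t. ennreal (a * gamma_weight t * (cosh (2 * t) powr q * exp (- tanh (2 * t) * a\<^sup>2 / 2))) \<partial>lborel) \<le>
      (\<integral>\<^sup>+t. ennreal a * ennreal (gamma_weight t * exp (- t * (3 / 4 * a\<^sup>2))) +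
         ennreal (K * exp (- t)) * indicator {1 / 2..} t \<partial>lborel)"
    using a K gamma_weight_nonneg
    by (intro nn_integral_mono) (simp flip: ennreal_mult ennreal_plus ennreal_indicator)
  also have "\<dots> = ennreal a * ennreal ((3 / 4 * a\<^sup>2) powr (- 1 / 2)) + ennreal (K * exp (- (1 / 2)))"
    using a K nn_integral_gamma_weight_exp[of "3 / 4 * a\<^sup>2"]
    by (subst nn_integral_add) (simp_all add: nn_integral_cmult nn_integral_exp_tail)
  also have "\<dots> = ennreal (sqrt (4 / 3) + sqrt (16 / (3 * pi * (exp 1)\<^sup>2)))"
  proof -
    \<comment> \<open>The Gamma integral contributes a constant free of a: this homogeneity is why
      the power -1/2 of L compensates one factor |x|.\<close>
    have "a * (3 / 4 * a\<^sup>2) powr (- 1 / 2) = sqrt (4 / 3)"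
      using powr_minus[of "3 / 4 * a\<^sup>2" "1 / 2"] a
      by (simp add: powr_half_sqrt inverse_eq_divide real_sqrt_mult real_sqrt_divide)
    moreover have "K * exp (- (1 / 2)) = sqrt (16 / (3 * pi * (exp 1)\<^sup>2))"
    proof -
      have "(exp (- (1 / 2)))\<^sup>2 = 1 / exp (1 :: real)"
        using exp_double[of "- (1 / 2) :: real"] exp_minus[of "1 :: real"] by (simp add: inverse_eq_divide)
      then have e: "exp (- (1 / 2)) = sqrt (1 / exp (1 :: real))"
        by (metis exp_ge_zero real_sqrt_unique)
      show ?thesis
        unfolding e K_def real_sqrt_mult[symmetric] by (rule arg_cong[of _ _ sqrt]) (simp add: power2_eq_square)
    qed
    ultimately show ?thesis using a K by (simp flip: ennreal_mult ennreal_plus)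
  qed
  also have "\<dots> \<le> ennreal 1.7"
  proof (rule ennreal_leI)
    have "sqrt (4 / 3) \<le> 1.16" by (rule real_le_lsqrt) (auto simp: power2_eq_square)
    moreover have "sqrt (16 / (3 * pi * (exp 1)\<^sup>2)) \<le> 1 / 2"
    proof (rule real_le_lsqrt)
      \<comment> \<open>Four terms of the exponential series give e \<ge> 8/3, hence e^2 > 7; with
        pi > 3.1 the denominator exceeds 64.\<close>
      have "(8 / 3 :: real) \<le> exp 1"
        using exp_lower_Taylor_quadratic[of 1] sum_le_suminf[of "\<lambda>n. 1 / fact n :: real" "{..<4}"]
          summable_exp[of "1::real"] by (simp add: exp_def inverse_eq_divide eval_nat_numeral)
      then have "(8 / 3) * (8 / 3) \<le> exp 1 * (exp 1 :: real)" by (intro mult_mono) auto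
      then have "3 * 3.1 * 7 \<le> 3 * pi * (exp 1)\<^sup>2"
        using pi_approx by (intro mult_mono) (auto simp: power2_eq_square)
      then show "16 / (3 * pi * (exp 1)\<^sup>2) \<le> (1 / 2)\<^sup>2"
        by (simp add: divide_le_eq power2_eq_square)
    qed auto
    ultimately show "sqrt (4 / 3) + sqrt (16 / (3 * pi * (exp 1)\<^sup>2)) \<le> 1.7" by simp
  qed
  finally show ?thesis .
qed simp

lemma self_le_sinh: "x \<ge> 0 \<Longrightarrow> x \<le> sinh (x :: real)"
proof -
  assume x: "x \<ge> 0"
  have "sinh 0 - 0 \<le> sinh x - x"
  proof (rule DERIV_nonneg_imp_nondecreasing[OF x])
    fix y :: real
    show "\<exists>z. ((\<lambda>x. sinh x - x) has_real_derivative z) (at y) \<and> 0 \<le> z"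
      using cosh_real_ge_1[of y]
      by (intro exI[of _ "cosh y - 1"]) (auto intro!: derivative_eq_intros)
  qed
  then show ?thesis by simp
qed

lemma one_plus_square_le_cosh: "x \<ge> 0 \<Longrightarrow> 1 + x\<^sup>2 / 2 \<le> cosh (x :: real)"
proof -
  assume x: "x \<ge> 0"
  have "cosh 0 - 0\<^sup>2 / 2 \<le> cosh x - x\<^sup>2 / 2"
  proof (rule DERIV_nonneg_imp_nondecreasing[OF x])
    fix y :: real assume "0 \<le> y"
    then show "\<exists>z. ((\<lambda>x. cosh x - x\<^sup>2 / 2) has_real_derivative z) (at y) \<and> 0 \<le> z"
      using self_le_sinh[of y]
      by (intro exI[of _ "sinh y - y"]) (auto intro!: derivative_eq_intros)
  qed
  then show ?thesis by simp
qed

lemma Bernoulli_powr: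
  fixes u r :: real
  assumes u: "u \<ge> 0" and r: "r \<ge> 1"
  shows "1 + r * u \<le> (1 + u) powr r"
proof -
  have "(1 + 0) powr r - r * 0 \<le> (1 + u) powr r - r * u"
  proof (rule DERIV_nonneg_imp_nondecreasing[OF u])
    fix y :: real assume y: "0 \<le> y"
    have "((\<lambda>u. (1 + u) powr r - r * u) has_real_derivative r * (1 + y) powr (r - 1) - r) (at y)"
      using y by (auto intro!: derivative_eq_intros)
    moreover have "r * 1 \<le> r * (1 + y) powr (r - 1)"
      using y r by (intro mult_left_mono ge_one_powr_ge_zero) auto
    ultimately show "\<exists>z. ((\<lambda>u. (1 + u) powr r - r * u) has_real_derivative z) (at y) \<and> 0 \<le> z"
      by auto
  qed
  then show ?thesis by simp
qed

lemma nn_integral_arctan_tail: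
  assumes "k > (0 :: real)"
  shows "(\<integral>\<^sup>+t. ennreal (1 / (1 + k * t\<^sup>2)) * indicator {0..} t \<partial>lborel) = ennreal (pi / 2 / sqrt k)"
proof -
  have "(\<integral>\<^sup>+t. ennreal (1 / (1 + k * t\<^sup>2)) * indicator {0..} t \<partial>lborel) =
      ennreal (pi / 2 / sqrt k - arctan (sqrt k * 0) / sqrt k)"
  proof (rule nn_integral_FTC_atLeast[where F = "\<lambda>t. arctan (sqrt k * t) / sqrt k"])
    have "filterlim (\<lambda>t. sqrt k * t) at_top at_top"
      using assms by (intro filterlim_tendsto_pos_mult_at_top[OF tendsto_const _ filterlim_ident]) auto
    then have "((\<lambda>t. arctan (sqrt k * t)) \<longlongrightarrow> pi / 2) at_top"
      by (rule filterlim_compose[OF tendsto_arctan_at_top])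
    then show "((\<lambda>t. arctan (sqrt k * t) / sqrt k) \<longlongrightarrow> pi / 2 / sqrt k) at_top"
      using assms by (intro tendsto_divide tendsto_const) auto
  next
    fix t :: real
    show "DERIV (\<lambda>t. arctan (sqrt k * t) / sqrt k) t :> 1 / (1 + k * t\<^sup>2)"
      using assms by (auto intro!: derivative_eq_intros simp: power_mult_distrib inverse_eq_divide)
  qed (use assms in \<open>auto intro!: add_nonneg_nonneg\<close>)
  then show ?thesis by simp
qed

text \<open>The bound sqrt (tanh (2t)) \<le> sqrt (2t) cancels the singularity of the weight and
  leaves sqrt (2d / pi) times the integral of cosh (2t)^(-d/2). For d \<ge> 2 Bernoulli's inequality
  with exponent d/2 \<ge> 1 gives cosh (2t)^(d/2) \<ge> 1 + d t^2, and the resulting arctan integral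
  scales like d^(-1/2), cancelling the growth. For d = 1 exponential decay replaces this.\<close>

lemma nn_integral_weight_tanh_le:
  fixes d :: nat
  assumes "d \<ge> 1"
  shows "(\<integral>\<^sup>+t. ennreal (gamma_weight t * (cosh (2 * t) powr (- real d / 2) * sqrt (real d * tanh (2 * t)))) \<partial>lborel)
    \<le> ennreal 1.26"
proof -
  have le: "gamma_weight t * (cosh (2 * t) powr (- real d / 2) * sqrt (real d * tanh (2 * t))) \<le>
      sqrt (2 / pi) * sqrt (real d) * cosh (2 * t) powr (- real d / 2)" if "t > 0" for t
  proof -
    have "sqrt (tanh (2 * t)) \<le> sqrt (2 * t)" using that tanh_le_self[of "2 * t"] by simp
    then have "gamma_weight t * sqrt (tanh (2 * t)) \<le> 1 / sqrt (pi * t) * sqrt (2 * t)"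
      using that by (simp add: gamma_weight_def divide_right_mono)
    also have "\<dots> = sqrt (2 / pi)" using that by (simp add: real_sqrt_mult real_sqrt_divide)
    finally have "gamma_weight t * sqrt (tanh (2 * t)) * (sqrt (real d) * cosh (2 * t) powr (- real d / 2)) \<le>
        sqrt (2 / pi) * (sqrt (real d) * cosh (2 * t) powr (- real d / 2))"
      by (intro mult_right_mono) auto
    then show ?thesis by (simp add: real_sqrt_mult mult_ac)
  qed
  show ?thesis
  proof (cases "d = 1")
    case True
    have "gamma_weight t * (cosh (2 * t) powr (- real d / 2) * sqrt (real d * tanh (2 * t))) \<le>
        sqrt (2 / pi) * sqrt 2 * exp (- t) * indicator {0..} t" for t
    proof (cases "t > 0")
      case t: True
      have "sqrt (2 / pi) * cosh (2 * t) powr (- 1 / 2) \<le> sqrt (2 / pi) * (sqrt 2 * exp (- t))"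
        by (intro mult_left_mono cosh_powr_le) auto
      then have "sqrt (2 / pi) * sqrt (real d) * cosh (2 * t) powr (- real d / 2) \<le>
          sqrt (2 / pi) * sqrt 2 * exp (- t)"
        using True by (simp add: mult.assoc)
      from order_trans[OF le[OF t] this] show ?thesis using t by simp
    qed (simp add: gamma_weight_def)
    then have "(\<integral>\<^sup>+t. ennreal (gamma_weight t * (cosh (2 * t) powr (- real d / 2) * sqrt (real d * tanh (2 * t)))) \<partial>lborel) \<le>
        (\<integral>\<^sup>+t. ennreal (sqrt (2 / pi) * sqrt 2 * exp (- t)) * indicator {0..} t \<partial>lborel)"
      by (intro nn_integral_mono) (simp flip: ennreal_mult ennreal_indicator)
    also have "\<dots> = ennreal (sqrt (4 / pi))"
      by (subst nn_integral_exp_tail) (simp_all flip: real_sqrt_mult)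
    also have "\<dots> \<le> ennreal 1.26"
    proof (rule ennreal_leI, rule real_le_lsqrt)
      show "4 / pi \<le> 1.26\<^sup>2" using pi_approx by (simp add: divide_le_eq power2_eq_square)
    qed auto
    finally show ?thesis .
  next
    case False
    with assms have d: "d \<ge> 2" by simp
    have cosh: "cosh (2 * t) powr (- real d / 2) \<le> 1 / (1 + real d * t\<^sup>2)" if "t \<ge> 0" for t
    proof -
      have "1 + real d * t\<^sup>2 \<le> (1 + 2 * t\<^sup>2) powr (real d / 2)"
        using Bernoulli_powr[of "2 * t\<^sup>2" "real d / 2"] d by simp
      also have "\<dots> \<le> cosh (2 * t) powr (real d / 2)"
        using one_plus_square_le_cosh[of "2 * t"] that by (intro powr_mono2) (auto simp: power2_eq_square)
      finally have "1 / cosh (2 * t) powr (real d / 2) \<le> 1 / (1 + real d * t\<^sup>2)"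
        by (intro divide_left_mono) (auto intro!: mult_pos_pos add_pos_nonneg)
      then show ?thesis using powr_minus[of "cosh (2 * t)" "real d / 2"] by (simp add: inverse_eq_divide)
    qed
    have "gamma_weight t * (cosh (2 * t) powr (- real d / 2) * sqrt (real d * tanh (2 * t))) \<le>
        sqrt (2 / pi) * sqrt (real d) * (1 / (1 + real d * t\<^sup>2) * indicator {0..} t)" for t
    proof (cases "t > 0")
      case t: True
      have "sqrt (2 / pi) * sqrt (real d) * cosh (2 * t) powr (- real d / 2) \<le>
          sqrt (2 / pi) * sqrt (real d) * (1 / (1 + real d * t\<^sup>2))"
        using t by (intro mult_left_mono cosh) auto
      from order_trans[OF le[OF t] this] show ?thesis using t by simp
    qed (simp add: gamma_weight_def)
    then have "(\<integral>\<^sup>+t. ennreal (gamma_weight t * (cosh (2 * t) powr (- real d / 2) * sqrt (real d * tanh (2 * t)))) \<partial>lborel) \<le>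
        (\<integral>\<^sup>+t. ennreal (sqrt (2 / pi) * sqrt (real d)) * (ennreal (1 / (1 + real d * t\<^sup>2)) * indicator {0..} t) \<partial>lborel)"
      by (intro nn_integral_mono) (simp add: add_nonneg_nonneg flip: ennreal_mult ennreal_indicator)
    also have "\<dots> = ennreal (sqrt (2 / pi) * sqrt (real d)) * ennreal (pi / 2 / sqrt (real d))"
      using d by (subst nn_integral_cmult) (simp_all add: nn_integral_arctan_tail)
    also have "\<dots> = ennreal (sqrt (pi / 2))"
    proof -
      have "sqrt (2 / pi) * sqrt (real d) * (pi / 2 / sqrt (real d)) = sqrt (2 / pi) * (pi / 2)"
        using d by simp
      also have "\<dots> = sqrt (2 / pi) * sqrt ((pi / 2)\<^sup>2)" by simp
      also have "\<dots> = sqrt (pi / 2)"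
        unfolding real_sqrt_mult[symmetric] by (simp add: power2_eq_square)
      finally show ?thesis by (simp flip: ennreal_mult)
    qed
    also have "\<dots> \<le> ennreal 1.26"
    proof (rule ennreal_leI, rule real_le_lsqrt)
      show "pi / 2 \<le> 1.26\<^sup>2" using pi_approx by (simp add: power2_eq_square)
    qed auto
    finally show ?thesis .
  qed
qed

section \<open>The Mehler kernel in several dimensions\<close>

lemma Basis_real_vec: "(Basis :: (real ^ 'd) set) = range (\<lambda>i. axis i 1)"
  by (auto simp: Basis_vec_def)

lemma inj_axis_one: "inj (\<lambda>i::'d::finite. axis i (1::real))"
  by (auto simp: inj_def axis_eq_axis)

text \<open>Lebesgue measure factorises over the vectors in \<open>Basis\<close>; the inverse of
  \<open>axis\<close> turns such products into products over coordinates.\<close>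

lemma prod_Basis_vec:
  fixes F :: "'d::finite \<Rightarrow> 'b::comm_monoid_mult"
  shows "(\<Prod>b\<in>(Basis :: (real ^ 'd) set). F (inv (\<lambda>i. axis i 1) b)) = (\<Prod>i\<in>UNIV. F i)"
  unfolding Basis_real_vec by (subst prod.reindex) (auto simp: inj_axis_one inv_f_f[OF inj_axis_one])

lemma prod_Basis_inner_vec:
  fixes f :: "'d::finite \<Rightarrow> real \<Rightarrow> 'b::comm_monoid_mult"
  shows "(\<Prod>b\<in>Basis. f (inv (\<lambda>i. axis i 1) b) (x \<bullet> b)) = (\<Prod>i\<in>UNIV. f i (x $ i))"
  unfolding Basis_real_vec by (subst prod.reindex) (auto simp: inj_axis_one inner_axis inv_f_f[OF inj_axis_one])

lemma nn_integral_prod_vec: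
  fixes f :: "'d::finite \<Rightarrow> real \<Rightarrow> ennreal"
  assumes "\<And>i. f i \<in> borel_measurable borel"
  shows "(\<integral>\<^sup>+x. (\<Prod>i\<in>UNIV. f i (x $ i)) \<partial>lborel) = (\<Prod>i\<in>UNIV. \<integral>\<^sup>+v. f i v \<partial>lborel)"
proof -
  have "(\<integral>\<^sup>+x. (\<Prod>i\<in>UNIV. f i (x $ i)) \<partial>lborel) =
      (\<integral>\<^sup>+x. (\<Prod>b\<in>(Basis :: (real ^ 'd) set). f (inv (\<lambda>i. axis i 1) b) (x \<bullet> b)) \<partial>lborel)"
    by (intro nn_integral_cong prod_Basis_inner_vec[symmetric])
  also have "\<dots> = (\<Prod>b\<in>(Basis :: (real ^ 'd) set). \<integral>\<^sup>+v. f (inv (\<lambda>i. axis i 1) b) v \<partial>lborel)"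
    by (rule nn_integral_lborel_prod) (use assms in auto)
  also have "\<dots> = (\<Prod>i\<in>UNIV. \<integral>\<^sup>+v. f i v \<partial>lborel)"
    by (rule prod_Basis_vec)
  finally show ?thesis .
qed

lemma borel_measurable_vec_nth [measurable]: "(\<lambda>x :: real ^ 'd. x $ i) \<in> borel_measurable borel"
  by (intro borel_measurable_continuous_onI continuous_intros)

lemma integral_prod_vec:
  fixes f :: "'d::finite \<Rightarrow> real \<Rightarrow> real"
  assumes f: "\<And>i. integrable lborel (f i)"
  shows "integrable lborel (\<lambda>x. \<Prod>i\<in>UNIV. f i (x $ i))"
    and "(LINT x|lborel. (\<Prod>i\<in>UNIV. f i (x $ i))) = (\<Prod>i\<in>UNIV. (LINT v|lborel. f i v))"
proof -
  interpret product_sigma_finite "\<lambda>_ :: real ^ 'd. lborel :: real measure"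
    by standard
  define g where "g b = f (inv (\<lambda>i. axis i 1) b)" for b :: "real ^ 'd"
  have [measurable]: "f i \<in> borel_measurable borel" for i
    using borel_measurable_integrable[OF f[of i]] by simp
  have eq: "(\<Prod>i\<in>UNIV. f i ((\<Sum>b\<in>Basis. h b *\<^sub>R b) $ i)) = (\<Prod>b\<in>Basis. g b (h b))"
    for h :: "real ^ 'd \<Rightarrow> real"
    unfolding g_def prod_Basis_inner_vec[symmetric] by (intro prod.cong refl) simp
  \<comment> \<open>Lebesgue measure is the image of the product measure under this map from
    coordinate families to vectors.\<close>
  have T: "(\<lambda>h. \<Sum>b\<in>Basis. h b *\<^sub>R b) \<in> measurable (\<Pi>\<^sub>M b\<in>(Basis :: (real ^ 'd) set). lborel) borel"
    by measurable
  have I: "integrable (\<Pi>\<^sub>M b\<in>(Basis :: (real ^ 'd) set). lborel) (\<lambda>h. \<Prod>b\<in>Basis. g b (h b))"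
    by (intro product_integrable_prod) (auto simp: g_def f)
  show "integrable lborel (\<lambda>x. \<Prod>i\<in>UNIV. f i (x $ i))"
    by (subst lborel_eq, subst integrable_distr_eq[OF T]) (simp_all only: eq I, measurable)
  have "(LINT x|lborel. (\<Prod>i\<in>UNIV. f i (x $ i))) = (LINT h|(\<Pi>\<^sub>M b\<in>(Basis :: (real ^ 'd) set). lborel). (\<Prod>b\<in>Basis. g b (h b)))"
    by (subst lborel_eq, subst integral_distr[OF T]) (simp_all only: eq, measurable)
  also have "\<dots> = (\<Prod>b\<in>Basis. (LINT v|lborel. g b v))"
    by (intro product_integral_prod) (auto simp: g_def f)
  also have "\<dots> = (\<Prod>i\<in>UNIV. (LINT v|lborel. f i v))"
    unfolding g_def by (rule prod_Basis_vec)
  finally show "(LINT x|lborel. (\<Prod>i\<in>UNIV. f i (x $ i))) = (\<Prod>i\<in>UNIV. (LINT v|lborel. f i v))" .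
qed

lemma norm_vec_square: "(norm x)\<^sup>2 = (\<Sum>i\<in>UNIV. (x $ i)\<^sup>2)" for x :: "real ^ 'd"
  by (simp add: norm_vec_def L2_set_def sum_nonneg)

lemma exp_norm_square:
  "exp (c * (norm x)\<^sup>2) = (\<Prod>i\<in>UNIV. exp (c * (x $ i)\<^sup>2))" for x :: "real ^ 'd"
  by (simp add: norm_vec_square sum_distrib_left exp_sum)

definition mehler :: "real \<Rightarrow> real ^ 'd \<Rightarrow> real ^ 'd \<Rightarrow> real" where
  "mehler t x y = (\<Prod>i\<in>UNIV. mehler1 t (x $ i) (y $ i))"

lemma mehler_commute: "mehler t x y = mehler t y x"
  by (simp add: mehler_def mehler1_commute)

lemma mehler_nonneg: "t > 0 \<Longrightarrow> mehler t x y \<ge> 0"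
  by (simp add: mehler_def prod_nonneg mehler1_nonneg)

lemma borel_measurable_cosh [measurable (raw)]:
  "f \<in> borel_measurable M \<Longrightarrow> (\<lambda>x. cosh (f x :: real)) \<in> borel_measurable M"
  by (erule measurable_compose) (intro borel_measurable_continuous_onI continuous_intros)

lemma borel_measurable_sinh [measurable (raw)]:
  "f \<in> borel_measurable M \<Longrightarrow> (\<lambda>x. sinh (f x :: real)) \<in> borel_measurable M"
  by (erule measurable_compose) (intro borel_measurable_continuous_onI continuous_intros)

lemma borel_measurable_mehler1 [measurable (raw)]:
  assumes [measurable]: "f \<in> borel_measurable M" "g \<in> borel_measurable M" "h \<in> borel_measurable M"
  shows "(\<lambda>x. mehler1 (f x) (g x) (h x)) \<in> borel_measurable M"
  unfolding mehler1_def by measurable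

lemma borel_measurable_mehler [measurable (raw)]:
  assumes [measurable]: "f \<in> borel_measurable M" "g \<in> borel_measurable M" "h \<in> borel_measurable M"
  shows "(\<lambda>x. mehler (f x) (g x) (h x :: real ^ 'd)) \<in> borel_measurable M"
proof -
  have [measurable]: "(\<lambda>x. g x $ i) \<in> borel_measurable M" "(\<lambda>x. h x $ i) \<in> borel_measurable M" for i
    using measurable_compose[OF assms(2) borel_measurable_vec_nth]
      measurable_compose[OF assms(3) borel_measurable_vec_nth] by auto
  show ?thesis unfolding mehler_def by measurable
qed

section \<open>Mass and moments of the Mehler kernel\<close>

lemma nn_integral_normal_density: "\<sigma> > 0 \<Longrightarrow> (\<integral>\<^sup>+v. ennreal (normal_density \<mu> \<sigma> v) \<partial>lborel) = 1"
  by (subst nn_integral_eq_integral) auto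

lemma nn_integral_normal_density_square:
  assumes \<sigma>: "\<sigma> > 0"
  shows "(\<integral>\<^sup>+v. ennreal (normal_density \<mu> \<sigma> v * v\<^sup>2) \<partial>lborel) = ennreal (\<mu>\<^sup>2 + \<sigma>\<^sup>2)"
proof -
  \<comment> \<open>Two explicit factors and a 1, so that \<open>affine_mean_by_parts\<close>
    applies twice.\<close>
  define P :: "real poly" where "P = [:0, 1:] * ([:0, 1:] * 1)"
  have P: "poly P v = v\<^sup>2" for v by (simp add: P_def power2_eq_square)
  have "affine_mean \<mu> \<sigma> P = \<mu>\<^sup>2 + \<sigma>\<^sup>2"
    unfolding P_def affine_mean_by_parts pderiv_mult
    by (simp add: affine_mean_1 pderiv_pCons power2_eq_square affine_mean_def gauss_mean_def)
      (use affine_mean_1[of \<mu> \<sigma>] in \<open>simp add: affine_mean_def gauss_mean_def\<close>)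
  then show ?thesis
    using integral_normal_poly[OF \<sigma>, of \<mu> P] by (subst nn_integral_eq_integral) (simp_all add: P)
qed

text \<open>The total mass in the second variable, read off as the factor of the normal density in
  \<open>mehler1_eq_normal\<close>.\<close>

definition mehler_mass1 :: "real \<Rightarrow> real \<Rightarrow> real" where
  "mehler_mass1 t u = cosh (2 * t) powr (- 1 / 2) * exp (- tanh (2 * t) * u\<^sup>2 / 2)"

definition mehler_mass :: "real \<Rightarrow> real ^ 'd \<Rightarrow> real" where
  "mehler_mass t x = cosh (2 * t) powr (- real CARD('d) / 2) * exp (- tanh (2 * t) * (norm x)\<^sup>2 / 2)"

lemma mehler_mass1_nonneg: "mehler_mass1 t u \<ge> 0"
  by (simp add: mehler_mass1_def)

lemma prod_mehler_mass1: "(\<Prod>i\<in>UNIV. mehler_mass1 t (x $ i)) = mehler_mass t x"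
proof -
  have "(\<Prod>i\<in>(UNIV :: 'd set). cosh (2 * t) powr (- 1 / 2)) = cosh (2 * t) powr (- real CARD('d) / 2)"
    using cosh_real_pos[of "2 * t"] by (simp add: powr_power)
  moreover have "(\<Prod>i\<in>UNIV. exp (- tanh (2 * t) * (x $ i)\<^sup>2 / 2)) = exp (- tanh (2 * t) * (norm x)\<^sup>2 / 2)"
    using exp_norm_square[of "- tanh (2 * t) / 2" x] by simp
  ultimately show ?thesis by (simp add: mehler_mass1_def mehler_mass_def prod.distrib)
qed

lemma mehler_mass_nonneg: "mehler_mass t x \<ge> 0"
  by (simp add: mehler_mass_def)

lemma nn_integral_mehler1:
  assumes t: "t > 0"
  shows "(\<integral>\<^sup>+v. ennreal (mehler1 t u v) \<partial>lborel) = ennreal (mehler_mass1 t u)"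
    and "(\<integral>\<^sup>+v. ennreal (mehler1 t u v * v\<^sup>2) \<partial>lborel) =
      ennreal (mehler_mass1 t u * ((u / cosh (2 * t))\<^sup>2 + tanh (2 * t)))"
proof -
  have \<sigma>: "sqrt (tanh (2 * t)) > 0" using t by simp
  have *: "mehler1 t u v = mehler_mass1 t u * normal_density (u / cosh (2 * t)) (sqrt (tanh (2 * t))) v" for v
    by (simp add: mehler1_eq_normal[OF t] mehler_mass1_def)
  show "(\<integral>\<^sup>+v. ennreal (mehler1 t u v) \<partial>lborel) = ennreal (mehler_mass1 t u)"
    by (simp add: * ennreal_mult mehler_mass1_nonneg nn_integral_cmult nn_integral_normal_density \<sigma> del: real_sqrt_gt_0_iff)
  have "(\<integral>\<^sup>+v. ennreal (mehler1 t u v * v\<^sup>2) \<partial>lborel) =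
     (\<integral>\<^sup>+v. ennreal (mehler_mass1 t u) * ennreal (normal_density (u / cosh (2 * t)) (sqrt (tanh (2 * t))) v * v\<^sup>2) \<partial>lborel)"
    by (simp add: * mehler_mass1_nonneg mult.assoc flip: ennreal_mult)
  also have "\<dots> = ennreal (mehler_mass1 t u) * ennreal ((u / cosh (2 * t))\<^sup>2 + (sqrt (tanh (2 * t)))\<^sup>2)"
    by (subst nn_integral_cmult) (simp_all only: nn_integral_normal_density_square \<sigma>, measurable)
  finally show "(\<integral>\<^sup>+v. ennreal (mehler1 t u v * v\<^sup>2) \<partial>lborel) =
      ennreal (mehler_mass1 t u * ((u / cosh (2 * t))\<^sup>2 + tanh (2 * t)))"
    using t mehler_mass1_nonneg[of t u] by (subst ennreal_mult) simp_all
qed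

lemma nn_integral_mehler:
  fixes x :: "real ^ 'd"
  assumes t: "t > 0"
  shows "(\<integral>\<^sup>+y. ennreal (mehler t x y) \<partial>lborel) = ennreal (mehler_mass t x)"
proof -
  have "(\<integral>\<^sup>+y. ennreal (mehler t x y) \<partial>lborel) = (\<integral>\<^sup>+y. (\<Prod>i\<in>UNIV. ennreal (mehler1 t (x $ i) (y $ i))) \<partial>lborel)"
    using t by (simp add: mehler_def prod_ennreal mehler1_nonneg)
  also have "\<dots> = (\<Prod>i\<in>UNIV. ennreal (mehler_mass1 t (x $ i)))"
    by (subst nn_integral_prod_vec) (simp_all add: nn_integral_mehler1[OF t])
  finally show ?thesis by (simp add: prod_ennreal mehler_mass1_nonneg prod_mehler_mass1)
qed

lemma nn_integral_mehler_square:
  fixes x :: "real ^ 'd"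
  assumes t: "t > 0"
  shows "(\<integral>\<^sup>+y. ennreal (mehler t x y * (norm y)\<^sup>2) \<partial>lborel) =
    ennreal (mehler_mass t x * ((norm x / cosh (2 * t))\<^sup>2 + real CARD('d) * tanh (2 * t)))"
proof -
  have th: "tanh (2 * t) > 0" using t by simp
  have one: "(\<integral>\<^sup>+y. ennreal (mehler t x y * (y $ i)\<^sup>2) \<partial>lborel) =
      ennreal (mehler_mass t x * ((x $ i / cosh (2 * t))\<^sup>2 + tanh (2 * t)))" for i
  proof -
    have *: "(\<Prod>j\<in>UNIV. F j * (if j = i then a else 1)) = (\<Prod>j\<in>UNIV. F j) * a" for F :: "'d \<Rightarrow> real" and a
      by (simp add: prod.distrib prod.delta)
    \<comment> \<open>The square is inserted as a factor at j = i, which keeps the integrand a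
      product over the coordinates.\<close>
    have "mehler t x y * (y $ i)\<^sup>2 = (\<Prod>j\<in>UNIV. mehler1 t (x $ j) (y $ j) * (if j = i then (y $ j)\<^sup>2 else 1))" for y
      using *[of "\<lambda>j. mehler1 t (x $ j) (y $ j)" "(y $ i)\<^sup>2"]
      by (simp add: mehler_def cong: if_cong)
    then have "(\<integral>\<^sup>+y. ennreal (mehler t x y * (y $ i)\<^sup>2) \<partial>lborel) =
       (\<integral>\<^sup>+y. (\<Prod>j\<in>UNIV. ennreal (mehler1 t (x $ j) (y $ j) * (if j = i then (y $ j)\<^sup>2 else 1))) \<partial>lborel)"
      using t by (simp add: prod_ennreal mehler1_nonneg)
    also have "\<dots> = (\<Prod>j\<in>UNIV. \<integral>\<^sup>+v. ennreal (mehler1 t (x $ j) v * (if j = i then v\<^sup>2 else 1)) \<partial>lborel)"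
      by (rule nn_integral_prod_vec) measurable
    also have "\<dots> = (\<Prod>j\<in>UNIV. ennreal (mehler_mass1 t (x $ j) *
        (if j = i then (x $ i / cosh (2 * t))\<^sup>2 + tanh (2 * t) else 1)))"
      by (intro prod.cong refl) (simp add: nn_integral_mehler1[OF t])
    also have "\<dots> = ennreal (mehler_mass t x * ((x $ i / cosh (2 * t))\<^sup>2 + tanh (2 * t)))"
      using th by (subst prod_ennreal) (simp_all add: mehler_mass1_nonneg * prod_mehler_mass1)
    finally show ?thesis .
  qed
  have "(\<integral>\<^sup>+y. ennreal (mehler t x y * (norm y)\<^sup>2) \<partial>lborel) =
      (\<integral>\<^sup>+y. (\<Sum>i\<in>UNIV. ennreal (mehler t x y * (y $ i)\<^sup>2)) \<partial>lborel)"
    using t by (simp add: norm_vec_square sum_distrib_left mehler_nonneg sum_ennreal)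
  also have "\<dots> = (\<Sum>i\<in>UNIV. ennreal (mehler_mass t x * ((x $ i / cosh (2 * t))\<^sup>2 + tanh (2 * t))))"
    by (subst nn_integral_sum) (simp_all add: one)
  also have "\<dots> = ennreal (mehler_mass t x * ((norm x / cosh (2 * t))\<^sup>2 + real CARD('d) * tanh (2 * t)))"
    using th by (subst sum_ennreal)
      (simp_all add: mehler_mass_nonneg norm_vec_square power_divide sum_divide_distrib sum.distrib
        flip: sum_distrib_left)
  finally show ?thesis .
qed

text \<open>The first moment is estimated through \<open>r \<le> (r\<^sup>2 / b + b) / 2\<close>, with \<open>b\<^sup>2\<close> the second moment.\<close>

lemma nn_integral_mehler_norm_le:
  fixes x :: "real ^ 'd"
  assumes t: "t > 0"
  shows "(\<integral>\<^sup>+y. ennreal (norm y * mehler t x y) \<partial>lborel) \<le>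
    ennreal (mehler_mass t x * (norm x + sqrt (real CARD('d) * tanh (2 * t))))"
proof -
  have th: "tanh (2 * t) > 0" using t by simp
  define B b where "B = (norm x / cosh (2 * t))\<^sup>2 + real CARD('d) * tanh (2 * t)" and "b = sqrt B"
  have "B > 0" using th unfolding B_def by (intro add_nonneg_pos) auto
  then have b: "b > 0" "B = b\<^sup>2" by (simp_all add: b_def)
  have "norm y * mehler t x y \<le> (1 / (2 * b)) * (mehler t x y * (norm y)\<^sup>2) + b / 2 * mehler t x y" for y
  proof -
    have "0 \<le> (norm y - b)\<^sup>2" by simp
    then have "norm y \<le> (1 / (2 * b)) * (norm y)\<^sup>2 + b / 2"
      using b by (simp add: field_simps power2_eq_square)
    from mult_right_mono[OF this mehler_nonneg[OF t, of x y]] show ?thesis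
      by (simp add: algebra_simps)
  qed
  then have "(\<integral>\<^sup>+y. ennreal (norm y * mehler t x y) \<partial>lborel) \<le>
      (\<integral>\<^sup>+y. ennreal (1 / (2 * b)) * ennreal (mehler t x y * (norm y)\<^sup>2) + ennreal (b / 2) * ennreal (mehler t x y) \<partial>lborel)"
    using b mehler_nonneg[OF t, of x]
    by (intro nn_integral_mono) (subst (1 2) ennreal_mult[symmetric], simp, simp, simp, simp,
      subst ennreal_plus[symmetric], simp, simp, intro ennreal_leI)
  also have "\<dots> = ennreal (1 / (2 * b)) * ennreal (mehler_mass t x * B) + ennreal (b / 2) * ennreal (mehler_mass t x)"
    by (subst nn_integral_add)
      (simp_all add: nn_integral_cmult nn_integral_mehler[OF t] nn_integral_mehler_square[OF t] B_def)
  also have "\<dots> = ennreal (mehler_mass t x * b)"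
    using b mehler_mass_nonneg[of t x]
    by (simp add: power2_eq_square field_simps flip: ennreal_mult ennreal_plus)
  also have "\<dots> \<le> ennreal (mehler_mass t x * (norm x + sqrt (real CARD('d) * tanh (2 * t))))"
  proof (intro ennreal_leI mult_left_mono mehler_mass_nonneg)
    \<comment> \<open>Subadditivity of the root separates the part proportional to |x|, to be
      treated like the row integral, from the fluctuation.\<close>
    have "b \<le> sqrt ((norm x / cosh (2 * t))\<^sup>2) + sqrt (real CARD('d) * tanh (2 * t))"
      unfolding b_def B_def using th by (intro sqrt_add_le_add_sqrt) auto
    also have "sqrt ((norm x / cosh (2 * t))\<^sup>2) \<le> norm x"
      using cosh_real_ge_1[of "2 * t"] by (simp add: divide_le_eq mult_le_cancel_left1)
    finally show "b \<le> norm x + sqrt (real CARD('d) * tanh (2 * t))" by simp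
  qed
  finally show ?thesis .
qed

section \<open>Action of the kernel and of L^(-1/2) on Hermite functions\<close>

lemma mehler_hermite_fun:
  fixes x :: "real ^ 'd"
  assumes t: "t > 0"
  shows "integrable lborel (\<lambda>y. mehler t x y * hermite_fun n y)"
    and "(LINT y|lborel. mehler t x y * hermite_fun n y) = exp (- t * hermite_eigenvalue n) * hermite_fun n x"
proof -
  have eq: "mehler t x y * hermite_fun n y = (\<Prod>i\<in>UNIV. mehler1 t (x $ i) (y $ i) * hermite_fun1 (n $ i) (y $ i))" for y
    by (simp add: mehler_def hermite_fun_def prod.distrib)
  show "integrable lborel (\<lambda>y. mehler t x y * hermite_fun n y)"
    unfolding eq by (rule integral_prod_vec) (rule mehler1_hermite_fun1[OF t])
  have "(LINT y|lborel. mehler t x y * hermite_fun n y) =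
      (\<Prod>i\<in>UNIV. exp (- t * (2 * real (n $ i) + 1)) * hermite_fun1 (n $ i) (x $ i))"
    unfolding eq by (subst integral_prod_vec) (simp_all only: mehler1_hermite_fun1[OF t])
  also have "\<dots> = exp (\<Sum>i\<in>UNIV. - t * (2 * real (n $ i) + 1)) * hermite_fun n x"
    by (simp add: prod.distrib exp_sum hermite_fun_def)
  also have "(\<Sum>i\<in>UNIV. - t * (2 * real (n $ i) + 1)) = - t * hermite_eigenvalue n"
    unfolding hermite_eigenvalue_def sum_distrib_left[symmetric] by (simp add: sum.distrib sum_distrib_left)
  finally show "(LINT y|lborel. mehler t x y * hermite_fun n y) = exp (- t * hermite_eigenvalue n) * hermite_fun n x" .
qed

lemma integral_hermite_fun_mult:
  fixes m n :: "nat ^ 'd"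
  shows "integrable lborel (\<lambda>x. hermite_fun m x * hermite_fun n x)"
    and "(LINT x|lborel. hermite_fun m x * hermite_fun n x) = (if m = n then 1 else 0)"
proof -
  have eq: "hermite_fun m x * hermite_fun n x =
      (\<Prod>i\<in>UNIV. hermite_fun1 (m $ i) (x $ i) * hermite_fun1 (n $ i) (x $ i))" for x :: "real ^ 'd"
    by (simp add: hermite_fun_def prod.distrib)
  show "integrable lborel (\<lambda>x. hermite_fun m x * hermite_fun n x)"
    unfolding eq by (rule integral_prod_vec) (rule integral_hermite_fun1_mult)
  have "(LINT x|lborel. hermite_fun m x * hermite_fun n x) = (\<Prod>i\<in>UNIV. if m $ i = n $ i then 1 else 0)"
    unfolding eq by (subst integral_prod_vec) (simp_all only: integral_hermite_fun1_mult)
  also have "\<dots> = (if m = n then 1 else 0)"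
    by (auto simp: vec_eq_iff)
  finally show "(LINT x|lborel. hermite_fun m x * hermite_fun n x) = (if m = n then 1 else 0)" .
qed

lemma borel_measurable_hermite_fun [measurable]: "hermite_fun n \<in> borel_measurable borel"
  unfolding hermite_fun_def hermite_fun1_eq
  by (intro borel_measurable_continuous_onI continuous_intros) simp_all

lemma L2_inner_hermite_sum:
  fixes A :: "(nat ^ 'd) set"
  assumes "finite A"
  shows "L2_inner (\<lambda>x. \<Sum>n\<in>A. c n * hermite_fun n x) (hermite_fun m) = (if m \<in> A then c m else 0)"
proof -
  have "L2_inner (\<lambda>x. \<Sum>n\<in>A. c n * hermite_fun n x) (hermite_fun m) =
      (LINT x|lborel. (\<Sum>n\<in>A. c n * (hermite_fun n x * hermite_fun m x)))"
    unfolding L2_inner_def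
    by (subst integral_completion) (simp_all add: sum_distrib_right mult.assoc)
  also have "\<dots> = (\<Sum>n\<in>A. c n * (if n = m then 1 else 0))"
    by (subst Bochner_Integration.integral_sum) (simp_all add: integral_hermite_fun_mult)
  finally show ?thesis using assms by (simp add: sum.delta if_distrib cong: if_cong)
qed

text \<open>The definition sums over nonzero coefficients only; by orthonormality these indices lie
  in A, and the remaining indices of A contribute 0.\<close>

lemma L_inv_sqrt_hermite_sum:
  fixes A :: "(nat ^ 'd) set"
  assumes A: "finite A"
  shows "L_inv_sqrt (\<lambda>x. \<Sum>n\<in>A. c n * hermite_fun n x) x =
    (\<Sum>n\<in>A. c n * (hermite_eigenvalue n powr (- 1 / 2) * hermite_fun n x))"
  unfolding L_inv_sqrt_def L2_inner_hermite_sum[OF A]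
  by (rule sum.mono_neutral_cong_left) (use A in auto)

section \<open>The integral operator and the Schur test\<close>

text \<open>Induction on the polynomial with \<epsilon> arbitrary: half of the Gaussian controls the
  new factor u, the other half is left to the induction hypothesis.\<close>

lemma poly_gauss_bounded:
  fixes P :: "real poly" and \<epsilon> :: real
  assumes "\<epsilon> > 0"
  shows "\<exists>C\<ge>0. \<forall>u. \<bar>poly P u\<bar> * exp (- \<epsilon> * u\<^sup>2) \<le> C"
  using assms
proof (induction P arbitrary: \<epsilon>)
  case (pCons a P)
  then obtain C where C: "C \<ge> 0" "\<And>u. \<bar>poly P u\<bar> * exp (- (\<epsilon> / 2) * u\<^sup>2) \<le> C"
    by (meson half_gt_zero)
  define K where "K = 1 + 2 / \<epsilon>"
  have K: "\<bar>u\<bar> * exp (- (\<epsilon> / 2) * u\<^sup>2) \<le> K" for u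
  proof -
    have "\<bar>u\<bar> \<le> 1 + u\<^sup>2"
      using zero_le_power2[of "\<bar>u\<bar> - 1"] by (simp add: power2_eq_square algebra_simps) 
    also have "\<dots> \<le> K * (1 + \<epsilon> / 2 * u\<^sup>2)"
      using pCons.prems by (simp add: K_def field_simps)
    also have "\<dots> \<le> K * exp (\<epsilon> / 2 * u\<^sup>2)"
      using pCons.prems by (intro mult_left_mono exp_ge_add_one_self) (simp add: K_def)
    finally show ?thesis by (simp add: exp_minus field_simps)
  qed
  have "\<bar>poly (pCons a P) u\<bar> * exp (- \<epsilon> * u\<^sup>2) \<le> \<bar>a\<bar> + K * C" for u
  proof -
    have e: "exp (- \<epsilon> * u\<^sup>2) = exp (- (\<epsilon> / 2) * u\<^sup>2) * exp (- (\<epsilon> / 2) * u\<^sup>2)"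
      by (simp flip: exp_add)
    have "\<bar>poly (pCons a P) u\<bar> * exp (- \<epsilon> * u\<^sup>2) \<le>
        \<bar>a\<bar> * exp (- \<epsilon> * u\<^sup>2) + \<bar>u * poly P u\<bar> * exp (- \<epsilon> * u\<^sup>2)"
      unfolding distrib_right[symmetric] by (intro mult_right_mono) (auto simp: abs_triangle_ineq)
    also have "\<bar>a\<bar> * exp (- \<epsilon> * u\<^sup>2) \<le> \<bar>a\<bar> * 1"
      using pCons.prems by (intro mult_left_mono) auto
    also have "\<bar>u * poly P u\<bar> * exp (- \<epsilon> * u\<^sup>2) =
        (\<bar>u\<bar> * exp (- (\<epsilon> / 2) * u\<^sup>2)) * (\<bar>poly P u\<bar> * exp (- (\<epsilon> / 2) * u\<^sup>2))"
      unfolding e by (simp add: abs_mult mult_ac)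
    also have "\<dots> \<le> K * C"
      using pCons.prems by (intro mult_mono K C) (auto simp: K_def)
    finally show ?thesis by simp
  qed
  moreover have "\<bar>a\<bar> + K * C \<ge> 0" using C pCons.prems by (simp add: K_def)
  ultimately show ?case by blast
qed auto

text \<open>Of the exponent 1/2, one half is spent on the polynomial. The Gaussian majorant that
  remains gives boundedness, integrability of all powers, and room for the Taylor series of the
  sine.\<close>

lemma hermite_fun_gauss_bound:
  "\<exists>C\<ge>0. \<forall>x. \<bar>hermite_fun n x\<bar> \<le> C * exp (- (norm x)\<^sup>2 / 4)"
proof -
  have "\<exists>C\<ge>0. \<forall>u. \<bar>hermite_fun1 k u\<bar> \<le> C * exp (- u\<^sup>2 / 4)" for k
  proof -
    obtain C where C: "C \<ge> 0" "\<And>u. \<bar>poly (hpoly k) u\<bar> * exp (- (1 / 4) * u\<^sup>2) \<le> C"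
      using poly_gauss_bounded[of "1 / 4"] by auto
    have "\<bar>hermite_fun1 k u\<bar> \<le> (hnorm k * C) * exp (- u\<^sup>2 / 4)" for u
    proof -
      have e: "exp (- u\<^sup>2 / 2) = exp (- (1 / 4) * u\<^sup>2) * exp (- u\<^sup>2 / 4)"
        by (simp flip: exp_add)
      have "\<bar>hermite_fun1 k u\<bar> = hnorm k * (\<bar>poly (hpoly k) u\<bar> * exp (- (1 / 4) * u\<^sup>2)) * exp (- u\<^sup>2 / 4)"
        using hnorm_pos[of k] unfolding hermite_fun1_eq e by (simp add: abs_mult)
      also have "\<dots> \<le> hnorm k * C * exp (- u\<^sup>2 / 4)"
        using hnorm_pos[of k] by (intro mult_right_mono mult_left_mono C) auto
      finally show ?thesis .
    qed
    then show ?thesis using C hnorm_pos[of k] by (intro exI[of _ "hnorm k * C"]) auto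
  qed
  then obtain C where C: "\<And>k. C k \<ge> 0" "\<And>k u. \<bar>hermite_fun1 k u\<bar> \<le> C k * exp (- u\<^sup>2 / 4)"
    by metis
  have "\<bar>hermite_fun n x\<bar> \<le> (\<Prod>i\<in>UNIV. C (n $ i)) * exp (- (norm x)\<^sup>2 / 4)" for x
  proof -
    have "\<bar>hermite_fun n x\<bar> \<le> (\<Prod>i\<in>UNIV. C (n $ i) * exp (- (x $ i)\<^sup>2 / 4))"
      unfolding hermite_fun_def abs_prod by (intro prod_mono conjI C) auto
    then show ?thesis
      using exp_norm_square[of "- 1 / 4" x] by (simp add: prod.distrib)
  qed
  then show ?thesis using C by (intro exI[of _ "\<Prod>i\<in>UNIV. C (n $ i)"]) (auto intro: prod_nonneg)
qed

text \<open>The kernel of \<open>S\<close>, before the integration over the time \<open>t\<close> of the semigroup.\<close>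

definition S_kernel :: "real ^ 'd \<Rightarrow> real \<times> (real ^ 'd) \<Rightarrow> real" where
  "S_kernel x z = norm x * gamma_weight (fst z) * mehler (fst z) x (snd z)"

lemma S_kernel_nonneg: "S_kernel x z \<ge> 0"
  by (cases "fst z > 0") (simp_all add: S_kernel_def gamma_weight_def mehler_nonneg)

lemma borel_measurable_S_kernel [measurable (raw)]:
  assumes [measurable]: "f \<in> borel_measurable M" "g \<in> measurable M (borel \<Otimes>\<^sub>M borel)"
  shows "(\<lambda>x. S_kernel (f x :: real ^ 'd) (g x)) \<in> borel_measurable M"
proof -
  have [measurable]: "(\<lambda>x. fst (g x)) \<in> borel_measurable M" "(\<lambda>x. snd (g x)) \<in> borel_measurable M"
    using measurable_compose[OF assms(2) measurable_fst] measurable_compose[OF assms(2) measurable_snd] by auto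
  show ?thesis unfolding S_kernel_def by measurable
qed

text \<open>The row integral. The factor |x| does not depend on y, so only the mass of the Mehler
  kernel enters: \<open>nn_integral_weight_le\<close> with a = |x| and q = -d/2.\<close>

lemma nn_integral_S_kernel_snd:
  fixes x :: "real ^ 'd"
  shows "(\<integral>\<^sup>+z. ennreal (S_kernel x z) \<partial>(lborel \<Otimes>\<^sub>M lborel)) \<le> ennreal 3"
proof -
  have "(\<integral>\<^sup>+z. ennreal (S_kernel x z) \<partial>(lborel \<Otimes>\<^sub>M lborel)) =
      (\<integral>\<^sup>+t. (\<integral>\<^sup>+y. ennreal (S_kernel x (t, y)) \<partial>lborel) \<partial>lborel)"
    by (rule lborel.nn_integral_fst[symmetric]) measurable
  also have "\<dots> = (\<integral>\<^sup>+t. ennreal (norm x * gamma_weight t *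
      (cosh (2 * t) powr (- real CARD('d) / 2) * exp (- tanh (2 * t) * (norm x)\<^sup>2 / 2))) \<partial>lborel)"
  proof (rule nn_integral_cong)
    fix t :: real
    show "(\<integral>\<^sup>+y. ennreal (S_kernel x (t, y)) \<partial>lborel) = ennreal (norm x * gamma_weight t *
      (cosh (2 * t) powr (- real CARD('d) / 2) * exp (- tanh (2 * t) * (norm x)\<^sup>2 / 2)))"
    proof (cases "t > 0")
      case True
      have "(\<integral>\<^sup>+y. ennreal (S_kernel x (t, y)) \<partial>lborel) =
          (\<integral>\<^sup>+y. ennreal (norm x * gamma_weight t) * ennreal (mehler t x y) \<partial>lborel)"
        by (simp add: S_kernel_def ennreal_mult gamma_weight_nonneg mehler_nonneg[OF True])
      also have "\<dots> = ennreal (norm x * gamma_weight t) * ennreal (mehler_mass t x)"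
        by (subst nn_integral_cmult) (simp_all add: nn_integral_mehler[OF True])
      finally show ?thesis
        using gamma_weight_nonneg[of t] mehler_mass_nonneg[of t x]
        by (simp add: mehler_mass_def ennreal_mult)
    qed (simp add: S_kernel_def gamma_weight_def)
  qed
  also have "\<dots> \<le> ennreal 1.7"
    by (rule nn_integral_weight_le) (auto simp: Suc_le_eq)
  also have "\<dots> \<le> ennreal 3" by (intro ennreal_leI) simp
  finally show ?thesis .
qed

text \<open>The column integral. By symmetry of the Mehler kernel it is a first moment of
  \<open>mehler t y\<close>, hence the row estimate at y plus the fluctuation. The order, x
  innermost and y fixed, is the one that the Schur test produces.\<close>

lemma nn_integral_S_kernel_fst:
  fixes y :: "real ^ 'd"
  shows "(\<integral>\<^sup>+t. (\<integral>\<^sup>+x. ennreal (S_kernel x (t, y)) \<partial>lborel) \<partial>lborel) \<le> ennreal 3"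
proof -
  define q where "q = - real CARD('d) / 2"
  have d: "CARD('d) \<ge> 1" by (simp add: Suc_le_eq)
  have "(\<integral>\<^sup>+x. ennreal (S_kernel x (t, y)) \<partial>lborel) \<le>
      ennreal (norm y * gamma_weight t * (cosh (2 * t) powr q * exp (- tanh (2 * t) * (norm y)\<^sup>2 / 2))) +
      ennreal (gamma_weight t * (cosh (2 * t) powr q * sqrt (real CARD('d) * tanh (2 * t))))" for t
  proof (cases "t > 0")
    case True
    have th: "tanh (2 * t) > 0" using True by simp
    have "(\<integral>\<^sup>+x. ennreal (S_kernel x (t, y)) \<partial>lborel) =
        (\<integral>\<^sup>+x. ennreal (gamma_weight t) * ennreal (norm x * mehler t y x) \<partial>lborel)"
      by (simp add: S_kernel_def gamma_weight_nonneg mehler_nonneg[OF True] mehler_commute[of t y] mult.left_commute mult.assoc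
          flip: ennreal_mult)
    also have "\<dots> = ennreal (gamma_weight t) * (\<integral>\<^sup>+x. ennreal (norm x * mehler t y x) \<partial>lborel)"
      by (rule nn_integral_cmult) measurable
    also have "\<dots> \<le> ennreal (gamma_weight t) *
        ennreal (mehler_mass t y * (norm y + sqrt (real CARD('d) * tanh (2 * t))))"
      by (intro mult_left_mono nn_integral_mehler_norm_le True) simp
    also have "\<dots> = ennreal (gamma_weight t * (mehler_mass t y * (norm y + sqrt (real CARD('d) * tanh (2 * t)))))"
      using th gamma_weight_nonneg[of t] mehler_mass_nonneg[of t y] by (simp add: ennreal_mult)
    also have "\<dots> \<le> ennreal (norm y * gamma_weight t * (cosh (2 * t) powr q * exp (- tanh (2 * t) * (norm y)\<^sup>2 / 2)) +
        gamma_weight t * (cosh (2 * t) powr q * sqrt (real CARD('d) * tanh (2 * t))))"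
    proof (rule ennreal_leI)
      \<comment> \<open>In the fluctuation term the Gaussian decay in |y| is discarded; the cosh
        factor alone suffices there.\<close>
      have "mehler_mass t y \<le> cosh (2 * t) powr q * 1"
        unfolding mehler_mass_def q_def using th by (intro mult_left_mono) (auto intro!: mult_nonneg_nonneg)
      then have "gamma_weight t * (mehler_mass t y * sqrt (real CARD('d) * tanh (2 * t))) \<le>
          gamma_weight t * (cosh (2 * t) powr q * sqrt (real CARD('d) * tanh (2 * t)))"
        using th gamma_weight_nonneg[of t] by (intro mult_left_mono mult_right_mono) auto
      moreover have "gamma_weight t * (mehler_mass t y * norm y) =
          norm y * gamma_weight t * (cosh (2 * t) powr q * exp (- tanh (2 * t) * (norm y)\<^sup>2 / 2))"
        by (simp add: mehler_mass_def q_def)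
      ultimately show "gamma_weight t * (mehler_mass t y * (norm y + sqrt (real CARD('d) * tanh (2 * t)))) \<le>
          norm y * gamma_weight t * (cosh (2 * t) powr q * exp (- tanh (2 * t) * (norm y)\<^sup>2 / 2)) +
          gamma_weight t * (cosh (2 * t) powr q * sqrt (real CARD('d) * tanh (2 * t)))"
        unfolding distrib_left by linarith
    qed
    also have "\<dots> = ennreal (norm y * gamma_weight t * (cosh (2 * t) powr q * exp (- tanh (2 * t) * (norm y)\<^sup>2 / 2))) +
      ennreal (gamma_weight t * (cosh (2 * t) powr q * sqrt (real CARD('d) * tanh (2 * t))))"
      using th gamma_weight_nonneg[of t] by (intro ennreal_plus) auto
    finally show ?thesis .
  qed (simp add: S_kernel_def gamma_weight_def)
  then have "(\<integral>\<^sup>+t. (\<integral>\<^sup>+x. ennreal (S_kernel x (t, y)) \<partial>lborel) \<partial>lborel) \<le>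
      (\<integral>\<^sup>+t. ennreal (norm y * gamma_weight t * (cosh (2 * t) powr q * exp (- tanh (2 * t) * (norm y)\<^sup>2 / 2))) +
        ennreal (gamma_weight t * (cosh (2 * t) powr q * sqrt (real CARD('d) * tanh (2 * t)))) \<partial>lborel)"
    by (intro nn_integral_mono)
  also have "\<dots> = (\<integral>\<^sup>+t. ennreal (norm y * gamma_weight t * (cosh (2 * t) powr q * exp (- tanh (2 * t) * (norm y)\<^sup>2 / 2))) \<partial>lborel) +
      (\<integral>\<^sup>+t. ennreal (gamma_weight t * (cosh (2 * t) powr q * sqrt (real CARD('d) * tanh (2 * t)))) \<partial>lborel)"
    unfolding tanh_def by (rule nn_integral_add) measurable
  also have "\<dots> \<le> ennreal 1.7 + ennreal 1.26"
    using d nn_integral_weight_tanh_le[OF d]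
    by (intro add_mono nn_integral_weight_le) (simp_all add: q_def)
  also have "\<dots> = ennreal (1.7 + 1.26)" by (rule ennreal_plus[symmetric]) simp_all
  also have "\<dots> \<le> ennreal 3" by (intro ennreal_leI) simp
  finally show ?thesis .
qed

section \<open>Jensen's inequality and the Schur test\<close>

text \<open>The weighted arithmetic-geometric mean inequality with weights 1/p and 1 - 1/p. No
  conjugate exponent occurs, so p = 1 is included.\<close>

lemma Young_powr:
  fixes a b p :: real
  assumes "p \<ge> 1" "a \<ge> 0" "b > 0"
  shows "p * (a * b powr (p - 1)) \<le> a powr p + (p - 1) * b powr p"
proof (cases "a = 0")
  case False
  then have "(a powr p) powr (1 / p) * (b powr p) powr (1 - 1 / p) \<le> 1 / p * a powr p + (1 - 1 / p) * b powr p"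
    using assms by (intro Youngs_inequality_0) auto
  also have "(a powr p) powr (1 / p) * (b powr p) powr (1 - 1 / p) = a * b powr (p - 1)"
    using assms by (simp add: powr_powr right_diff_distrib)
  finally have "p * (a * b powr (p - 1)) \<le> p * (1 / p * a powr p + (1 - 1 / p) * b powr p)"
    using assms by (intro mult_left_mono) auto
  then show ?thesis using assms by (simp add: distrib_left right_diff_distrib left_diff_distrib)
qed (use assms in auto)

text \<open>
  Jensen's inequality for a measure of mass at most \<open>C\<close>: integrate Young's inequality
  \<open>p a b\<^sup>p\<^sup>-\<^sup>1 \<le> a\<^sup>p + (p - 1) b\<^sup>p\<close> with \<open>b\<close> the mean of \<open>\<bar>f\<bar>\<close>.
\<close>

lemma weighted_powr_mean:
  fixes q f :: "'a \<Rightarrow> real"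
  assumes p: "p \<ge> 1" and C: "C > 0"
    and [measurable]: "q \<in> borel_measurable M" "f \<in> borel_measurable M"
    and q: "\<And>z. q z \<ge> 0" and qC: "(\<integral>\<^sup>+z. ennreal (q z) \<partial>M) \<le> ennreal C"
    and J: "(\<integral>\<^sup>+z. ennreal (q z * \<bar>f z\<bar> powr p) \<partial>M) < \<infinity>"
  shows "integrable M (\<lambda>z. q z * f z)"
    and "ennreal (\<bar>LINT z|M. q z * f z\<bar> powr p) \<le>
      ennreal (C powr (p - 1)) * (\<integral>\<^sup>+z. ennreal (q z * \<bar>f z\<bar> powr p) \<partial>M)"
proof -
  have iq: "integrable M q"
    using q qC by (intro integrableI_nonneg) (auto simp: less_top[symmetric] top_unique)
  have iJ: "integrable M (\<lambda>z. q z * \<bar>f z\<bar> powr p)"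
    using q J by (intro integrableI_nonneg) auto
  have le: "p * (b powr (p - 1)) * (q z * \<bar>f z\<bar>) \<le> q z * \<bar>f z\<bar> powr p + (p - 1) * b powr p * q z"
    if "b > 0" for b z
    using mult_left_mono[OF Young_powr[OF p abs_ge_zero that, of "f z"] q[of z]]
    by (simp add: algebra_simps)
  have "integrable M (\<lambda>z. q z * \<bar>f z\<bar>)"
  proof (rule Bochner_Integration.integrable_bound)
    \<comment> \<open>The majorant is Young's inequality at b = 1.\<close>
    show "integrable M (\<lambda>z. q z * \<bar>f z\<bar> powr p + (p - 1) * q z)"
      using iq iJ by auto
    show "AE z in M. norm (q z * \<bar>f z\<bar>) \<le> norm (q z * \<bar>f z\<bar> powr p + (p - 1) * q z)"
    proof (rule AE_I2)
      fix z
      have "1 * (q z * \<bar>f z\<bar>) \<le> p * (q z * \<bar>f z\<bar>)"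
        using p q[of z] by (intro mult_right_mono) auto
      then show "norm (q z * \<bar>f z\<bar>) \<le> norm (q z * \<bar>f z\<bar> powr p + (p - 1) * q z)"
        using le[of 1 z] p q[of z] by simp
    qed
  qed measurable
  then show int: "integrable M (\<lambda>z. q z * f z)"
    by (rule Bochner_Integration.integrable_bound) (auto simp: abs_mult)
  define I where "I = (LINT z|M. q z * \<bar>f z\<bar>)"
  have I0: "I \<ge> 0" unfolding I_def using q by (intro integral_nonneg_AE) auto
  have "\<bar>LINT z|M. q z * f z\<bar> \<le> (LINT z|M. \<bar>q z * f z\<bar>)"
    by (rule integral_abs_bound)
  also have "\<dots> = I" unfolding I_def using q by (simp add: abs_mult)
  finally have I: "\<bar>LINT z|M. q z * f z\<bar> \<le> I" .
  have "I powr p \<le> C powr (p - 1) * (LINT z|M. q z * \<bar>f z\<bar> powr p)"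
  proof (cases "I = 0")
    case True
    then show ?thesis using q by (auto intro!: integral_nonneg_AE)
  next
    case False
    with I0 have I0: "I > 0" by simp
    \<comment> \<open>Dividing by the bound C rather than by the mass: the integrated inequality
      then has p b^p C on the left and (p - 1) b^p C on the right, and the difference is b^p
      C.\<close>
    define b where "b = I / C"
    have b: "b > 0" "I = b * C" using I0 C by (simp_all add: b_def)
    have "p * (b powr (p - 1)) * I \<le> (LINT z|M. q z * \<bar>f z\<bar> powr p + (p - 1) * b powr p * q z)"
      unfolding I_def integral_mult_right_zero[symmetric]
      using \<open>integrable M (\<lambda>z. q z * \<bar>f z\<bar>)\<close> iq iJ le[OF b(1)]
      by (intro integral_mono) auto
    also have "\<dots> = (LINT z|M. q z * \<bar>f z\<bar> powr p) + (p - 1) * b powr p * (LINT z|M. q z)"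
      using iq iJ by simp
    also have "(LINT z|M. q z) \<le> C"
      using qC q C iq by (simp add: nn_integral_eq_integral)
    finally have "p * (b powr (p - 1)) * I \<le> (LINT z|M. q z * \<bar>f z\<bar> powr p) + (p - 1) * b powr p * C"
      using p by (simp add: mult_left_mono)
    moreover have "b powr (p - 1) * I = b powr p * C"
      using b by (simp add: powr_diff)
    then have "p * (b powr (p - 1)) * I = p * (b powr p * C)"
      by (simp only: mult.assoc)
    ultimately have "p * (b powr p * C) \<le> (LINT z|M. q z * \<bar>f z\<bar> powr p) + (p - 1) * b powr p * C"
      by linarith
    then have "b powr p * C \<le> (LINT z|M. q z * \<bar>f z\<bar> powr p)"
      by (simp add: algebra_simps)
    then have "C powr (p - 1) * (b powr p * C) \<le> C powr (p - 1) * (LINT z|M. q z * \<bar>f z\<bar> powr p)"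
      by (intro mult_left_mono) auto
    moreover have "I powr p = C powr (p - 1) * (b powr p * C)"
      using b C by (simp add: powr_mult powr_diff)
    ultimately show ?thesis by simp
  qed
  moreover have "\<bar>LINT z|M. q z * f z\<bar> powr p \<le> I powr p"
    using I p by (intro powr_mono2) auto
  ultimately have "ennreal (\<bar>LINT z|M. q z * f z\<bar> powr p) \<le>
      ennreal (C powr (p - 1) * (LINT z|M. q z * \<bar>f z\<bar> powr p))"
    by (intro ennreal_leI) linarith
  also have "\<dots> = ennreal (C powr (p - 1)) * (\<integral>\<^sup>+z. ennreal (q z * \<bar>f z\<bar> powr p) \<partial>M)"
    using nn_integral_eq_integral[OF iJ] q ennreal_mult[of "C powr (p - 1)" "LINT z|M. q z * \<bar>f z\<bar> powr p"]
    by (simp add: integral_nonneg_AE)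
  finally show "ennreal (\<bar>LINT z|M. q z * f z\<bar> powr p) \<le>
      ennreal (C powr (p - 1)) * (\<integral>\<^sup>+z. ennreal (q z * \<bar>f z\<bar> powr p) \<partial>M)" .
qed

text \<open>Time and space are integrated jointly. Integrating out t first would give a kernel that
  is infinite on the diagonal away from the origin, since t^(-1/2 - d/2) is not integrable at
  0.\<close>

definition S_int :: "(real ^ 'd \<Rightarrow> real) \<Rightarrow> real ^ 'd \<Rightarrow> real" where
  "S_int f x = (LINT z|(lborel \<Otimes>\<^sub>M lborel). S_kernel x z * f (snd z))"

lemma borel_measurable_S_int [measurable]:
  assumes [measurable]: "f \<in> borel_measurable borel"
  shows "S_int f \<in> borel_measurable borel"
proof -
  interpret sigma_finite_measure "lborel \<Otimes>\<^sub>M lborel :: (real \<times> (real ^ 'd)) measure"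
    unfolding lborel_prod by (rule sigma_finite_lborel)
  have "(\<lambda>x. LINT z|(lborel \<Otimes>\<^sub>M lborel). S_kernel x z * f (snd z)) \<in> borel_measurable borel"
    by measurable
  then show ?thesis by (simp add: S_int_def[abs_def])
qed

text \<open>At each x the row bound 3 enters through \<open>weighted_powr_mean\<close> with exponent
  p - 1; integrating \<open>J\<close> over x brings in the column bound once, which makes 3^p in
  total.\<close>

lemma S_int_Lp_bound:
  fixes f :: "real ^ 'd \<Rightarrow> real"
  assumes p: "p \<ge> 1" and [measurable]: "f \<in> borel_measurable borel"
    and f: "integrable lborel (\<lambda>x. \<bar>f x\<bar> powr p)"
  shows "AE x in lborel. integrable (lborel \<Otimes>\<^sub>M lborel) (\<lambda>z. S_kernel x z * f (snd z))"
    and "integrable lborel (\<lambda>x. \<bar>S_int f x\<bar> powr p)"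
    and "(LINT x|lborel. \<bar>S_int f x\<bar> powr p) \<le> 3 powr p * (LINT x|lborel. \<bar>f x\<bar> powr p)"
proof -
  interpret N: sigma_finite_measure "lborel \<Otimes>\<^sub>M lborel :: (real \<times> (real ^ 'd)) measure"
    unfolding lborel_prod by (rule sigma_finite_lborel)
  interpret P: pair_sigma_finite "lborel :: (real ^ 'd) measure" "lborel \<Otimes>\<^sub>M lborel :: (real \<times> (real ^ 'd)) measure"
    by standard
  define J where "J x = (\<integral>\<^sup>+z. ennreal (S_kernel x z * \<bar>f (snd z)\<bar> powr p) \<partial>(lborel \<Otimes>\<^sub>M lborel))" for x
  have [measurable]: "J \<in> borel_measurable borel"
    unfolding J_def by measurable
  have "(\<integral>\<^sup>+x. J x \<partial>lborel) =
      (\<integral>\<^sup>+z. (\<integral>\<^sup>+x. ennreal (S_kernel x z * \<bar>f (snd z)\<bar> powr p) \<partial>lborel) \<partial>(lborel \<Otimes>\<^sub>M lborel))"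
    unfolding J_def by (rule P.Fubini'[symmetric]) measurable
  also have "\<dots> = (\<integral>\<^sup>+y. (\<integral>\<^sup>+t. (\<integral>\<^sup>+x. ennreal (S_kernel x (t, y) * \<bar>f y\<bar> powr p) \<partial>lborel) \<partial>lborel) \<partial>lborel)"
  proof -
    have "(\<lambda>z. \<integral>\<^sup>+x. ennreal (S_kernel x z * \<bar>f (snd z)\<bar> powr p) \<partial>lborel)
        \<in> borel_measurable (lborel \<Otimes>\<^sub>M lborel)"
      by (rule lborel.borel_measurable_nn_integral) measurable
    from lborel_pair.nn_integral_snd[OF this] show ?thesis by simp
  qed
  also have "\<dots> = (\<integral>\<^sup>+y. (\<integral>\<^sup>+t. (\<integral>\<^sup>+x. ennreal (S_kernel x (t, y)) \<partial>lborel) \<partial>lborel) * ennreal (\<bar>f y\<bar> powr p) \<partial>lborel)"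
    by (simp add: ennreal_mult S_kernel_nonneg nn_integral_multc)
  also have "\<dots> \<le> (\<integral>\<^sup>+y. ennreal 3 * ennreal (\<bar>f y\<bar> powr p) \<partial>lborel)"
    by (intro nn_integral_mono mult_right_mono nn_integral_S_kernel_fst) simp
  also have "\<dots> = ennreal (3 * (LINT y|lborel. \<bar>f y\<bar> powr p))"
    using f by (simp add: nn_integral_cmult nn_integral_eq_integral ennreal_mult integral_nonneg_AE)
  finally have J: "(\<integral>\<^sup>+x. J x \<partial>lborel) \<le> ennreal (3 * (LINT y|lborel. \<bar>f y\<bar> powr p))" .
  then have "(\<integral>\<^sup>+x. J x \<partial>lborel) \<noteq> \<infinity>" by (auto simp: top_unique)
  then have fin: "AE x in lborel. J x < \<infinity>"
    using nn_integral_PInf_AE[of J lborel] by (simp add: less_top)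
  \<comment> \<open>Nothing is claimed where \<open>J\<close> is infinite. There
    \<open>S_int f x\<close> may be the default value 0 of a divergent integral, but only on a null
    set.\<close>
  have mean: "integrable (lborel \<Otimes>\<^sub>M lborel) (\<lambda>z. S_kernel x z * f (snd z))"
      "ennreal (\<bar>S_int f x\<bar> powr p) \<le> ennreal (3 powr (p - 1)) * J x" if "J x < \<infinity>" for x
    using weighted_powr_mean[OF p, of 3 "S_kernel x" "lborel \<Otimes>\<^sub>M lborel" "\<lambda>z. f (snd z)"] that
      nn_integral_S_kernel_snd[of x]
    by (simp_all add: S_kernel_nonneg J_def S_int_def)
  show "AE x in lborel. integrable (lborel \<Otimes>\<^sub>M lborel) (\<lambda>z. S_kernel x z * f (snd z))"
    using fin by eventually_elim (rule mean)
  have "(\<integral>\<^sup>+x. ennreal (\<bar>S_int f x\<bar> powr p) \<partial>lborel) \<le> (\<integral>\<^sup>+x. ennreal (3 powr (p - 1)) * J x \<partial>lborel)"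
  proof (rule nn_integral_mono_AE)
    show "AE x in lborel. ennreal (\<bar>S_int f x\<bar> powr p) \<le> ennreal (3 powr (p - 1)) * J x"
      using fin by eventually_elim (rule mean)
  qed
  also have "\<dots> = ennreal (3 powr (p - 1)) * (\<integral>\<^sup>+x. J x \<partial>lborel)"
    by (rule nn_integral_cmult) measurable
  also have "\<dots> \<le> ennreal (3 powr (p - 1)) * ennreal (3 * (LINT y|lborel. \<bar>f y\<bar> powr p))"
    by (intro mult_left_mono J) simp
  also have "\<dots> = ennreal (3 powr p * (LINT y|lborel. \<bar>f y\<bar> powr p))"
    by (simp add: powr_diff integral_nonneg_AE flip: ennreal_mult)
  finally have le: "(\<integral>\<^sup>+x. ennreal (\<bar>S_int f x\<bar> powr p) \<partial>lborel) \<le>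
      ennreal (3 powr p * (LINT y|lborel. \<bar>f y\<bar> powr p))" .
  then show int: "integrable lborel (\<lambda>x. \<bar>S_int f x\<bar> powr p)"
    by (intro integrableI_nonneg) (auto simp: less_top[symmetric] top_unique)
  show "(LINT x|lborel. \<bar>S_int f x\<bar> powr p) \<le> 3 powr p * (LINT x|lborel. \<bar>f x\<bar> powr p)"
    using le int by (simp add: nn_integral_eq_integral integral_nonneg_AE)
qed

lemma hermite_eigenvalue_pos: "hermite_eigenvalue (n :: nat ^ 'd) > 0"
  unfolding hermite_eigenvalue_def by (intro add_nonneg_pos) (simp_all add: sum_nonneg)

text \<open>Hermite functions are bounded and the row mass is finite at every x, so the integral
  converges everywhere, not only almost everywhere. Fubini then leaves the subordination formula at
  the eigenvalue.\<close>

lemma S_int_hermite_fun: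
  fixes x :: "real ^ 'd"
  shows "integrable (lborel \<Otimes>\<^sub>M lborel) (\<lambda>z. S_kernel x z * hermite_fun n (snd z))"
    and "S_int (hermite_fun n) x = norm x * (hermite_eigenvalue n powr (- 1 / 2) * hermite_fun n x)"
proof -
  obtain C where C: "C \<ge> 0" "\<And>y. \<bar>hermite_fun n y\<bar> \<le> C * exp (- (norm y)\<^sup>2 / 4)"
    using hermite_fun_gauss_bound[of n] by blast
  have C': "\<bar>hermite_fun n y\<bar> \<le> C" for y
  proof -
    have "C * exp (- (norm y)\<^sup>2 / 4) \<le> C * 1" using C(1) by (intro mult_left_mono) auto
    then show ?thesis using C(2)[of y] by simp
  qed
  have "integrable (lborel \<Otimes>\<^sub>M lborel) (S_kernel x)"
    using nn_integral_S_kernel_snd[of x]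
    by (intro integrableI_nonneg) (auto simp: less_top[symmetric] top_unique S_kernel_nonneg)
  then have "integrable (lborel \<Otimes>\<^sub>M lborel) (\<lambda>z. C * S_kernel x z)" by simp
  then show int: "integrable (lborel \<Otimes>\<^sub>M lborel) (\<lambda>z. S_kernel x z * hermite_fun n (snd z))"
  proof (rule Bochner_Integration.integrable_bound)
    show "AE z in (lborel \<Otimes>\<^sub>M lborel). norm (S_kernel x z * hermite_fun n (snd z)) \<le> norm (C * S_kernel x z)"
      using C(1) C' S_kernel_nonneg by (intro AE_I2) (simp add: abs_mult mult.commute[of C] mult_left_mono)
  qed measurable
  have "S_int (hermite_fun n) x = (LINT t|lborel. (LINT y|lborel. S_kernel x (t, y) * hermite_fun n y))"
    unfolding S_int_def using lborel_pair.integral_fst'[OF int] by simp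
  also have "\<dots> = (LINT t|lborel. norm x * hermite_fun n x * (gamma_weight t * exp (- t * hermite_eigenvalue n)))"
  proof (rule Bochner_Integration.integral_cong[OF refl])
    fix t :: real
    show "(LINT y|lborel. S_kernel x (t, y) * hermite_fun n y) =
        norm x * hermite_fun n x * (gamma_weight t * exp (- t * hermite_eigenvalue n))"
    proof (cases "t > 0")
      case True
      have "(LINT y|lborel. S_kernel x (t, y) * hermite_fun n y) =
          norm x * gamma_weight t * (LINT y|lborel. mehler t x y * hermite_fun n y)"
        by (simp add: S_kernel_def mult.assoc)
      then show ?thesis by (simp add: mehler_hermite_fun[OF True])
    qed (simp add: S_kernel_def gamma_weight_def)
  qed
  also have "\<dots> = norm x * hermite_fun n x * (LINT t|lborel. gamma_weight t * exp (- t * hermite_eigenvalue n))"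
    by simp
  also have "(LINT t|lborel. gamma_weight t * exp (- t * hermite_eigenvalue n)) = hermite_eigenvalue n powr (- 1 / 2)"
    using nn_integral_gamma_weight_exp[OF hermite_eigenvalue_pos[of n]] gamma_weight_nonneg
    by (subst integral_eq_nn_integral) (auto simp: mult_ac)
  finally show "S_int (hermite_fun n) x = norm x * (hermite_eigenvalue n powr (- 1 / 2) * hermite_fun n x)"
    by (simp add: mult_ac)
qed

lemma S_int_eq_S_op:
  fixes f :: "real ^ 'd \<Rightarrow> real"
  assumes "f \<in> hermite_span"
  shows "S_int f = S_op f"
proof
  fix x
  obtain A c where A: "finite A" and f: "f = (\<lambda>x. \<Sum>n\<in>A. c n * hermite_fun n x)"
    using assms by (auto simp: hermite_span_def)
  have "S_int f x = (LINT z|(lborel \<Otimes>\<^sub>M lborel). (\<Sum>n\<in>A. c n * (S_kernel x z * hermite_fun n (snd z))))"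
    by (simp add: S_int_def f sum_distrib_left mult.left_commute)
  also have "\<dots> = (\<Sum>n\<in>A. c n * S_int (hermite_fun n) x)"
    by (subst Bochner_Integration.integral_sum) (simp_all add: S_int_hermite_fun(1) flip: S_int_def)
  also have "\<dots> = S_op f x"
    unfolding S_op_def f L_inv_sqrt_hermite_sum[OF A] S_int_hermite_fun(2)
    by (simp add: sum_distrib_left mult.left_commute)
  finally show "S_int f x = S_op f x" .
qed

section \<open>Density of the Hermite span\<close>

text \<open>A crude stand-in for Minkowski's inequality: density and uniqueness only ask that
  integrals of p-th powers become small, so the factor 2^p is harmless.\<close>

lemma powr_add_le:
  fixes a b p :: real
  assumes "p \<ge> 1"
  shows "\<bar>a + b\<bar> powr p \<le> 2 powr p * (\<bar>a\<bar> powr p + \<bar>b\<bar> powr p)"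
proof -
  have "\<bar>a + b\<bar> powr p \<le> (2 * max \<bar>a\<bar> \<bar>b\<bar>) powr p"
    using assms by (intro powr_mono2) auto
  also have "\<dots> = 2 powr p * max \<bar>a\<bar> \<bar>b\<bar> powr p" by (simp add: powr_mult)
  also have "\<dots> \<le> 2 powr p * (\<bar>a\<bar> powr p + \<bar>b\<bar> powr p)"
    by (intro mult_left_mono) (auto simp: max_def)
  finally show ?thesis .
qed

lemma integrable_powr_bound:
  fixes f w :: "'a \<Rightarrow> real"
  assumes "p \<ge> 1" "integrable M (\<lambda>x. \<bar>w x\<bar> powr p)"
    and [measurable]: "f \<in> borel_measurable M"
    and le: "\<And>x. \<bar>f x\<bar> \<le> \<bar>w x\<bar>"
  shows "integrable M (\<lambda>x. \<bar>f x\<bar> powr p)"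
  using assms(2)
proof (rule Bochner_Integration.integrable_bound)
  show "AE x in M. norm (\<bar>f x\<bar> powr p) \<le> norm (\<bar>w x\<bar> powr p)"
    using assms by (intro AE_I2) (simp add: powr_mono2)
qed measurable

lemma integrable_powr_add:
  fixes f g :: "'a \<Rightarrow> real"
  assumes p: "p \<ge> 1" and [measurable]: "f \<in> borel_measurable M" "g \<in> borel_measurable M"
    and f: "integrable M (\<lambda>x. \<bar>f x\<bar> powr p)" and g: "integrable M (\<lambda>x. \<bar>g x\<bar> powr p)"
  shows "integrable M (\<lambda>x. \<bar>f x + g x\<bar> powr p)"
    and "(LINT x|M. \<bar>f x + g x\<bar> powr p) \<le>
      2 powr p * ((LINT x|M. \<bar>f x\<bar> powr p) + (LINT x|M. \<bar>g x\<bar> powr p))"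
proof -
  have fg: "integrable M (\<lambda>x. 2 powr p * (\<bar>f x\<bar> powr p + \<bar>g x\<bar> powr p))"
    using f g by auto
  show int: "integrable M (\<lambda>x. \<bar>f x + g x\<bar> powr p)"
  proof (rule Bochner_Integration.integrable_bound[OF fg])
    show "AE x in M. norm (\<bar>f x + g x\<bar> powr p) \<le> norm (2 powr p * (\<bar>f x\<bar> powr p + \<bar>g x\<bar> powr p))"
      using powr_add_le[OF p] by (intro AE_I2) (simp add: order_trans[OF _ abs_ge_self])
  qed measurable
  have "(LINT x|M. \<bar>f x + g x\<bar> powr p) \<le> (LINT x|M. 2 powr p * (\<bar>f x\<bar> powr p + \<bar>g x\<bar> powr p))"
    using powr_add_le[OF p] by (intro integral_mono int fg) auto
  then show "(LINT x|M. \<bar>f x + g x\<bar> powr p) \<le>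
      2 powr p * ((LINT x|M. \<bar>f x\<bar> powr p) + (LINT x|M. \<bar>g x\<bar> powr p))"
    using f g by simp
qed

lemma integrable_powr_cmult:
  fixes f :: "'a \<Rightarrow> real"
  assumes "integrable M (\<lambda>x. \<bar>f x\<bar> powr p)"
  shows "integrable M (\<lambda>x. \<bar>c * f x\<bar> powr p)"
  using assms by (simp add: abs_mult powr_mult)

lemma integrable_gauss_vec:
  assumes "c > 0"
  shows "integrable lborel (\<lambda>x :: real ^ 'd. exp (- c * (norm x)\<^sup>2))"
proof -
  have "integrable lborel (\<lambda>u :: real. exp (- c * u\<^sup>2))"
  proof -
    define \<sigma> where "\<sigma> = sqrt (1 / (2 * c))"
    have \<sigma>: "\<sigma> > 0" "\<sigma>\<^sup>2 = 1 / (2 * c)" using assms by (simp_all add: \<sigma>_def)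
    have "integrable lborel (\<lambda>u. sqrt (2 * pi * \<sigma>\<^sup>2) * normal_density 0 \<sigma> u)"
      by (intro integrable_mult_right integrable_normal_density \<sigma>)
    moreover have "sqrt (2 * pi * \<sigma>\<^sup>2) * normal_density 0 \<sigma> u = exp (- c * u\<^sup>2)" for u
      using assms \<sigma>(1) unfolding normal_density_def \<sigma>(2) by simp
    ultimately show ?thesis by simp
  qed
  then show ?thesis
    unfolding exp_norm_square by (intro integral_prod_vec)
qed

lemma hermite_span_add:
  assumes "f \<in> hermite_span" "g \<in> hermite_span"
  shows "(\<lambda>x. f x + g x) \<in> hermite_span"
proof -
  obtain A c where A: "finite A" "f = (\<lambda>x. \<Sum>n\<in>A. c n * hermite_fun n x)"
    using assms by (auto simp: hermite_span_def)
  obtain B d where B: "finite B" "g = (\<lambda>x. \<Sum>n\<in>B. d n * hermite_fun n x)"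
    using assms by (auto simp: hermite_span_def)
  define e where "e n = (if n \<in> A then c n else 0) + (if n \<in> B then d n else 0)" for n
  have "f x + g x = (\<Sum>n\<in>A \<union> B. e n * hermite_fun n x)" for x
  proof -
    have "f x = (\<Sum>n\<in>A \<union> B. (if n \<in> A then c n else 0) * hermite_fun n x)"
      unfolding A(2) using A(1) B(1) by (intro sum.mono_neutral_cong_left) auto
    moreover have "g x = (\<Sum>n\<in>A \<union> B. (if n \<in> B then d n else 0) * hermite_fun n x)"
      unfolding B(2) using A(1) B(1) by (intro sum.mono_neutral_cong_left) auto
    ultimately show ?thesis by (simp only: e_def distrib_right sum.distrib)
  qed
  then show ?thesis using A(1) B(1) unfolding hermite_span_def by blast
qed

lemma hermite_span_cmult:
  assumes "f \<in> hermite_span"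
  shows "(\<lambda>x. c * f x) \<in> hermite_span"
proof -
  obtain A b where A: "finite A" "f = (\<lambda>x. \<Sum>n\<in>A. b n * hermite_fun n x)"
    using assms by (auto simp: hermite_span_def)
  then have "(\<lambda>x. c * f x) = (\<lambda>x. \<Sum>n\<in>A. (c * b n) * hermite_fun n x)"
    by (simp add: sum_distrib_left mult.assoc)
  then show ?thesis using A(1) unfolding hermite_span_def
    by (intro CollectI exI[of _ A] exI[of _ "\<lambda>n. c * b n"] conjI) auto
qed

lemma hermite_fun_in_span: "hermite_fun n \<in> hermite_span"
  unfolding hermite_span_def by (intro CollectI exI[of _ "{n}"] exI[of _ "\<lambda>_. 1"]) simp

lemma hermite_span_zero: "(\<lambda>x. 0) \<in> hermite_span"
  unfolding hermite_span_def by (intro CollectI exI[of _ "{}"]) simp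

lemma hermite_span_sum:
  "(\<And>i. i \<in> A \<Longrightarrow> f i \<in> hermite_span) \<Longrightarrow> (\<lambda>x. \<Sum>i\<in>A. f i x) \<in> hermite_span"
proof (induction A rule: infinite_finite_induct)
  case (insert a A)
  then show ?case using hermite_span_add[of "f a" "\<lambda>x. \<Sum>i\<in>A. f i x"] by simp
qed (simp_all add: hermite_span_zero)

lemma hermite_span_times_coord:
  fixes f :: "real ^ 'd \<Rightarrow> real"
  assumes "f \<in> hermite_span"
  shows "(\<lambda>x. x $ i * f x) \<in> hermite_span"
proof -
  have one: "(\<lambda>x. x $ i * hermite_fun n x) \<in> hermite_span" for n :: "nat ^ 'd"
  proof -
    define upd where "upd k = (\<chi> j. if j = i then k else n $ j)" for k
    have upd: "hermite_fun (upd k) x = hermite_fun1 k (x $ i) * (\<Prod>j\<in>UNIV - {i}. hermite_fun1 (n $ j) (x $ j))"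
      for k and x :: "real ^ 'd"
    proof -
      have "(\<Prod>j\<in>UNIV - {i}. hermite_fun1 (upd k $ j) (x $ j)) = (\<Prod>j\<in>UNIV - {i}. hermite_fun1 (n $ j) (x $ j))"
        by (rule prod.cong) (auto simp: upd_def)
      then show ?thesis
        unfolding hermite_fun_def by (subst prod.remove[of _ i]) (auto simp: upd_def)
    qed
    have n: "hermite_fun n x = hermite_fun1 (n $ i) (x $ i) * (\<Prod>j\<in>UNIV - {i}. hermite_fun1 (n $ j) (x $ j))"
      for x :: "real ^ 'd"
      unfolding hermite_fun_def by (subst prod.remove[of _ i]) auto
    obtain a b where ab: "\<And>u. u * hermite_fun1 (n $ i) u =
        a * hermite_fun1 (Suc (n $ i)) u + b * hermite_fun1 (n $ i - 1) u"
      using hermite_fun1_times by blast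
    have "x $ i * hermite_fun n x =
        a * hermite_fun (upd (Suc (n $ i))) x + b * hermite_fun (upd (n $ i - 1)) x" for x :: "real ^ 'd"
      unfolding n upd using ab[of "x $ i"] by (simp add: algebra_simps flip: mult.assoc)
    then show ?thesis
      by (simp add: hermite_span_add hermite_span_cmult hermite_fun_in_span)
  qed
  obtain A c where A: "finite A" "f = (\<lambda>x. \<Sum>n\<in>A. c n * hermite_fun n x)"
    using assms by (auto simp: hermite_span_def)
  have "(\<lambda>x. x $ i * f x) = (\<lambda>x. \<Sum>n\<in>A. c n * (x $ i * hermite_fun n x))"
    by (simp add: A(2) sum_distrib_left mult.left_commute)
  then show ?thesis
    by (simp add: hermite_span_sum hermite_span_cmult one)
qed

lemma hermite_span_times_coord_power:
  "f \<in> hermite_span \<Longrightarrow> (\<lambda>x. (x $ i) ^ k * f x) \<in> hermite_span"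
proof (induction k)
  case (Suc k)
  then show ?case using hermite_span_times_coord[of "\<lambda>x. (x $ i) ^ k * f x" i] by (simp add: mult.assoc)
qed simp

lemma borel_measurable_hermite_span: "f \<in> hermite_span \<Longrightarrow> f \<in> borel_measurable borel"
  by (auto simp: hermite_span_def)

lemma hermite_span_gauss_bound:
  fixes f :: "real ^ 'd \<Rightarrow> real"
  assumes "f \<in> hermite_span"
  shows "\<exists>C\<ge>0. \<forall>x. \<bar>f x\<bar> \<le> C * exp (- (norm x)\<^sup>2 / 4)"
proof -
  obtain A c where A: "finite A" "f = (\<lambda>x. \<Sum>n\<in>A. c n * hermite_fun n x)"
    using assms by (auto simp: hermite_span_def)
  have "\<forall>n :: nat ^ 'd. \<exists>C\<ge>0. \<forall>x. \<bar>hermite_fun n x\<bar> \<le> C * exp (- (norm x)\<^sup>2 / 4)"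
    using hermite_fun_gauss_bound by blast
  then obtain C where C: "\<And>n :: nat ^ 'd. C n \<ge> 0"
      "\<And>(n :: nat ^ 'd) x. \<bar>hermite_fun n x\<bar> \<le> C n * exp (- (norm x)\<^sup>2 / 4)"
    by metis
  have "\<bar>f x\<bar> \<le> (\<Sum>n\<in>A. \<bar>c n\<bar> * C n) * exp (- (norm x)\<^sup>2 / 4)" for x
  proof -
    have "\<bar>f x\<bar> \<le> (\<Sum>n\<in>A. \<bar>c n * hermite_fun n x\<bar>)" unfolding A(2) by (rule sum_abs)
    also have "\<dots> \<le> (\<Sum>n\<in>A. \<bar>c n\<bar> * (C n * exp (- (norm x)\<^sup>2 / 4)))"
      unfolding abs_mult by (intro sum_mono mult_left_mono C) auto
    finally show ?thesis by (simp add: sum_distrib_right mult.assoc)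
  qed
  then show ?thesis using C by (intro exI[of _ "\<Sum>n\<in>A. \<bar>c n\<bar> * C n"]) (auto intro: sum_nonneg)
qed

lemma integrable_powr_gauss:
  fixes a c p :: real
  assumes "p \<ge> 1" "c > 0"
  shows "integrable lborel (\<lambda>x :: real ^ 'd. \<bar>a * exp (- c * (norm x)\<^sup>2)\<bar> powr p)"
proof (rule integrable_powr_cmult)
  have "integrable lborel (\<lambda>x :: real ^ 'd. exp (- (c * p) * (norm x)\<^sup>2))"
    using assms by (intro integrable_gauss_vec) auto
  then show "integrable lborel (\<lambda>x :: real ^ 'd. \<bar>exp (- c * (norm x)\<^sup>2)\<bar> powr p)"
    by (simp add: exp_powr_real mult_ac)
qed

lemma hermite_span_integrable_powr:
  assumes p: "p \<ge> 1" and f: "f \<in> hermite_span"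
  shows "integrable lborel (\<lambda>x. \<bar>f x\<bar> powr p)"
proof -
  obtain C where C: "C \<ge> 0" "\<And>x. \<bar>f x\<bar> \<le> C * exp (- (norm x)\<^sup>2 / 4)"
    using hermite_span_gauss_bound[OF f] by blast
  show ?thesis
    using C borel_measurable_hermite_span[OF f]
    by (intro integrable_powr_bound[OF p integrable_powr_gauss[OF p, of "1 / 4" C]]) auto
qed

section \<open>The closure of the span in L^p\<close>

text \<open>Distance is the integral of the p-th power, without the root, which suits
  \<open>powr_add_le\<close> and dominated convergence.\<close>

definition Lp_closure :: "real \<Rightarrow> (real ^ 'd \<Rightarrow> real) set" where
  "Lp_closure p = {f. f \<in> borel_measurable borel \<and> integrable lborel (\<lambda>x. \<bar>f x\<bar> powr p) \<and>
     (\<forall>\<epsilon>>0. \<exists>g\<in>hermite_span. (LINT x|lborel. \<bar>f x - g x\<bar> powr p) < \<epsilon>)}"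

lemma Lp_closureD:
  assumes "f \<in> Lp_closure p"
  shows "f \<in> borel_measurable borel" "integrable lborel (\<lambda>x. \<bar>f x\<bar> powr p)"
    "\<epsilon> > 0 \<Longrightarrow> \<exists>g\<in>hermite_span. (LINT x|lborel. \<bar>f x - g x\<bar> powr p) < \<epsilon>"
  using assms by (auto simp: Lp_closure_def)

lemma hermite_span_subset_Lp_closure:
  assumes p: "p \<ge> 1" and f: "f \<in> hermite_span"
  shows "f \<in> Lp_closure p"
  unfolding Lp_closure_def using p f
  by (auto simp: borel_measurable_hermite_span hermite_span_integrable_powr intro!: bexI[of _ f])

lemma Lp_closure_limit:
  assumes p: "p \<ge> 1" and f: "f \<in> borel_measurable borel" "integrable lborel (\<lambda>x. \<bar>f x\<bar> powr p)"
    and lim: "\<And>\<epsilon>. \<epsilon> > 0 \<Longrightarrow> \<exists>h\<in>Lp_closure p. (LINT x|lborel. \<bar>f x - h x\<bar> powr p) < \<epsilon>"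
  shows "f \<in> Lp_closure p"
  unfolding Lp_closure_def
proof (intro CollectI conjI f allI impI)
  fix \<epsilon> :: real assume "\<epsilon> > 0"
  \<comment> \<open>Half of \<epsilon> for each of the two errors, divided by the 2^p of
    \<open>powr_add_le\<close>.\<close>
  then have \<epsilon>': "\<epsilon> / (2 * 2 powr p) > 0" by simp
  obtain h where h: "h \<in> Lp_closure p" "(LINT x|lborel. \<bar>f x - h x\<bar> powr p) < \<epsilon> / (2 * 2 powr p)"
    using lim[OF \<epsilon>'] by blast
  note h' = Lp_closureD[OF h(1)]
  obtain g where g: "g \<in> hermite_span" "(LINT x|lborel. \<bar>h x - g x\<bar> powr p) < \<epsilon> / (2 * 2 powr p)"
    using h'(3)[OF \<epsilon>'] by blast
  have gi: "integrable lborel (\<lambda>x. \<bar>- 1 * g x\<bar> powr p)" and hi: "integrable lborel (\<lambda>x. \<bar>- 1 * h x\<bar> powr p)"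
    using hermite_span_integrable_powr[OF p g(1)] h'(2) by simp_all
  have m: "(\<lambda>x. f x - h x) \<in> borel_measurable borel" "(\<lambda>x. h x - g x) \<in> borel_measurable borel"
    using f h'(1) borel_measurable_hermite_span[OF g(1)] by auto
  have "integrable lborel (\<lambda>x. \<bar>f x + - 1 * h x\<bar> powr p)"
    using f h'(1) by (intro integrable_powr_add(1)[OF p _ _ f(2) hi]) auto
  moreover have "integrable lborel (\<lambda>x. \<bar>h x + - 1 * g x\<bar> powr p)"
    using h'(1) borel_measurable_hermite_span[OF g(1)] by (intro integrable_powr_add(1)[OF p _ _ h'(2) gi]) auto
  ultimately have "(LINT x|lborel. \<bar>(f x - h x) + (h x - g x)\<bar> powr p) \<le>
      2 powr p * ((LINT x|lborel. \<bar>f x - h x\<bar> powr p) + (LINT x|lborel. \<bar>h x - g x\<bar> powr p))"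
    using m by (intro integrable_powr_add(2)[OF p]) auto
  also have "\<dots> < 2 powr p * (\<epsilon> / (2 * 2 powr p) + \<epsilon> / (2 * 2 powr p))"
    using h g by (intro mult_strict_left_mono add_strict_mono) auto
  also have "\<dots> = \<epsilon>" by simp
  finally have "(LINT x|lborel. \<bar>f x - g x\<bar> powr p) < \<epsilon>" by simp
  then show "\<exists>g\<in>hermite_span. (LINT x|lborel. \<bar>f x - g x\<bar> powr p) < \<epsilon>"
    using g by blast
qed

text \<open>The gateway for the later approximations (Taylor series, Weierstrass, ramps, unions,
  simple functions): each converges pointwise under an L^p majorant.\<close>

lemma Lp_closure_dominated:
  fixes f w :: "real ^ 'd \<Rightarrow> real"
  assumes p: "p \<ge> 1" and h: "\<And>k :: nat. h k \<in> Lp_closure p"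
    and lim: "\<And>x. (\<lambda>k. h k x) \<longlonglongrightarrow> f x"
    and w: "integrable lborel (\<lambda>x. \<bar>w x\<bar> powr p)" "\<And>k x. \<bar>h k x\<bar> \<le> \<bar>w x\<bar>"
  shows "f \<in> Lp_closure p"
proof (rule Lp_closure_limit[OF p])
  have hm [measurable]: "h k \<in> borel_measurable borel" for k using Lp_closureD(1)[OF h] .
  show fm [measurable]: "f \<in> borel_measurable borel"
    by (rule borel_measurable_LIMSEQ_real[OF lim]) measurable
  have fw: "\<bar>f x\<bar> \<le> \<bar>w x\<bar>" for x
    by (rule tendsto_upperbound[OF tendsto_rabs[OF lim]]) (auto simp: w)
  show "integrable lborel (\<lambda>x. \<bar>f x\<bar> powr p)"
    by (rule integrable_powr_bound[OF p w(1)]) (auto simp: fw)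
  have "(\<lambda>k. LINT x|lborel. \<bar>f x - h k x\<bar> powr p) \<longlonglongrightarrow> (LINT x|(lborel :: (real ^ 'd) measure). 0)"
  proof (rule integral_dominated_convergence)
    show "integrable lborel (\<lambda>x. \<bar>2 * w x\<bar> powr p)" by (rule integrable_powr_cmult[OF w(1)])
    show "AE x in lborel. (\<lambda>k. \<bar>f x - h k x\<bar> powr p) \<longlonglongrightarrow> 0"
    proof (rule AE_I2)
      fix x
      have "(\<lambda>k. \<bar>f x - h k x\<bar>) \<longlonglongrightarrow> 0"
        using tendsto_rabs[OF tendsto_diff[OF tendsto_const lim], of "f x" x] by simp
      then show "(\<lambda>k. \<bar>f x - h k x\<bar> powr p) \<longlonglongrightarrow> 0"
        using p by (intro tendsto_zero_powrI[OF _ tendsto_const]) auto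
    qed
    show "AE x in lborel. norm (\<bar>f x - h k x\<bar> powr p) \<le> \<bar>2 * w x\<bar> powr p" for k
    proof (rule AE_I2)
      fix x
      have "\<bar>f x - h k x\<bar> \<le> \<bar>2 * w x\<bar>"
        using fw[of x] w(2)[of k x] by (simp add: abs_mult)
      then show "norm (\<bar>f x - h k x\<bar> powr p) \<le> \<bar>2 * w x\<bar> powr p"
        using p by (simp add: powr_mono2)
    qed
  qed measurable
  then have lim0: "(\<lambda>k. LINT x|lborel. \<bar>f x - h k x\<bar> powr p) \<longlonglongrightarrow> 0" by simp
  fix \<epsilon> :: real assume "\<epsilon> > 0"
  from order_tendstoD(2)[OF lim0 this] obtain k where "(LINT x|lborel. \<bar>f x - h k x\<bar> powr p) < \<epsilon>"
    by (auto simp: eventually_sequentially)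
  then show "\<exists>h\<in>Lp_closure p. (LINT x|lborel. \<bar>f x - h x\<bar> powr p) < \<epsilon>" using h by blast
qed


lemma Lp_closure_cmult:
  assumes p: "p \<ge> 1" and f: "f \<in> Lp_closure p"
  shows "(\<lambda>x. c * f x) \<in> Lp_closure p"
proof (rule Lp_closure_limit[OF p])
  note f' = Lp_closureD[OF f]
  show "(\<lambda>x. c * f x) \<in> borel_measurable borel" using f' by auto
  show "integrable lborel (\<lambda>x. \<bar>c * f x\<bar> powr p)" by (rule integrable_powr_cmult[OF f'(2)])
  fix \<epsilon> :: real assume \<epsilon>: "\<epsilon> > 0"
  define K where "K = \<bar>c\<bar> powr p + 1"
  have K: "K > 0" by (simp add: K_def add_nonneg_pos)
  obtain g where g: "g \<in> hermite_span" "(LINT x|lborel. \<bar>f x - g x\<bar> powr p) < \<epsilon> / K"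
    using f'(3)[of "\<epsilon> / K"] \<epsilon> K by auto
  have "(LINT x|lborel. \<bar>c * f x - c * g x\<bar> powr p) = \<bar>c\<bar> powr p * (LINT x|lborel. \<bar>f x - g x\<bar> powr p)"
    by (simp add: abs_mult powr_mult flip: right_diff_distrib)
  also have "\<dots> \<le> K * (LINT x|lborel. \<bar>f x - g x\<bar> powr p)"
    by (intro mult_right_mono) (auto simp: K_def intro!: integral_nonneg_AE)
  also have "\<dots> < K * (\<epsilon> / K)" using g K by (intro mult_strict_left_mono) auto
  finally have "(LINT x|lborel. \<bar>c * f x - c * g x\<bar> powr p) < \<epsilon>" using K by simp
  then show "\<exists>h\<in>Lp_closure p. (LINT x|lborel. \<bar>c * f x - h x\<bar> powr p) < \<epsilon>"
    using g by (intro bexI[of _ "\<lambda>x. c * g x"] hermite_span_subset_Lp_closure p hermite_span_cmult) auto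
qed

lemma Lp_closure_add:
  assumes p: "p \<ge> 1" and f: "f \<in> Lp_closure p" and g: "g \<in> Lp_closure p"
  shows "(\<lambda>x. f x + g x) \<in> Lp_closure p"
proof (rule Lp_closure_limit[OF p])
  note f' = Lp_closureD[OF f] and g' = Lp_closureD[OF g]
  show "(\<lambda>x. f x + g x) \<in> borel_measurable borel" using f' g' by auto
  show "integrable lborel (\<lambda>x. \<bar>f x + g x\<bar> powr p)"
    using f' g' by (intro integrable_powr_add(1)[OF p]) auto
  fix \<epsilon> :: real assume "\<epsilon> > 0"
  then have \<epsilon>': "\<epsilon> / (2 * 2 powr p) > 0" by simp
  obtain a where a: "a \<in> hermite_span" "(LINT x|lborel. \<bar>f x - a x\<bar> powr p) < \<epsilon> / (2 * 2 powr p)"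
    using f'(3)[OF \<epsilon>'] by blast
  obtain b where b: "b \<in> hermite_span" "(LINT x|lborel. \<bar>g x - b x\<bar> powr p) < \<epsilon> / (2 * 2 powr p)"
    using g'(3)[OF \<epsilon>'] by blast
  note am = borel_measurable_hermite_span[OF a(1)] and bm = borel_measurable_hermite_span[OF b(1)]
  have "integrable lborel (\<lambda>x. \<bar>f x + - 1 * a x\<bar> powr p)" "integrable lborel (\<lambda>x. \<bar>g x + - 1 * b x\<bar> powr p)"
    using f' g' am bm hermite_span_integrable_powr[OF p a(1)] hermite_span_integrable_powr[OF p b(1)]
    by (intro integrable_powr_add(1)[OF p]; simp)+
  then have "(LINT x|lborel. \<bar>(f x - a x) + (g x - b x)\<bar> powr p) \<le>
      2 powr p * ((LINT x|lborel. \<bar>f x - a x\<bar> powr p) + (LINT x|lborel. \<bar>g x - b x\<bar> powr p))"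
    using f' g' am bm by (intro integrable_powr_add(2)[OF p]) auto
  also have "\<dots> < 2 powr p * (\<epsilon> / (2 * 2 powr p) + \<epsilon> / (2 * 2 powr p))"
    using a b by (intro mult_strict_left_mono add_strict_mono) auto
  also have "\<dots> = \<epsilon>" by simp
  finally have "(LINT x|lborel. \<bar>f x + g x - (a x + b x)\<bar> powr p) < \<epsilon>" by (simp add: algebra_simps)
  then show "\<exists>h\<in>Lp_closure p. (LINT x|lborel. \<bar>f x + g x - h x\<bar> powr p) < \<epsilon>"
    using a b by (intro bexI[of _ "\<lambda>x. a x + b x"] hermite_span_subset_Lp_closure p hermite_span_add) auto
qed

section \<open>Bounded multipliers of the closure\<close>

definition Lp_multiplier :: "real \<Rightarrow> (real ^ 'd \<Rightarrow> real) set" where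
  "Lp_multiplier p = {\<phi>. \<phi> \<in> borel_measurable borel \<and> (\<exists>B. \<forall>x. \<bar>\<phi> x\<bar> \<le> B) \<and>
     (\<forall>f\<in>Lp_closure p. (\<lambda>x. \<phi> x * f x) \<in> Lp_closure p)}"

lemma Lp_multiplier_const: "p \<ge> 1 \<Longrightarrow> (\<lambda>x. c) \<in> Lp_multiplier p"
  by (auto simp: Lp_multiplier_def Lp_closure_cmult)

lemma Lp_multiplier_add:
  assumes "p \<ge> 1" "\<phi> \<in> Lp_multiplier p" "\<psi> \<in> Lp_multiplier p"
  shows "(\<lambda>x. \<phi> x + \<psi> x) \<in> Lp_multiplier p"
proof -
  obtain A B where "\<And>x. \<bar>\<phi> x\<bar> \<le> A" "\<And>x. \<bar>\<psi> x\<bar> \<le> B"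
    using assms by (auto simp: Lp_multiplier_def)
  then have "\<bar>\<phi> x + \<psi> x\<bar> \<le> A + B" for x
    by (meson abs_triangle_ineq add_mono order_trans)
  then show ?thesis
    using assms by (auto simp: Lp_multiplier_def distrib_right intro!: Lp_closure_add)
qed

lemma Lp_multiplier_mult:
  assumes "\<phi> \<in> Lp_multiplier p" "\<psi> \<in> Lp_multiplier p"
  shows "(\<lambda>x. \<phi> x * \<psi> x) \<in> Lp_multiplier p"
proof -
  obtain A B where "\<And>x. \<bar>\<phi> x\<bar> \<le> A" "\<And>x. \<bar>\<psi> x\<bar> \<le> B"
    using assms by (auto simp: Lp_multiplier_def)
  then have "\<bar>\<phi> x * \<psi> x\<bar> \<le> A * B" for x
    unfolding abs_mult by (meson abs_ge_zero mult_mono order_trans)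
  then show ?thesis
    using assms by (auto simp: Lp_multiplier_def mult.assoc)
qed

lemma Lp_multiplier_limit:
  assumes p: "p \<ge> 1" and \<phi>: "\<And>k :: nat. \<phi> k \<in> Lp_multiplier p"
    and lim: "\<And>x. (\<lambda>k. \<phi> k x) \<longlonglongrightarrow> \<psi> x" and B: "\<And>k x. \<bar>\<phi> k x\<bar> \<le> B"
  shows "\<psi> \<in> Lp_multiplier p"
proof -
  have [measurable]: "\<phi> k \<in> borel_measurable borel" for k
    using \<phi> by (auto simp: Lp_multiplier_def)
  have m: "\<psi> \<in> borel_measurable borel"
    by (rule borel_measurable_LIMSEQ_real[OF lim]) measurable
  have \<psi>B: "\<bar>\<psi> x\<bar> \<le> B" for x
    by (rule tendsto_upperbound[OF tendsto_rabs[OF lim]]) (auto simp: B)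
  have "B \<ge> 0" using B[of 0 0] by linarith
  have "(\<lambda>x. \<psi> x * f x) \<in> Lp_closure p" if f: "f \<in> Lp_closure p" for f
  proof (rule Lp_closure_dominated[OF p])
    show "(\<lambda>x. \<phi> k x * f x) \<in> Lp_closure p" for k using \<phi> f by (auto simp: Lp_multiplier_def)
    show "(\<lambda>k. \<phi> k x * f x) \<longlonglongrightarrow> \<psi> x * f x" for x by (intro tendsto_intros lim)
    show "integrable lborel (\<lambda>x. \<bar>B * f x\<bar> powr p)"
      by (rule integrable_powr_cmult[OF Lp_closureD(2)[OF f]])
    show "\<bar>\<phi> k x * f x\<bar> \<le> \<bar>B * f x\<bar>" for k x
      using B[of k x] by (simp add: abs_mult mult_right_mono)
  qed
  then show ?thesis using m \<psi>B by (auto simp: Lp_multiplier_def)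
qed


lemma sum_power_fact_le_exp: "y \<ge> 0 \<Longrightarrow> (\<Sum>k<n. y ^ k / fact k) \<le> exp (y :: real)"
  using sum_le_suminf[OF summable_exp[of y], of "{..<n}"]
  by (simp add: exp_def divide_inverse mult.commute)

text \<open>The Taylor polynomials of the sine, times a Hermite function, converge dominatedly.\<close>

lemma sin_times_hermite_span:
  fixes g :: "real ^ 'd \<Rightarrow> real"
  assumes p: "p \<ge> 1" and g: "g \<in> hermite_span"
  shows "(\<lambda>x. sin (c * x $ i) * g x) \<in> Lp_closure p"
proof -
  obtain C where C: "C \<ge> 0" "\<And>x. \<bar>g x\<bar> \<le> C * exp (- (norm x)\<^sup>2 / 4)"
    using hermite_span_gauss_bound[OF g] by blast
  define T where "T n x = (\<Sum>k<n. sin_coeff k * (c * x $ i) ^ k) * g x" for n and x :: "real ^ 'd"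
  show ?thesis
  proof (rule Lp_closure_dominated[OF p])
    fix n
    have "T n = (\<lambda>x. \<Sum>k<n. (sin_coeff k * c ^ k) * ((x $ i) ^ k * g x))"
      unfolding T_def sum_distrib_right power_mult_distrib by (simp only: mult.assoc)
    then show "T n \<in> Lp_closure p"
      using p g by (simp add: hermite_span_subset_Lp_closure hermite_span_sum hermite_span_cmult hermite_span_times_coord_power)
  next
    fix x :: "real ^ 'd"
    have "(\<lambda>n. \<Sum>k<n. sin_coeff k * (c * x $ i) ^ k) \<longlonglongrightarrow> sin (c * x $ i)"
      using sin_converges[of "c * x $ i"] by (simp add: sums_def)
    then show "(\<lambda>n. T n x) \<longlonglongrightarrow> sin (c * x $ i) * g x"
      unfolding T_def by (intro tendsto_intros)
  next
    show "integrable lborel (\<lambda>x :: real ^ 'd. \<bar>C * exp (2 * c\<^sup>2) * exp (- (1 / 8) * (norm x)\<^sup>2)\<bar> powr p)"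
      using p by (rule integrable_powr_gauss) simp
    fix n and x :: "real ^ 'd"
    have "\<bar>\<Sum>k<n. sin_coeff k * (c * x $ i) ^ k\<bar> \<le> (\<Sum>k<n. (\<bar>c\<bar> * norm x) ^ k / fact k)"
    proof (rule order_trans[OF sum_abs sum_mono])
      fix k
      have "\<bar>sin_coeff k\<bar> \<le> 1 / fact k"
        by (auto simp: sin_coeff_def abs_mult power_abs)
      moreover have "\<bar>c * x $ i\<bar> ^ k \<le> (\<bar>c\<bar> * norm x) ^ k"
        unfolding abs_mult by (intro power_mono mult_left_mono component_le_norm_cart) auto
      ultimately have "\<bar>sin_coeff k\<bar> * \<bar>c * x $ i\<bar> ^ k \<le> 1 / fact k * (\<bar>c\<bar> * norm x) ^ k"
        by (intro mult_mono) auto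
      then show "\<bar>sin_coeff k * (c * x $ i) ^ k\<bar> \<le> (\<bar>c\<bar> * norm x) ^ k / fact k"
        by (simp add: abs_mult power_abs)
    qed
    also have "\<dots> \<le> exp (\<bar>c\<bar> * norm x)" by (rule sum_power_fact_le_exp) simp
    finally have "\<bar>T n x\<bar> \<le> exp (\<bar>c\<bar> * norm x) * (C * exp (- (norm x)\<^sup>2 / 4))"
      unfolding T_def abs_mult by (intro mult_mono C) auto
    also have "\<dots> = C * exp (\<bar>c\<bar> * norm x - (norm x)\<^sup>2 / 4)"
      by (simp add: mult.left_commute[of _ C] flip: exp_add)
    also have "\<dots> \<le> C * exp (2 * c\<^sup>2 + - (1 / 8) * (norm x)\<^sup>2)"
    proof (intro mult_left_mono C)
      \<comment> \<open>Divided by 8 this reads |c| |x| \<le> 2 c^2 + |x|^2 / 8: half of the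
        Gaussian absorbs the exponential growth of the Taylor polynomials.\<close>
      have "0 \<le> (norm x - 4 * \<bar>c\<bar>)\<^sup>2" by simp
      then show "exp (\<bar>c\<bar> * norm x - (norm x)\<^sup>2 / 4) \<le> exp (2 * c\<^sup>2 + - (1 / 8) * (norm x)\<^sup>2)"
        by (simp add: power2_eq_square algebra_simps flip: abs_mult)
    qed
    also have "\<dots> = C * exp (2 * c\<^sup>2) * exp (- (1 / 8) * (norm x)\<^sup>2)" by (simp only: exp_add mult.assoc)
    finally show "\<bar>T n x\<bar> \<le> \<bar>C * exp (2 * c\<^sup>2) * exp (- (1 / 8) * (norm x)\<^sup>2)\<bar>" by simp
  qed
qed

text \<open>The bound |sin| \<le> 1 makes multiplication a contraction, so
  \<open>sin_times_hermite_span\<close> passes from the span to its closure.\<close>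

lemma Lp_multiplier_sin:
  fixes c :: real
  assumes p: "p \<ge> 1"
  shows "(\<lambda>x :: real ^ 'd. sin (c * x $ i)) \<in> Lp_multiplier p"
proof -
  have "(\<lambda>x. sin (c * x $ i) * f x) \<in> Lp_closure p" if f: "f \<in> Lp_closure p" for f :: "real ^ 'd \<Rightarrow> real"
  proof (rule Lp_closure_limit[OF p])
    note f' = Lp_closureD[OF f]
    show "(\<lambda>x. sin (c * x $ i) * f x) \<in> borel_measurable borel" using f' by measurable
    then show "integrable lborel (\<lambda>x. \<bar>sin (c * x $ i) * f x\<bar> powr p)"
      by (intro integrable_powr_bound[OF p f'(2)]) (auto simp: abs_mult mult_left_le_one_le)
    fix \<epsilon> :: real assume "\<epsilon> > 0"
    then obtain g where g: "g \<in> hermite_span" "(LINT x|lborel. \<bar>f x - g x\<bar> powr p) < \<epsilon>"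
      using f'(3) by blast
    note gm = borel_measurable_hermite_span[OF g(1)]
    have i1: "integrable lborel (\<lambda>x. \<bar>f x - g x\<bar> powr p)"
      using integrable_powr_add(1)[OF p, of f lborel "\<lambda>x. - g x"] f' gm hermite_span_integrable_powr[OF p g(1)]
      by simp
    have le: "\<bar>sin (c * x $ i) * f x - sin (c * x $ i) * g x\<bar> \<le> \<bar>f x - g x\<bar>" for x
      by (simp add: abs_mult mult_left_le_one_le flip: right_diff_distrib)
    have i2: "integrable lborel (\<lambda>x. \<bar>sin (c * x $ i) * f x - sin (c * x $ i) * g x\<bar> powr p)"
      using f'(1) gm le by (intro integrable_powr_bound[OF p i1]) (measurable, auto)
    have "(LINT x|lborel. \<bar>sin (c * x $ i) * f x - sin (c * x $ i) * g x\<bar> powr p) \<le>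
        (LINT x|lborel. \<bar>f x - g x\<bar> powr p)"
      using le p by (intro integral_mono i1 i2) (auto intro!: powr_mono2)
    then show "\<exists>h\<in>Lp_closure p. (LINT x|lborel. \<bar>sin (c * x $ i) * f x - h x\<bar> powr p) < \<epsilon>"
      using g by (intro bexI[of _ "\<lambda>x. sin (c * x $ i) * g x"] sin_times_hermite_span p) auto
  qed
  moreover have "\<bar>sin (c * x $ i)\<bar> \<le> 1" for x :: "real ^ 'd" by simp
  moreover have "(\<lambda>x :: real ^ 'd. sin (c * x $ i)) \<in> borel_measurable borel" by measurable
  ultimately show ?thesis unfolding Lp_multiplier_def by blast
qed

lemma Lp_multiplier_polynomial:
  assumes "real_polynomial_function q" "p \<ge> 1" "\<phi> \<in> Lp_multiplier p"
  shows "(\<lambda>x. q (\<phi> x :: real)) \<in> Lp_multiplier p"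
  using assms(1)
proof induction
  case (linear f)
  have "f u = f 1 * u" for u
    using linear_simps(5)[OF linear, of u 1] by simp
  then have "(\<lambda>x. f (\<phi> x)) = (\<lambda>x. f 1 * \<phi> x)" by (intro ext)
  then show ?case
    by (simp only: Lp_multiplier_mult[OF Lp_multiplier_const[OF assms(2)] assms(3)])
next
  case (const c)
  show ?case by (rule Lp_multiplier_const[OF assms(2)])
next
  case (add f g)
  show ?case by (rule Lp_multiplier_add[OF assms(2) add.IH])
next
  case (mult f g)
  show ?case by (rule Lp_multiplier_mult[OF mult.IH])
qed

text \<open>Weierstrass approximation on an interval containing the range of \<phi>. Polynomials in
  \<phi> are multipliers, and errors below 1 give them the common bound K + 1.\<close>

lemma Lp_multiplier_continuous:
  assumes p: "p \<ge> 1" and \<phi>: "\<phi> \<in> Lp_multiplier p" and B: "\<And>x. \<bar>\<phi> x\<bar> \<le> B"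
    and g: "continuous_on {- B..B} g"
  shows "(\<lambda>x. g (\<phi> x) :: real) \<in> Lp_multiplier p"
proof -
  have "\<exists>q. real_polynomial_function q \<and> (\<forall>u\<in>{- B..B}. \<bar>g u - q u\<bar> < 1 / Suc k)" for k :: nat
    using Stone_Weierstrass_real_polynomial_function[OF compact_Icc g, of "1 / Suc k"] by (metis zero_less_divide_1_iff of_nat_0_less_iff zero_less_Suc)
  then obtain q where q: "\<And>k :: nat. real_polynomial_function (q k)"
      "\<And>k u. u \<in> {- B..B} \<Longrightarrow> \<bar>g u - q k u\<bar> < 1 / Suc k"
    by metis
  have in_B: "\<phi> x \<in> {- B..B}" for x using B[of x] by auto
  have "compact (g ` {- B..B})" by (rule compact_continuous_image[OF g compact_Icc])
  then obtain K where K: "\<And>u. u \<in> {- B..B} \<Longrightarrow> \<bar>g u\<bar> \<le> K"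
    using compact_imp_bounded bounded_iff by (metis image_eqI real_norm_def)
  show ?thesis
  proof (rule Lp_multiplier_limit[OF p])
    show "(\<lambda>x. q k (\<phi> x)) \<in> Lp_multiplier p" for k
      by (rule Lp_multiplier_polynomial[OF q(1) p \<phi>])
    show "(\<lambda>k. q k (\<phi> x)) \<longlonglongrightarrow> g (\<phi> x)" for x
    proof (rule Lim_transform_eventually)
      have "(\<lambda>k. g (\<phi> x) - q k (\<phi> x)) \<longlonglongrightarrow> 0"
        by (rule Lim_null_comparison[OF _ LIMSEQ_Suc[OF lim_1_over_n]])
          (use q(2)[OF in_B] in \<open>auto intro!: always_eventually less_imp_le\<close>)
      then show "(\<lambda>k. g (\<phi> x) - (g (\<phi> x) - q k (\<phi> x))) \<longlonglongrightarrow> g (\<phi> x)"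
        using tendsto_diff[OF tendsto_const[of "g (\<phi> x)"]] by fastforce
    qed simp
    show "\<bar>q k (\<phi> x)\<bar> \<le> K + 1" for k x
    proof -
      have "1 / real (Suc k) \<le> 1" by simp
      then show ?thesis using q(2)[OF in_B, of x k] K[OF in_B, of x] by linarith
    qed
  qed
qed

lemma Lp_multiplier_coord:
  fixes g :: "real \<Rightarrow> real"
  assumes p: "p \<ge> 1" and g: "continuous_on UNIV g" and K: "\<And>u. \<bar>g u\<bar> \<le> K"
  shows "(\<lambda>x :: real ^ 'd. g (x $ i)) \<in> Lp_multiplier p"
proof (rule Lp_multiplier_limit[OF p])
  \<comment> \<open>For fixed k the range of the sine makes this a case of
    \<open>Lp_multiplier_continuous\<close> with B = 1; the bound K on g serves the limit in k.
    \<open>Suc k\<close> keeps the scale positive.\<close>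
  show "(\<lambda>x :: real ^ 'd. g (Suc k * sin (inverse (Suc k) * x $ i))) \<in> Lp_multiplier p" for k
    by (rule Lp_multiplier_continuous[OF p Lp_multiplier_sin[OF p], where B = 1])
      (auto intro!: continuous_on_compose2[OF g] continuous_intros)
  show "(\<lambda>k. g (Suc k * sin (inverse (Suc k) * x $ i))) \<longlonglongrightarrow> g (x $ i)" for x :: "real ^ 'd"
  proof -
    have "(\<lambda>k. real (Suc k) * sin (inverse (Suc k) * x $ i)) \<longlonglongrightarrow> x $ i"
      by real_asymp
    then show ?thesis
      using g by (intro isCont_tendsto_compose[of _ g]) (auto simp: continuous_on_eq_continuous_at)
  qed
qed (rule K)

text \<open>Continuous ramps of slope k vanish up to a and rise to 1 beyond it, so they converge to
  the indicator of the open half-space.\<close>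

lemma Lp_multiplier_halfspace:
  assumes p: "p \<ge> 1"
  shows "indicator {x :: real ^ 'd. a < x $ i} \<in> Lp_multiplier p"
proof (rule Lp_multiplier_limit[OF p])
  show "(\<lambda>x :: real ^ 'd. max 0 (min 1 (real k * (x $ i - a)))) \<in> Lp_multiplier p" for k
    by (rule Lp_multiplier_coord[OF p, where K = 1 and g = "\<lambda>u. max 0 (min 1 (real k * (u - a)))"])
      (auto intro!: continuous_intros)
  show "(\<lambda>k. max 0 (min 1 (real k * (x $ i - a)))) \<longlonglongrightarrow> indicator {x. a < x $ i} x" for x :: "real ^ 'd"
  proof (cases "a < x $ i")
    case True
    obtain N :: nat where N: "1 / (x $ i - a) \<le> real N" using real_arch_simple by blast
    have "max 0 (min 1 (real k * (x $ i - a))) = 1" if "k \<ge> N" for k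
    proof -
      have "1 / (x $ i - a) \<le> real k" using N that by linarith
      then have "1 \<le> real k * (x $ i - a)" using True by (simp add: divide_le_eq)
      then show ?thesis by simp
    qed
    then have "eventually (\<lambda>k. 1 = max 0 (min 1 (real k * (x $ i - a)))) sequentially"
      by (auto simp: eventually_sequentially intro!: exI[of _ N])
    from Lim_transform_eventually[OF tendsto_const this] show ?thesis using True by simp
  next
    case False
    then have "real k * (x $ i - a) \<le> 0" for k
      by (intro mult_nonneg_nonpos) auto
    moreover have "max 0 (min 1 r) = 0" if "r \<le> 0" for r :: real
      using that by simp
    ultimately have "max 0 (min 1 (real k * (x $ i - a))) = 0" for k
      by blast
    then show ?thesis using False by simp
  qed
  show "\<bar>max 0 (min 1 (real k * (x $ i - a)))\<bar> \<le> 1" for k and x :: "real ^ 'd" by simp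
qed

text \<open>Multipliers are closed under products, so the induction runs directly over the
  sigma-algebra generated by half-spaces, with no disjointness: 1 minus the product of the
  complements is the indicator of a finite union, and bounded limits give the countable
  ones.\<close>

lemma Lp_multiplier_indicator:
  fixes A :: "(real ^ 'd) set"
  assumes p: "p \<ge> 1" and A: "A \<in> sets borel"
  shows "indicator A \<in> Lp_multiplier p"
proof -
  have compl: "(\<lambda>x. 1 - \<phi> x) \<in> Lp_multiplier p" if "\<phi> \<in> Lp_multiplier p" for \<phi> :: "real ^ 'd \<Rightarrow> real"
    using Lp_multiplier_add[OF p Lp_multiplier_const[OF p, of 1]
        Lp_multiplier_mult[OF Lp_multiplier_const[OF p, of "- 1"] that]] by simp
  have "A \<in> sigma_sets UNIV ((\<lambda>(a, b). {x. a < x \<bullet> b}) ` (UNIV \<times> (Basis :: (real ^ 'd) set)))"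
    using A unfolding borel_eq_halfspace_greater by (simp add: sets_measure_of)
  then show ?thesis
  proof induction
    case (Basic a)
    then obtain c i where "a = {x. c < x \<bullet> axis i 1}"
      by (auto simp: Basis_real_vec)
    then show ?case using Lp_multiplier_halfspace[OF p, of c i] by (simp add: inner_axis)
  next
    case Empty
    have "indicator {} = (\<lambda>x :: real ^ 'd. 0 :: real)" by auto
    then show ?case using Lp_multiplier_const[OF p, of 0] by simp
  next
    case (Compl a)
    have "indicator (UNIV - a) = (\<lambda>x. 1 - indicator a x :: real)" by (auto simp: indicator_def)
    then show ?case using compl[OF Compl.IH] by simp
  next
    case (Union a)
    have prod: "(\<lambda>x. \<Prod>j<k. 1 - indicator (a j) x) \<in> Lp_multiplier p" for k :: nat
    proof (induction k)
      case (Suc k)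
      then show ?case using Lp_multiplier_mult[OF Suc compl[OF Union.IH[of k]]] by simp
    qed (simp add: Lp_multiplier_const[OF p])
    have eq: "(1 - (\<Prod>j<k. 1 - indicator (a j) x) :: real) = indicator (\<Union>j<k. a j) x" for k x
      by (auto simp: indicator_def prod_zero_iff)
    show ?case
    proof (rule Lp_multiplier_limit[OF p])
      show "(\<lambda>x. 1 - (\<Prod>j<k. 1 - indicator (a j) x)) \<in> Lp_multiplier p" for k :: nat
        by (rule compl[OF prod])
      show "(\<lambda>k. 1 - (\<Prod>j<k. 1 - indicator (a j) x)) \<longlonglongrightarrow> (indicator (\<Union> (range a)) x :: real)" for x
        unfolding eq by (rule LIMSEQ_indicator_UN)
      show "\<bar>1 - (\<Prod>j<k. 1 - indicator (a j) x)\<bar> \<le> (1 :: real)" for k :: nat and x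
        unfolding eq by (simp add: indicator_def)
    qed
  qed
qed

text \<open>Here u may be unbounded, so the product is assumed to be p-integrable, and the induction
  over measurable functions recovers this for the pieces by comparison with the whole.\<close>

lemma Lp_closure_times_nonneg:
  fixes u :: "real ^ 'd \<Rightarrow> real"
  assumes p: "p \<ge> 1" and u: "u \<in> borel_measurable borel" "\<And>x. u x \<ge> 0"
    and f: "f \<in> Lp_closure p" and uf: "integrable lborel (\<lambda>x. \<bar>u x * f x\<bar> powr p)"
  shows "(\<lambda>x. u x * f x) \<in> Lp_closure p"
  using u uf
proof (induction rule: borel_measurable_induct_real)
  note fm [measurable] = Lp_closureD(1)[OF f]
  {
    case (set A)
    then show ?case using Lp_multiplier_indicator[OF p, of A] f by (auto simp: Lp_multiplier_def)
  next
    case (mult u c)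
    show ?case
    \<comment> \<open>For c = 0 the assumption only says that 0 is integrable, which does not give
      access to the induction hypothesis for u.\<close>
    proof (cases "c = 0")
      case True
      then show ?thesis using Lp_closure_cmult[OF p f, of 0] by simp
    next
      case False
      have "integrable lborel (\<lambda>x. \<bar>inverse c * (c * u x * f x)\<bar> powr p)"
        by (rule integrable_powr_cmult[OF mult.prems])
      then have "(\<lambda>x. u x * f x) \<in> Lp_closure p"
        using False by (intro mult.IH) (simp flip: mult.assoc)
      from Lp_closure_cmult[OF p this, of c] show ?thesis by (simp add: mult.assoc)
    qed
  next
    case (add u v)
    have "integrable lborel (\<lambda>x. \<bar>u x * f x\<bar> powr p)" "integrable lborel (\<lambda>x. \<bar>v x * f x\<bar> powr p)"
      using add.hyps by (intro integrable_powr_bound[OF p add.prems]; simp add: abs_mult mult_right_mono)+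
    then show ?case
      using Lp_closure_add[OF p add.IH(2) add.IH(1)] by (simp add: distrib_right)
  next
    case (seq U)
    have le: "U k x \<le> u x" for k x
    proof -
      have "incseq (\<lambda>i. U i x)" using seq.hyps by (auto simp: incseq_def le_fun_def)
      from incseq_le[OF this] show ?thesis using seq.hyps by auto
    qed
    have le': "\<bar>U k x * f x\<bar> \<le> \<bar>u x * f x\<bar>" for k x
      using le[of k x] seq.hyps(2)[of k x] by (simp add: abs_mult mult_right_mono)
    show ?case
    proof (rule Lp_closure_dominated[OF p _ _ seq.prems le'])
      show "(\<lambda>x. U k x * f x) \<in> Lp_closure p" for k
        using seq.hyps le' by (intro seq.IH integrable_powr_bound[OF p seq.prems]) auto
      show "(\<lambda>k. U k x * f x) \<longlonglongrightarrow> u x * f x" for x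
        using seq.hyps by (intro tendsto_intros) auto
    qed
  }
qed

lemma hermite_span_dense:
  fixes f :: "real ^ 'd \<Rightarrow> real"
  assumes p: "p \<ge> 1" and f: "f \<in> borel_measurable borel" "integrable lborel (\<lambda>x. \<bar>f x\<bar> powr p)"
  shows "f \<in> Lp_closure p"
proof -
  note f(1) [measurable]
  \<comment> \<open>The Gaussian is positive everywhere, so f can be written as (f / h) h with a
    measurable, possibly unbounded factor.\<close>
  define h :: "real ^ 'd \<Rightarrow> real" where "h = hermite_fun 0"
  have h: "h \<in> Lp_closure p"
    unfolding h_def by (intro hermite_span_subset_Lp_closure p hermite_fun_in_span)
  have [measurable]: "h \<in> borel_measurable borel" unfolding h_def by measurable
  have hpos: "h x > 0" for x
    unfolding h_def hermite_fun_def hermite_fun1_eq by (intro prod_pos) (auto simp: hnorm_pos)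
  \<comment> \<open>The signs s = 1 and s = -1 give the positive and the negative part, since
    \<open>Lp_closure_times_nonneg\<close> takes a nonnegative factor.\<close>
  have part: "(\<lambda>x. max 0 (s * f x)) \<in> Lp_closure p" if s: "\<bar>s\<bar> = 1" for s
  proof -
    have "(\<lambda>x. (max 0 (s * f x) / h x) * h x) \<in> Lp_closure p"
    proof (rule Lp_closure_times_nonneg[OF p _ _ h])
      have "integrable lborel (\<lambda>x. \<bar>max 0 (s * f x)\<bar> powr p)"
        by (rule integrable_powr_bound[OF p f(2)]) (use s in \<open>auto simp: abs_if max_def split: if_splits\<close>)
      then show "integrable lborel (\<lambda>x. \<bar>max 0 (s * f x) / h x * h x\<bar> powr p)"
        using hpos by (simp add: less_imp_neq[THEN not_sym])
    qed (use hpos in \<open>auto simp: less_imp_le\<close>)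
    then show ?thesis using hpos by (simp add: less_imp_neq[THEN not_sym])
  qed
  have "f x = max 0 (1 * f x) + - 1 * max 0 (- 1 * f x)" for x by simp
  moreover have "(\<lambda>x. max 0 (1 * f x) + - 1 * max 0 (- 1 * f x)) \<in> Lp_closure p"
    by (intro Lp_closure_add[OF p] Lp_closure_cmult[OF p] part) simp_all
  ultimately show ?thesis by presburger
qed

section \<open>The bounded extension\<close>

text \<open>Elements of \<open>Lp_space\<close> are Lebesgue measurable, while the Fubini arguments
  are about Borel functions. Which representative is chosen does not affect the operator, by
  \<open>S_int_cong_AE\<close>.\<close>

definition borel_rep :: "(real ^ 'd \<Rightarrow> real) \<Rightarrow> real ^ 'd \<Rightarrow> real" where
  "borel_rep f = (SOME g. g \<in> borel_measurable borel \<and> (AE x in lborel. f x = g x))"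

lemma borel_rep:
  assumes "f \<in> borel_measurable lebesgue"
  shows "borel_rep f \<in> borel_measurable borel" "AE x in lborel. f x = borel_rep f x"
proof -
  have "\<exists>g. g \<in> borel_measurable borel \<and> (AE x in lborel. f x = g x)"
    using completion_ex_borel_measurable_real[OF assms] by auto
  from someI_ex[OF this] show "borel_rep f \<in> borel_measurable borel" "AE x in lborel. f x = borel_rep f x"
    by (auto simp: borel_rep_def)
qed

lemma Lp_space_borel_iff:
  assumes "f \<in> borel_measurable borel"
  shows "f \<in> Lp_space p \<longleftrightarrow> integrable lborel (\<lambda>x. \<bar>f x\<bar> powr p)"
proof -
  have "f \<in> borel_measurable lebesgue" using assms by (intro measurable_completion) simp
  then show ?thesis using assms by (simp add: Lp_space_def integrable_completion)
qed

lemma Lp_norm_borel: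
  assumes [measurable]: "f \<in> borel_measurable borel"
  shows "Lp_norm p f = (LINT x|lborel. \<bar>f x\<bar> powr p) powr (1 / p)"
  unfolding Lp_norm_def by (subst integral_completion) auto

lemma Lp_norm_cong_AE:
  assumes "f \<in> borel_measurable lebesgue" "g \<in> borel_measurable lebesgue" "Lp_eq f g"
  shows "Lp_norm p f = Lp_norm p g"
proof -
  note assms(1,2) [measurable]
  have "(LINT x|lebesgue. \<bar>f x\<bar> powr p) = (LINT x|lebesgue. \<bar>g x\<bar> powr p)"
  proof (rule integral_cong_AE)
    show "AE x in lebesgue. \<bar>f x\<bar> powr p = \<bar>g x\<bar> powr p"
      using assms(3) unfolding Lp_eq_def by eventually_elim simp
  qed measurable
  then show ?thesis by (simp add: Lp_norm_def)
qed

lemma Lp_space_rep: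
  assumes f: "f \<in> Lp_space p"
  shows "borel_rep f \<in> borel_measurable borel" "AE x in lborel. f x = borel_rep f x"
    "integrable lborel (\<lambda>x. \<bar>borel_rep f x\<bar> powr p)" "borel_rep f \<in> Lp_space p"
    "Lp_eq f (borel_rep f)" "Lp_norm p (borel_rep f) = Lp_norm p f"
proof -
  have fm [measurable]: "f \<in> borel_measurable lebesgue" and fi: "integrable lebesgue (\<lambda>x. \<bar>f x\<bar> powr p)"
    using f by (auto simp: Lp_space_def)
  show rm [measurable]: "borel_rep f \<in> borel_measurable borel" and ae: "AE x in lborel. f x = borel_rep f x"
    using borel_rep[OF fm] by auto
  have rm' [measurable]: "borel_rep f \<in> borel_measurable lebesgue"
    using measurable_completion[of "borel_rep f" lborel borel] rm by simp
  show eq: "Lp_eq f (borel_rep f)" using ae by (simp add: Lp_eq_def AE_completion)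
  have "integrable lebesgue (\<lambda>x. \<bar>borel_rep f x\<bar> powr p)"
    using fi
  proof (rule integrable_cong_AE_imp)
    show "AE x in lebesgue. \<bar>f x\<bar> powr p = \<bar>borel_rep f x\<bar> powr p"
      using eq unfolding Lp_eq_def by eventually_elim simp
  qed measurable
  then show "integrable lborel (\<lambda>x. \<bar>borel_rep f x\<bar> powr p)"
    by (subst (asm) integrable_completion) auto
  then show "borel_rep f \<in> Lp_space p" using Lp_space_borel_iff[OF rm] by simp
  show "Lp_norm p (borel_rep f) = Lp_norm p f"
    using Lp_norm_cong_AE[OF fm rm' eq] by simp
qed

lemma Lp_space_add:
  assumes p: "p \<ge> 1" and "f \<in> Lp_space p" "g \<in> Lp_space p"
  shows "(\<lambda>x. f x + g x) \<in> Lp_space p"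
  using assms(2,3) integrable_powr_add(1)[OF p, of f lebesgue g] unfolding Lp_space_def by auto

lemma Lp_space_cmult: "f \<in> Lp_space p \<Longrightarrow> (\<lambda>x. c * f x) \<in> Lp_space p"
  using integrable_powr_cmult[of lebesgue f p c] unfolding Lp_space_def by auto

text \<open>A null set of points y is a null set of pairs (t, y), so the integrals agree at every
  x.\<close>

lemma S_int_cong_AE:
  fixes f g :: "real ^ 'd \<Rightarrow> real"
  assumes [measurable]: "f \<in> borel_measurable borel" "g \<in> borel_measurable borel"
    and eq: "AE x in lborel. f x = g x"
  shows "S_int f = S_int g"
proof
  fix x
  have "AE z in (lborel \<Otimes>\<^sub>M lborel :: (real \<times> (real ^ 'd)) measure). f (snd z) = g (snd z)"
  proof (rule lborel_pair.AE_pair_measure)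
    show "AE t in lborel. AE y in lborel. f (snd (t :: real, y)) = g (snd (t, y))"
      by (rule AE_I2) (simp add: eq)
  qed measurable
  then have "AE z in (lborel \<Otimes>\<^sub>M lborel). S_kernel x z * f (snd z) = S_kernel x z * g (snd z)"
    by eventually_elim simp
  then show "S_int f x = S_int g x"
    unfolding S_int_def by (intro integral_cong_AE) simp_all
qed

definition S_ext :: "(real ^ 'd \<Rightarrow> real) \<Rightarrow> real ^ 'd \<Rightarrow> real" where
  "S_ext f = S_int (borel_rep f)"

lemma S_ext_cong:
  assumes f: "f \<in> Lp_space p" and g: "g \<in> borel_measurable borel" and eq: "AE x in lborel. f x = g x"
  shows "S_ext f = S_int g"
  unfolding S_ext_def
proof (rule S_int_cong_AE)
  show "AE x in lborel. borel_rep f x = g x"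
    using Lp_space_rep(2)[OF f] eq by eventually_elim simp
qed (rule Lp_space_rep(1)[OF f], rule g)

lemma S_ext_bound:
  assumes p: "p \<ge> 1" and f: "f \<in> Lp_space p"
  shows "S_ext f \<in> Lp_space p" "Lp_norm p (S_ext f) \<le> 3 * Lp_norm p f"
proof -
  note r = Lp_space_rep[OF f]
  note b = S_int_Lp_bound[OF p r(1,3)]
  have m: "S_ext f \<in> borel_measurable borel" unfolding S_ext_def using r(1) by measurable
  then show "S_ext f \<in> Lp_space p" using b(2) by (simp add: Lp_space_borel_iff S_ext_def)
  have "Lp_norm p (S_ext f) = (LINT x|lborel. \<bar>S_int (borel_rep f) x\<bar> powr p) powr (1 / p)"
    using Lp_norm_borel[OF m] by (simp add: S_ext_def)
  also have "\<dots> \<le> (3 powr p * (LINT x|lborel. \<bar>borel_rep f x\<bar> powr p)) powr (1 / p)"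
    using p by (intro powr_mono2 b) (auto intro!: integral_nonneg_AE)
  also have "\<dots> = 3 * Lp_norm p (borel_rep f)"
    using p by (simp add: Lp_norm_borel[OF r(1)] powr_mult powr_powr)
  finally show "Lp_norm p (S_ext f) \<le> 3 * Lp_norm p f" by (simp add: r)
qed

text \<open>Only almost everywhere: the integral of the sum is split where both integrals converge.
  Scalars come out of any integral, so \<open>S_ext_cmult\<close> is an equality of
  functions.\<close>

lemma S_ext_add:
  assumes p: "p \<ge> 1" and f: "f \<in> Lp_space p" and g: "g \<in> Lp_space p"
  shows "Lp_eq (S_ext (\<lambda>x. f x + g x)) (\<lambda>x. S_ext f x + S_ext g x)"
proof -
  note rf = Lp_space_rep[OF f] and rg = Lp_space_rep[OF g]
  have ae: "AE x in lborel. f x + g x = borel_rep f x + borel_rep g x"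
    using rf(2) rg(2) by eventually_elim simp
  have "S_ext (\<lambda>x. f x + g x) = S_int (\<lambda>x. borel_rep f x + borel_rep g x)"
    using rf(1) rg(1) by (intro S_ext_cong[OF Lp_space_add[OF p f g] _ ae]) auto
  moreover have "AE x in lborel. S_int (\<lambda>x. borel_rep f x + borel_rep g x) x = S_ext f x + S_ext g x"
    using S_int_Lp_bound(1)[OF p rf(1,3)] S_int_Lp_bound(1)[OF p rg(1,3)]
    by eventually_elim (simp add: S_ext_def S_int_def distrib_left)
  ultimately show ?thesis by (simp add: Lp_eq_def AE_completion)
qed

lemma S_ext_cmult:
  assumes f: "f \<in> Lp_space p"
  shows "S_ext (\<lambda>x. c * f x) = (\<lambda>x. c * S_ext f x)"
proof -
  note rf = Lp_space_rep[OF f]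
  have ae: "AE x in lborel. c * f x = c * borel_rep f x"
    using rf(2) by eventually_elim simp
  have "S_ext (\<lambda>x. c * f x) = S_int (\<lambda>x. c * borel_rep f x)"
    using rf(1) by (intro S_ext_cong[OF Lp_space_cmult[OF f] _ ae]) auto
  then show ?thesis by (simp add: S_ext_def S_int_def mult.left_commute fun_eq_iff)
qed

lemma S_ext_bounded_operator:
  assumes p: "p \<ge> 1"
  shows "Lp_bounded_operator p S_ext"
  unfolding Lp_bounded_operator_def
proof (intro conjI ballI allI impI)
  show "S_ext f \<in> Lp_space p" if "f \<in> Lp_space p" for f :: "real ^ 'd \<Rightarrow> real"
    by (rule S_ext_bound[OF p that])
  show "Lp_eq (S_ext f) (S_ext g)" if f: "f \<in> Lp_space p" and g: "g \<in> Lp_space p" and "Lp_eq f g"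
    for f g :: "real ^ 'd \<Rightarrow> real"
  proof -
    have "AE x in lborel. f x = g x" using that(3) by (simp add: Lp_eq_def AE_completion_iff)
    then have "AE x in lborel. f x = borel_rep g x"
      using Lp_space_rep(2)[OF g] by eventually_elim simp
    from S_ext_cong[OF f Lp_space_rep(1)[OF g] this] show ?thesis by (simp add: S_ext_def Lp_eq_def)
  qed
  show "Lp_eq (S_ext (\<lambda>x. c * f x)) (\<lambda>x. c * S_ext f x)" if "f \<in> Lp_space p"
    for c and f :: "real ^ 'd \<Rightarrow> real"
    by (simp add: S_ext_cmult[OF that] Lp_eq_def)
  show "\<exists>C. \<forall>f\<in>Lp_space p. Lp_norm p (S_ext f) \<le> C * Lp_norm p (f :: real ^ 'd \<Rightarrow> real)"
    using S_ext_bound[OF p] by blast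
qed (rule S_ext_add[OF p])

lemma hermite_span_Lp_space: "p \<ge> 1 \<Longrightarrow> f \<in> hermite_span \<Longrightarrow> f \<in> Lp_space p"
  by (simp add: Lp_space_borel_iff borel_measurable_hermite_span hermite_span_integrable_powr)

lemma S_ext_extension:
  assumes p: "p \<ge> 1"
  shows "Lp_bounded_extension p hermite_span S_op S_ext"
  unfolding Lp_bounded_extension_def
proof (intro conjI S_ext_bounded_operator p ballI)
  fix f :: "real ^ 'd \<Rightarrow> real" assume f: "f \<in> hermite_span"
  have "S_ext f = S_int f"
    by (rule S_ext_cong[OF hermite_span_Lp_space[OF p f] borel_measurable_hermite_span[OF f]]) simp
  then show "Lp_eq (S_ext f) (S_op f)"
    by (simp add: S_int_eq_S_op[OF f] Lp_eq_def)
qed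

section \<open>Uniqueness of the extension and its norm\<close>

lemma Lp_norm_le_imp:
  assumes p: "p \<ge> 1" and "C \<ge> 0" and le: "Lp_norm p f \<le> C * Lp_norm p g"
  shows "(LINT x|lebesgue. \<bar>f x\<bar> powr p) \<le> C powr p * (LINT x|lebesgue. \<bar>g x\<bar> powr p)"
proof -
  have "(LINT x|lebesgue. \<bar>f x\<bar> powr p) = Lp_norm p f powr p"
    using p by (simp add: Lp_norm_def powr_powr integral_nonneg_AE)
  also have "\<dots> \<le> (C * Lp_norm p g) powr p"
    using p le by (intro powr_mono2) (auto simp: Lp_norm_def)
  also have "\<dots> = C powr p * (LINT x|lebesgue. \<bar>g x\<bar> powr p)"
    using p by (simp add: Lp_norm_def powr_mult powr_powr integral_nonneg_AE)
  finally show ?thesis .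
qed

text \<open>Split the Borel representative F as h + g with g in the span and h small. The operators
  agree on g, so their difference at F is their difference at h almost everywhere, which is small
  because both are bounded.\<close>

lemma Lp_bounded_extension_unique:
  fixes T T' :: "(real ^ 'd \<Rightarrow> real) \<Rightarrow> real ^ 'd \<Rightarrow> real"
  assumes p: "p \<ge> 1" and T: "Lp_bounded_extension p hermite_span S T"
    and T': "Lp_bounded_extension p hermite_span S T'" and f: "f \<in> Lp_space p"
  shows "Lp_eq (T' f) (T f)"
proof -
  have ex: "\<exists>C\<ge>0. \<forall>f\<in>Lp_space p. Lp_norm p (U f) \<le> C * Lp_norm p f"
    if U: "Lp_bounded_operator p U" for U :: "(real ^ 'd \<Rightarrow> real) \<Rightarrow> real ^ 'd \<Rightarrow> real"
  proof -
    have "\<exists>C. \<forall>f\<in>Lp_space p. Lp_norm p (U f) \<le> C * Lp_norm p f"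
      using U by (simp add: Lp_bounded_operator_def)
    then obtain C where C: "\<And>f. f \<in> Lp_space p \<Longrightarrow> Lp_norm p (U f) \<le> C * Lp_norm p f"
      by blast
    have "Lp_norm p (U f) \<le> \<bar>C\<bar> * Lp_norm p f" if "f \<in> Lp_space p" for f
    proof -
      have "C * Lp_norm p f \<le> \<bar>C\<bar> * Lp_norm p f" by (intro mult_right_mono) (auto simp: Lp_norm_def)
      then show ?thesis using C[OF that] by linarith
    qed
    then show ?thesis by (intro exI[of _ "\<bar>C\<bar>"]) auto
  qed
  have bT: "Lp_bounded_operator p T" and bT': "Lp_bounded_operator p T'"
    using T T' by (auto simp: Lp_bounded_extension_def)
  obtain C where C: "C \<ge> 0" "\<And>f. f \<in> Lp_space p \<Longrightarrow> Lp_norm p (T f) \<le> C * Lp_norm p f"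
    using ex[OF bT] by blast
  obtain C' where C': "C' \<ge> 0" "\<And>f. f \<in> Lp_space p \<Longrightarrow> Lp_norm p (T' f) \<le> C' * Lp_norm p f"
    using ex[OF bT'] by blast
  define F where "F = borel_rep f"
  note rf = Lp_space_rep[OF f, folded F_def]
  define D where "D x = T' F x - T F x" for x
  have TF: "T F \<in> Lp_space p" "T' F \<in> Lp_space p"
    using bT bT' rf(4) by (auto simp: Lp_bounded_operator_def)
  have D: "D \<in> Lp_space p"
    using Lp_space_add[OF p TF(2) Lp_space_cmult[OF TF(1), of "- 1"]] by (simp add: D_def[abs_def])
  \<comment> \<open>The factor 2^p is the constant of \<open>powr_add_le\<close>; the summands are
    the two operator bounds to the power p.\<close>
  define K where "K = 2 powr p * (C' powr p + C powr p)"
  have small: "(LINT x|lebesgue. \<bar>D x\<bar> powr p) \<le> K * \<epsilon>" if \<epsilon>: "\<epsilon> > 0" for \<epsilon>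
  proof -
    obtain g where g: "g \<in> hermite_span" "(LINT x|lborel. \<bar>F x - g x\<bar> powr p) < \<epsilon>"
      using Lp_closureD(3)[OF hermite_span_dense[OF p rf(1,3)] \<epsilon>] by blast
    have gL: "g \<in> Lp_space p" by (rule hermite_span_Lp_space[OF p g(1)])
    define h where "h x = F x - g x" for x
    have hL: "h \<in> Lp_space p"
      using Lp_space_add[OF p rf(4) Lp_space_cmult[OF gL, of "- 1"]] by (simp add: h_def[abs_def])
    have h_int: "(LINT x|lebesgue. \<bar>h x\<bar> powr p) \<le> \<epsilon>"
      using g(2) rf(1) borel_measurable_hermite_span[OF g(1)]
      by (subst integral_completion) (auto simp: h_def)
    have F: "F = (\<lambda>x. h x + g x)" by (simp add: h_def)
    have eqT: "Lp_eq (T F) (\<lambda>x. T h x + T g x)" and eqT': "Lp_eq (T' F) (\<lambda>x. T' h x + T' g x)"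
      using bT bT' hL gL unfolding F by (auto simp: Lp_bounded_operator_def)
    have eqg: "Lp_eq (T g) (S g)" "Lp_eq (T' g) (S g)"
      using T T' g(1) by (auto simp: Lp_bounded_extension_def)
    have ThL: "T h \<in> Lp_space p" "T' h \<in> Lp_space p"
      using bT bT' hL by (auto simp: Lp_bounded_operator_def)
    have ThL': "(\<lambda>x. - 1 * T h x) \<in> Lp_space p" by (rule Lp_space_cmult[OF ThL(1)])
    have sumL: "(\<lambda>x. T' h x + - 1 * T h x) \<in> Lp_space p" by (rule Lp_space_add[OF p ThL(2) ThL'])
    have "AE x in lebesgue. D x = T' h x + - 1 * T h x"
      using eqT eqT' eqg unfolding Lp_eq_def by eventually_elim (simp add: D_def)
    then have "AE x in lebesgue. \<bar>D x\<bar> powr p = \<bar>T' h x + - 1 * T h x\<bar> powr p"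
      by eventually_elim simp
    then have "(LINT x|lebesgue. \<bar>D x\<bar> powr p) = (LINT x|lebesgue. \<bar>T' h x + - 1 * T h x\<bar> powr p)"
      using D sumL unfolding Lp_space_def by (intro integral_cong_AE) auto
    also have "\<dots> \<le> 2 powr p * ((LINT x|lebesgue. \<bar>T' h x\<bar> powr p) + (LINT x|lebesgue. \<bar>- 1 * T h x\<bar> powr p))"
      using ThL(2) ThL' unfolding Lp_space_def by (intro integrable_powr_add(2)[OF p]) auto
    also have "\<dots> \<le> 2 powr p * (C' powr p * \<epsilon> + C powr p * \<epsilon>)"
    proof -
      have "(LINT x|lebesgue. \<bar>T' h x\<bar> powr p) \<le> C' powr p * \<epsilon>"
        using Lp_norm_le_imp[OF p C'(1) C'(2)[OF hL]] mult_left_mono[OF h_int, of "C' powr p"] by simp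
      moreover have "(LINT x|lebesgue. \<bar>- 1 * T h x\<bar> powr p) \<le> C powr p * \<epsilon>"
        using Lp_norm_le_imp[OF p C(1) C(2)[OF hL]] mult_left_mono[OF h_int, of "C powr p"] by simp
      ultimately show ?thesis by (intro mult_left_mono add_mono) auto
    qed
    finally show ?thesis by (simp add: K_def algebra_simps)
  qed
  have "K \<ge> 0" by (simp add: K_def)
  have "(LINT x|lebesgue. \<bar>D x\<bar> powr p) \<le> 0"
  proof (rule field_le_epsilon)
    fix e :: real assume "e > 0"
    \<comment> \<open>The denominator is \<open>K + 1\<close> because K may be 0.\<close>
    then have "(LINT x|lebesgue. \<bar>D x\<bar> powr p) \<le> K * (e / (K + 1))"
      using \<open>K \<ge> 0\<close> by (intro small) auto
    also have "\<dots> \<le> e" using \<open>K \<ge> 0\<close> \<open>e > 0\<close> by (simp add: field_simps)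
    finally show "(LINT x|lebesgue. \<bar>D x\<bar> powr p) \<le> 0 + e" by simp
  qed
  then have "(LINT x|lebesgue. \<bar>D x\<bar> powr p) = 0"
    by (intro antisym integral_nonneg_AE) auto
  then have "AE x in lebesgue. \<bar>D x\<bar> powr p = 0"
    using D integral_nonneg_eq_0_iff_AE[of lebesgue "\<lambda>x. \<bar>D x\<bar> powr p"] by (simp add: Lp_space_def)
  then have "Lp_eq (T' F) (T F)"
    unfolding Lp_eq_def by eventually_elim (simp add: D_def)
  moreover have "Lp_eq (T' f) (T' F)" "Lp_eq (T f) (T F)"
    using bT bT' f rf(4,5) by (auto simp: Lp_bounded_operator_def)
  ultimately show ?thesis
    unfolding Lp_eq_def by eventually_elim simp
qed

lemma S_ext_onorm:
  assumes p: "p \<ge> 1"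
  shows "Lp_onorm p (S_ext :: (real ^ 'd \<Rightarrow> real) \<Rightarrow> real ^ 'd \<Rightarrow> real) \<le> 3"
  unfolding Lp_onorm_def
proof (rule cSUP_least)
  have "(\<lambda>x. 0 :: real) \<in> Lp_space p" by (rule hermite_span_Lp_space[OF p hermite_span_zero])
  then show "(Lp_space p :: (real ^ 'd \<Rightarrow> real) set) \<noteq> {}" by blast
  fix f :: "real ^ 'd \<Rightarrow> real" assume "f \<in> Lp_space p"
  from S_ext_bound(2)[OF p this] show "Lp_norm p (S_ext f) / Lp_norm p f \<le> 3"
    by (cases "Lp_norm p f = 0") (auto simp: divide_le_eq Lp_norm_def)
qed

theorem theorem8:
  fixes p :: real
  assumes "1 \<le> p"
  shows "\<exists>T :: (real ^ 'd \<Rightarrow> real) \<Rightarrow> real ^ 'd \<Rightarrow> real.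
           Lp_bounded_extension p hermite_span S_op T \<and>
           Lp_onorm p T \<le> 3 \<and>
           (\<forall>T'. Lp_bounded_extension p hermite_span S_op T' \<longrightarrow>
                  (\<forall>f\<in>Lp_space p. Lp_eq (T' f) (T f)))"
proof (intro exI[of _ S_ext] conjI allI impI ballI)
  show "Lp_bounded_extension p hermite_span S_op (S_ext :: (real ^ 'd \<Rightarrow> real) \<Rightarrow> real ^ 'd \<Rightarrow> real)"
    by (rule S_ext_extension[OF assms])
  show "Lp_onorm p (S_ext :: (real ^ 'd \<Rightarrow> real) \<Rightarrow> real ^ 'd \<Rightarrow> real) \<le> 3"
    by (rule S_ext_onorm[OF assms])
qed (rule Lp_bounded_extension_unique[OF assms S_ext_extension[OF assms]])

end
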